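(* Assume $m=n$ for all $n$. Assume that $\mu_{X_n}$ converges almost surely weakly to a non-random compactly supported probability measure $\mu_X$, that the smallest singular value of $X_n$ converges almost surely to $a:=\inf\operatorname{supp}\mu_X$, and that $\nu$ has mean zero, variance one and satisfies a log-Sobolev inequality. Let $r=1$, $\theta:=\theta_1$, and $\widetilde X_n=X_n+P_n$, with $P_n$ built according to either the i.i.d. model or the orthonormalized model. Let $\widetilde\sigma_n$ be the smallest singular value of $\widetilde X_n$ and let $\widetilde u,\widetilde v$ be associated left and right unit singular vectors. Suppose that $$a>0,\qquad\theta\le\underline\theta\qquad\text{and}\qquad\varphi_{\mu_X}'(a^-)=-\infty.$$ Then, as $n\to\infty$, $$\langle\widetilde u,\ker(\theta^2I_n-P_nP_n^* )\rangle\xrightarrow{\ \mathrm{a.s.}\ }0\qquad\text{and}\qquad\langle\widetilde v,\ker(\theta^2I_n-P_n^*P_n)\rangle\xrightarrow{\ \mathrm{a.s.}\ }0.$$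
   Context: Let $\mathbb K=\mathbb R$ or $\mathbb C$. $X_n$ is an $n\times n$ random matrix with entries in $\mathbb K$, with singular values $\sigma_1\ge\cdots\ge\sigma_n$, and $\mu_{X_n}=\frac1n\sum_{i=1}^n\delta_{\sigma_i}$. Perturbation (case $r=1$). Let $\theta_1>0$ be deterministic and independent of $n$, and let $\nu$ be a probability measure on $\mathbb K$. For every $n$ let $G_u^{(n)}$, $G_v^{(n)}$ be independent $n\times1$ vectors with i.i.d. entries of law $\nu$; the families $(G_u^{(n)},G_v^{(n)})_n$ and $(X_n)_n$ are independent. i.i.d. model: $u_1=\frac1{\sqrt n}G_u^{(n)}$, $v_1=\frac1{\sqrt n}G_v^{(n)}$. Orthonormalized model: $u_1$, $v_1$ are $G_u^{(n)}$, $G_v^{(n)}$ normalized to have norm one (well defined with probability tending to one). Set $P_n=\theta_1u_1v_1^*$ and $\widetilde X_n=X_n+P_n$. Log-Sobolev inequality: there is a constant $C>0$ such that $\int f^2\log\frac{f^2}{\int f^2d\nu}\,d\nu\le 2C\int|\nabla f|^2d\nu$ for all continuously differentiable $f\in L^2(\nu)$ (with $\mathbb C$ identified with $\mathbb R^2$). $\varphi_{\mu_X}(z)=\int\frac{z}{z^2-t^2}d\mu_X(t)$ for $z\in(0,a)$, where it is negative. With $\varphi_{\mu_X}(a^-)=\lim_{z\uparrow a}\varphi_{\mu_X}(z)$ and $\varphi_{\mu_X}'(a^-)=\lim_{z\uparrow a}\varphi_{\mu_X}'(z)$, the threshold is $\underline\theta=(-\varphi_{\mu_X}(a^-))^{-1}$,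 with the convention $(+\infty)^{-1}=0$. For a vector $x$ and a subspace $F$, $\langle x,F\rangle$ denotes the norm of the orthogonal projection of $x$ onto $F$. Left and right unit singular vectors $\widetilde u,\widetilde v$ associated with $\sigma$ form a matching pair: $\widetilde X_n\widetilde v=\sigma\widetilde u$, $\widetilde X_n^*\widetilde u=\sigma\widetilde v$. *)

theory Defs
  imports
    "HOL-Probability.Probability"
    "HOL-Computational_Algebra.Fundamental_Theorem_Algebra"
    "Jordan_Normal_Form.Char_Poly"
    "Jordan_Normal_Form.Matrix_Kernel"
    "Jordan_Normal_Form.Schur_Decomposition"
begin

unbundle no vec_syntax
unbundle no inner_syntax

text \<open>
  The scalar field is \<open>\<real>\<close> or \<open>\<complex>\<close>: the axioms say that the type is one of these two fields, with
  its absolute value, its conjugation, and the Euclidean structure of \<open>\<real>\<close> or \<open>\<real>\<^sup>2\<close>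
  (the inner product is determined by the norm).
\<close>

class real_or_complex = real_normed_field + euclidean_space + conjugatable_field +
  assumes mult_conjugate_eq: "x * conjugate x = ((norm x)\<^sup>2) *\<^sub>R 1"
  assumes real_or_complex:
    "(\<forall>x. \<exists>r. x = r *\<^sub>R 1) \<or>
     (\<exists>i. i * i = - 1 \<and> (\<forall>x. \<exists>r s. x = r *\<^sub>R 1 + s *\<^sub>R i))"

instance real :: real_or_complex
proof
  fix x :: real
  show "x * conjugate x = ((norm x)\<^sup>2) *\<^sub>R 1"
    by (simp add: power2_eq_square)
  show "(\<forall>x::real. \<exists>r. x = r *\<^sub>R 1) \<or>
     (\<exists>i::real. i * i = - 1 \<and> (\<forall>x. \<exists>r s. x = r *\<^sub>R 1 + s *\<^sub>R i))"
    by auto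
qed

instance complex :: real_or_complex
proof
  fix x :: complex
  show "x * conjugate x = ((norm x)\<^sup>2) *\<^sub>R 1"
    by (simp add: complex_norm_square[symmetric] scaleR_conv_of_real del: of_real_power)
  have "y = Re y *\<^sub>R 1 + Im y *\<^sub>R \<i>" for y :: complex
    by (simp add: complex_eq_iff)
  then have "\<i> * \<i> = - 1 \<and> (\<forall>y. \<exists>r s. y = r *\<^sub>R 1 + s *\<^sub>R \<i>)"
    by (metis i_squared)
  then show "(\<forall>x::complex. \<exists>r. x = r *\<^sub>R 1) \<or>
     (\<exists>i::complex. i * i = - 1 \<and> (\<forall>x. \<exists>r s. x = r *\<^sub>R 1 + s *\<^sub>R i))"
    by blast
qed

definition l2_norm :: "'k::real_normed_vector vec \<Rightarrow> real" where
  "l2_norm x = sqrt (\<Sum>i<dim_vec x. (norm (x $ i))\<^sup>2)"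

definition orth_proj :: "'k::conjugatable_ring vec set \<Rightarrow> 'k vec \<Rightarrow> 'k vec" where
  "orth_proj F x = (THE p. p \<in> F \<and> (\<forall>w\<in>F. (x - p) \<bullet>c w = 0))"

definition proj_norm :: "'k::real_or_complex vec \<Rightarrow> 'k vec set \<Rightarrow> real" where
  "proj_norm x F = l2_norm (orth_proj F x)"

text \<open>
  The singular values with multiplicity, in nonincreasing order, are the square roots of the
  eigenvalues of \<open>A\<^sup>*A\<close>. These eigenvalues are nonnegative reals seen in \<open>'k\<close>; \<open>norm\<close> only moves
  them to type \<^typ>\<open>real\<close>.
\<close>

definition singular_values :: "'k::real_or_complex mat \<Rightarrow> real list" where
  "singular_values A = rev (sorted_list_of_multiset
     (image_mset (\<lambda>l. sqrt (norm l)) (proots (char_poly (mat_adjoint A * A)))))"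

definition smallest_singular_value :: "'k::real_or_complex mat \<Rightarrow> real" where
  "smallest_singular_value A = last (singular_values A)"

definition singular_value_measure :: "'k::real_or_complex mat \<Rightarrow> real measure" where
  "singular_value_measure A =
     distr (uniform_count_measure {..<dim_col A}) borel (\<lambda>i. singular_values A ! i)"

definition singular_vector_pair ::
  "'k::real_or_complex mat \<Rightarrow> real \<Rightarrow> 'k vec \<Rightarrow> 'k vec \<Rightarrow> bool" where
  "singular_vector_pair A s x y \<longleftrightarrow>
     x \<in> carrier_vec (dim_row A) \<and> y \<in> carrier_vec (dim_col A) \<and>
     l2_norm x = 1 \<and> l2_norm y = 1 \<and>
     A *\<^sub>v y = of_real s \<cdot>\<^sub>v x \<and> mat_adjoint A *\<^sub>v x = of_real s \<cdot>\<^sub>v y"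

definition generated_sigma ::
  "'w measure \<Rightarrow> ('i \<Rightarrow> 'w \<Rightarrow> 'a::topological_space) \<Rightarrow> 'i set \<Rightarrow> 'w set set" where
  "generated_sigma M Y I =
     sigma_sets (space M) (\<Union>i\<in>I. {Y i -` A \<inter> space M | A. A \<in> sets borel})"

definition measure_support :: "'a::topological_space measure \<Rightarrow> 'a set" where
  "measure_support \<mu> = {x. \<forall>U. open U \<longrightarrow> x \<in> U \<longrightarrow> emeasure \<mu> U > 0}"

text \<open>
  \<open>f\<close> ranges over real-valued \<open>C\<^sup>1\<close> functions in \<open>L\<^sup>2(\<nu>)\<close>, with gradient \<open>g\<close>. The right-hand side is
  \<open>+\<infinity>\<close> when \<open>norm (g x)\<^sup>2\<close> is not integrable, and nothing is claimed then. The negative part of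
  the entropy integrand is bounded, so when the right-hand side is finite the inequality includes
  integrability of that integrand. The convention \<open>0 log 0 = 0\<close> is automatic.
\<close>

definition log_sobolev :: "'k::euclidean_space measure \<Rightarrow> bool" where
  "log_sobolev \<nu> \<longleftrightarrow> (\<exists>C>0. \<forall>(f :: 'k \<Rightarrow> real) g.
     (\<forall>x. GDERIV f x :> g x) \<longrightarrow> continuous_on UNIV g \<longrightarrow>
     integrable \<nu> (\<lambda>x. (f x)\<^sup>2) \<longrightarrow> integrable \<nu> (\<lambda>x. (norm (g x))\<^sup>2) \<longrightarrow>
       integrable \<nu> (\<lambda>x. (f x)\<^sup>2 * ln ((f x)\<^sup>2 / (\<integral>y. (f y)\<^sup>2 \<partial>\<nu>))) \<and>
       (\<integral>x. (f x)\<^sup>2 * ln ((f x)\<^sup>2 / (\<integral>y. (f y)\<^sup>2 \<partial>\<nu>)) \<partial>\<nu>)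
         \<le> 2 * C * (\<integral>x. (norm (g x))\<^sup>2 \<partial>\<nu>))"

definition phi :: "real measure \<Rightarrow> real \<Rightarrow> real" where
  "phi \<mu> z = (\<integral>t. z / (z\<^sup>2 - t\<^sup>2) \<partial>\<mu>)"

text \<open>The limit is taken in \<^typ>\<open>ereal\<close>, where \<open>inverse \<infinity> = 0\<close>.\<close>

definition lower_threshold :: "real measure \<Rightarrow> ereal" where
  "lower_threshold \<mu> =
     inverse (- Lim (at_left (Inf (measure_support \<mu>))) (\<lambda>z. ereal (phi \<mu> z)))"

datatype perturbation_model = IID | Orthonormalized

text \<open>
  Normalizing \<open>g = 0\<close> is undefined mathematically; here it gives \<open>0\<close>, because \<open>1 / 0 = 0\<close>.
\<close>

fun model_vec :: "perturbation_model \<Rightarrow> 'k::real_or_complex vec \<Rightarrow> 'k vec" where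
  "model_vec IID g = of_real (1 / sqrt (real (dim_vec g))) \<cdot>\<^sub>v g"
| "model_vec Orthonormalized g = of_real (1 / l2_norm g) \<cdot>\<^sub>v g"

definition outer :: "'k::conjugatable_ring vec \<Rightarrow> 'k vec \<Rightarrow> 'k mat" where
  "outer x y = mat (dim_vec x) (dim_vec y) (\<lambda>(i, j). x $ i * conjugate (y $ j))"

end

theory Submission
  imports Defs
begin

text \<open>Let X = sum_l s_l z_l w_l^* be a singular value decomposition. Let U and V be the
  coordinates of u in the basis z and of v in the basis w, and U', V' those of the singular vectors
  ut, vt of the perturbed matrix at its smallest singular value \<sigma>. With the overlaps \<alpha>
  = <vt, v> and \<beta> = <ut, u>, the singular vector equations read s V' + \<theta> \<alpha> U =
  \<sigma> U' and s U' + \<theta> \<beta> V = \<sigma> V'. Eliminating V' gives (\<sigma>^2 - s^2)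
  U' = \<theta> (\<alpha> \<sigma> U + \<beta> s V), and symmetrically for V'. The kernel of
  \<theta>^2 - P P^* is contained in the line through u
  (\<open>proj_norm_rank_one_kernel_le\<close>), so the theorem reduces to \<alpha> -> 0 and \<beta>
  -> 0 (\<open>alpha_beta_tendsto_0\<close>).

  Randomness enters through concentration only. The log-Sobolev inequality gives \<nu> an
  exponential moment (\<open>log_sobolev_exp_moment\<close>), hence all moments. A centred quadratic
  form g^* A g - tr A in n such coordinates, with rows and columns of A of norm at most 1, has
  fourth moment O(n^2) (\<open>quadratic_form_E4\<close>). Divided by n it tends to 0 almost surely,
  also when A is a function of the independent matrix X (\<open>AE_centered_form_tendsto_0\<close>).
  For A built from powers of the inverse of 1 + X X^* this says that the weights |U_l|^2 and
  |V_l|^2, placed at the singular values, converge to \<mu>, while the cross weights V_l cnj(U_l)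
  average out. The variable y = 1/(1 + s^2) lives in [0,1] however large s is, and Weierstrass
  approximation passes from powers of y to continuous functions of y
  (\<open>moments_imp_continuous\<close>).

  The rest is deterministic. It suffices to treat a subsequence along which \<sigma>, \<alpha>,
  \<beta> tend to b, \<alpha>0, \<beta>0. A rank one perturbation cannot lift the smallest singular
  value above the second smallest of X, so b <= a (\<open>rank_one_interlacing\<close>,
  \<open>\<sigma>_upper\<close>). If b < a, dividing by \<sigma>^2 - s^2 and pairing with U yields
  \<beta>0 = \<theta> phi(b) \<alpha>0, and symmetrically \<alpha>0 = \<theta> phi(b) \<beta>0
  (\<open>interior_equation\<close>). Up to the threshold |\<theta> phi(b)| < 1
  (\<open>subthreshold\<close>), so both limits vanish. If b = a, the normalization of U' bounds a^2
  |\<alpha>0|^2 times the integral of 1/((t^2 - a^2)^2 + \<eta>^2) by 2/\<theta>^2 for every \<eta>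
  > 0 (\<open>edge_bound\<close>). These integrals are unbounded because phi'(a-) is minus infinity
  (\<open>edge_integral_unbounded\<close>), so \<alpha>0 = 0, and likewise \<beta>0 = 0.\<close>

section \<open>Exponential moments from the log-Sobolev inequality\<close>

text \<open>Young's inequality for the convex pair x ln x - x and exp. Integrated, it bounds the
  mass that a probability density puts on a set by the entropy of the density.\<close>

lemma entropy_duality:
  fixes x y :: real
  assumes "x \<ge> 0"
  shows "x * y \<le> x * ln x - x + exp y"
proof (cases "x = 0")
  case False
  then have "x > 0" using assms by simp
  have "1 + (y - ln x) \<le> exp (y - ln x)" by (rule exp_ge_add_one_self)
  then have "x * (1 + (y - ln x)) \<le> x * exp (y - ln x)" using \<open>x > 0\<close> by (simp add: mult_left_mono)
  also have "x * exp (y - ln x) = exp y" using \<open>x > 0\<close> by (simp add: exp_diff)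
  finally show ?thesis by (simp add: algebra_simps)
qed simp

text \<open>A C^1 substitute for the norm, since the log-Sobolev inequality speaks of C^1
  functions.\<close>

definition smooth_norm :: "'k::real_inner \<Rightarrow> real" where
  "smooth_norm x = sqrt (1 + inner x x)"

text \<open>Bounded by 1/\<epsilon>, so that its exponential is square integrable before any moment
  of \<nu> is known. As \<epsilon> tends to 0 it tends to \<open>smooth_norm\<close>.\<close>

definition trunc_norm :: "real \<Rightarrow> 'k::real_inner \<Rightarrow> real" where
  "trunc_norm \<epsilon> x = smooth_norm x / (1 + \<epsilon> * smooth_norm x)"

lemma smooth_norm_ge: "1 \<le> smooth_norm x" "norm x \<le> smooth_norm x"
  by (auto simp: smooth_norm_def norm_eq_sqrt_inner intro!: real_sqrt_le_mono)

lemma trunc_norm_bounds: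
  assumes "\<epsilon> > 0"
  shows "0 \<le> trunc_norm \<epsilon> x" "trunc_norm \<epsilon> x \<le> 1 / \<epsilon>" "trunc_norm \<epsilon> x \<le> smooth_norm x"
proof -
  have s: "1 \<le> smooth_norm x" by (rule smooth_norm_ge)
  show "0 \<le> trunc_norm \<epsilon> x" using s assms by (simp add: trunc_norm_def)
  have p: "0 < 1 + \<epsilon> * smooth_norm x" using s assms by (simp add: add_pos_nonneg)
  show "trunc_norm \<epsilon> x \<le> 1 / \<epsilon>" using p assms by (simp add: trunc_norm_def field_simps)
  show "trunc_norm \<epsilon> x \<le> smooth_norm x" using p s assms
    by (simp add: trunc_norm_def pos_divide_le_eq algebra_simps)
qed

text \<open>This gradient has norm at most 1 for every \<epsilon> > 0, which is why the exponential
  bound below is uniform in \<epsilon>.\<close>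

lemma GDERIV_trunc_norm:
  assumes "\<epsilon> > 0"
  shows "GDERIV (trunc_norm \<epsilon>) x :>
    (1 / (smooth_norm x * (1 + \<epsilon> * smooth_norm x)\<^sup>2)) *\<^sub>R x"
proof -
  have p: "0 < 1 + inner x x" by (simp add: add_pos_nonneg)
  have s: "1 \<le> smooth_norm x" by (rule smooth_norm_ge)
  have q: "0 < 1 + \<epsilon> * smooth_norm x" using s assms by (simp add: add_pos_nonneg)
  have d1: "GDERIV (\<lambda>x. 1 + inner x x) x :> 2 *\<^sub>R x"
    unfolding gderiv_def
    by (auto intro!: derivative_eq_intros simp: inner_commute)
  have d2: "DERIV sqrt (1 + inner x x) :> inverse (smooth_norm x) / 2"
    using DERIV_real_sqrt[OF p] by (simp add: smooth_norm_def)
  have d3: "GDERIV smooth_norm x :> (inverse (smooth_norm x)) *\<^sub>R x"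
    using GDERIV_DERIV_compose[OF d1 d2] by (simp add: smooth_norm_def[abs_def] o_def)
  have d4: "DERIV (\<lambda>t. t / (1 + \<epsilon> * t)) (smooth_norm x) :> 1 / (1 + \<epsilon> * smooth_norm x)\<^sup>2"
    using q by (auto intro!: derivative_eq_intros simp: power2_eq_square field_simps)
  show ?thesis
    using GDERIV_DERIV_compose[OF d3 d4] by (simp add: trunc_norm_def[abs_def] o_def field_simps)
qed

lemma continuous_smooth_norm [continuous_intros]:
  "continuous_on S f \<Longrightarrow> continuous_on S (\<lambda>x. smooth_norm (f x))"
  unfolding smooth_norm_def by (intro continuous_intros)

text \<open>For f = exp(\<delta> \<open>trunc_norm\<close>) one has |grad f| <= \<delta> f, so the
  log-Sobolev inequality says that the density w = f^2/m, where m is the integral of f^2, has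
  entropy at most 1/2. A density of such small entropy leaves at least half of its mass on a large
  ball, and there f^2 is at most a constant. This bounds m independently of \<epsilon>, and Fatou's
  lemma removes the truncation.\<close>

lemma log_sobolev_exp_moment:
  fixes \<nu> :: "'k::euclidean_space measure"
  assumes "prob_space \<nu>" and sets: "sets \<nu> = sets borel" and lsi: "log_sobolev \<nu>"
  obtains \<delta> where "\<delta> > 0" "integrable \<nu> (\<lambda>x. exp (\<delta> * smooth_norm x))"
proof -
  interpret prob_space \<nu> by fact
  have space [simp]: "space \<nu> = UNIV" using sets_eq_imp_space_eq[OF sets] by simp
  have meas: "f \<in> borel_measurable \<nu>" if "continuous_on UNIV f" for f :: "'k \<Rightarrow> real"
    using borel_measurable_continuous_onI[OF that] sets by (simp add: measurable_def)
  obtain C where C: "C > 0" and L: "\<And>(f :: 'k \<Rightarrow> real) g.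
     (\<forall>x. GDERIV f x :> g x) \<Longrightarrow> continuous_on UNIV g \<Longrightarrow>
     integrable \<nu> (\<lambda>x. (f x)\<^sup>2) \<Longrightarrow> integrable \<nu> (\<lambda>x. (norm (g x))\<^sup>2) \<Longrightarrow>
       integrable \<nu> (\<lambda>x. (f x)\<^sup>2 * ln ((f x)\<^sup>2 / (\<integral>y. (f y)\<^sup>2 \<partial>\<nu>))) \<and>
       (\<integral>x. (f x)\<^sup>2 * ln ((f x)\<^sup>2 / (\<integral>y. (f y)\<^sup>2 \<partial>\<nu>)) \<partial>\<nu>)
         \<le> 2 * C * (\<integral>x. (norm (g x))\<^sup>2 \<partial>\<nu>)"
    using lsi unfolding log_sobolev_def by blast
  \<comment> \<open>The log-Sobolev bound is 2 C \<delta>^2 times the integral of f^2; this choice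
    makes the factor 1/2.\<close>
  define \<delta> where "\<delta> = sqrt (1 / (4 * C))"
  have \<delta>: "\<delta> > 0" and \<delta>2: "C * \<delta>\<^sup>2 = 1 / 4" using C by (auto simp: \<delta>_def)
  \<comment> \<open>The level 1/16 is chosen so that (e^2 - 1)/16 <= 1/2, using e^2 <= 9.\<close>
  have "\<exists>K. prob {x. norm x > real K} \<le> 1/16"
  proof -
    have "(\<lambda>K. prob {x. norm x > real K}) \<longlonglongrightarrow> prob (\<Inter>K. {x. norm x > real K})"
      by (rule finite_Lim_measure_decseq) (auto simp: decseq_def sets open_Collect_less continuous_intros intro!: borel_open)
    also have "(\<Inter>K. {x::'k. norm x > real K}) = {}"
    proof -
      have "\<exists>K. \<not> norm x > real K" for x :: 'k
        using reals_Archimedean2[of "norm x"] less_asym by metis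
      then show ?thesis by auto
    qed
    finally have "(\<lambda>K. prob {x. norm x > real K}) \<longlonglongrightarrow> 0" by simp
    then have "eventually (\<lambda>K. prob {x. norm x > real K} < 1/16) sequentially"
      by (rule order_tendstoD) simp
    then show ?thesis by (auto simp: eventually_sequentially intro: less_imp_le)
  qed
  then obtain K where K: "prob {x. norm x > real K} \<le> 1/16" by blast
  \<comment> \<open>Half of \<open>B\<close> dominates f^2 on the ball of radius
    \<open>K\<close>.\<close>
  define B where "B = 2 * exp (2 * \<delta> * sqrt (1 + (real K)\<^sup>2))"
  have bound: "(\<integral>x. exp (2 * \<delta> * trunc_norm \<epsilon> x) \<partial>\<nu>) \<le> B" if \<epsilon>: "\<epsilon> > 0" for \<epsilon>
  proof -
    define f where "f = (\<lambda>x::'k. exp (\<delta> * trunc_norm \<epsilon> x))"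
    define g where "g = (\<lambda>x::'k. (\<delta> * f x) *\<^sub>R ((1 / (smooth_norm x * (1 + \<epsilon> * smooth_norm x)\<^sup>2)) *\<^sub>R x))"
    have pos: "smooth_norm x > 0" "1 + \<epsilon> * smooth_norm x > 0" for x :: 'k
      using smooth_norm_ge(1)[of x] \<epsilon> by (auto simp: add_pos_nonneg)
    have cf: "continuous_on UNIV f"
      unfolding f_def trunc_norm_def using pos by (auto intro!: continuous_intros simp: less_imp_neq[THEN not_sym])
    have cg: "continuous_on UNIV g"
      unfolding g_def using pos cf by (auto intro!: continuous_intros simp: less_imp_neq[THEN not_sym])
    have df: "GDERIV f x :> g x" for x
    proof -
      have "DERIV (\<lambda>t. exp (\<delta> * t)) (trunc_norm \<epsilon> x) :> \<delta> * f x"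
        by (auto intro!: derivative_eq_intros simp: f_def)
      from GDERIV_DERIV_compose[OF GDERIV_trunc_norm[OF \<epsilon>] this]
      show ?thesis by (simp add: f_def[abs_def] g_def o_def)
    qed
    have fpos: "f x > 0" for x by (simp add: f_def)
    have fle: "f x \<le> exp (\<delta> / \<epsilon>)" for x
      unfolding f_def using trunc_norm_bounds(2)[OF \<epsilon>, of x] \<delta> 
      by (simp, metis mult_left_mono less_imp_le times_divide_eq_right mult.right_neutral)
    have f2: "(f x)\<^sup>2 = exp (2 * \<delta> * trunc_norm \<epsilon> x)" for x
      unfolding f_def by (simp add: exp_double[symmetric] mult_ac)
    have gle: "(norm (g x))\<^sup>2 \<le> \<delta>\<^sup>2 * (f x)\<^sup>2" for x
    proof -
      have "norm x / (smooth_norm x * (1 + \<epsilon> * smooth_norm x)\<^sup>2) \<le> 1"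
      proof -
        have "1 \<le> (1 + \<epsilon> * smooth_norm x)\<^sup>2" using \<epsilon> pos(1)[of x] by (intro one_le_power) simp
        then have "smooth_norm x * 1 \<le> smooth_norm x * (1 + \<epsilon> * smooth_norm x)\<^sup>2"
          using pos(1)[of x] by (intro mult_left_mono) auto
        then have "norm x \<le> smooth_norm x * (1 + \<epsilon> * smooth_norm x)\<^sup>2"
          using smooth_norm_ge(2)[of x] by simp
        then show ?thesis using pos[of x] by (simp add: divide_le_eq_1)
      qed
      then have "norm (g x) \<le> \<delta> * f x"
        using \<delta> fpos[of x] pos[of x]
          mult_left_mono[of "norm x / (smooth_norm x * (1 + \<epsilon> * smooth_norm x)\<^sup>2)" 1 "\<delta> * f x"]
        unfolding g_def by (simp add: abs_mult)
      then have "(norm (g x))\<^sup>2 \<le> (\<delta> * f x)\<^sup>2" by (intro power_mono) auto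
      then show ?thesis by (simp add: power_mult_distrib)
    qed
    have if2: "integrable \<nu> (\<lambda>x. (f x)\<^sup>2)"
    proof (rule integrable_const_bound[where B = "(exp (\<delta> / \<epsilon>))\<^sup>2"])
      show "AE x in \<nu>. norm ((f x)\<^sup>2) \<le> (exp (\<delta> / \<epsilon>))\<^sup>2"
        using fle fpos by (auto intro!: power_mono simp: less_imp_le)
      show "(\<lambda>x. (f x)\<^sup>2) \<in> borel_measurable \<nu>"
        by (intro meas continuous_intros cf)
    qed
    have ig2: "integrable \<nu> (\<lambda>x. (norm (g x))\<^sup>2)"
    proof (rule Bochner_Integration.integrable_bound)
      show "integrable \<nu> (\<lambda>x. \<delta>\<^sup>2 * (f x)\<^sup>2)" using if2 by simp
      show "(\<lambda>x. (norm (g x))\<^sup>2) \<in> borel_measurable \<nu>" by (intro meas continuous_intros cg)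
      show "AE x in \<nu>. norm ((norm (g x))\<^sup>2) \<le> norm (\<delta>\<^sup>2 * (f x)\<^sup>2)" using gle by simp
    qed
    define m where "m = (\<integral>x. (f x)\<^sup>2 \<partial>\<nu>)"
    have m1: "1 \<le> m"
    proof -
      have "(\<integral>x. 1 \<partial>\<nu>) \<le> m" unfolding m_def
        using trunc_norm_bounds(1)[OF \<epsilon>] \<delta> by (intro integral_mono if2) (auto simp: f2 intro!: mult_nonneg_nonneg)
      then show ?thesis using prob_space by simp
    qed
    have ent: "integrable \<nu> (\<lambda>x. (f x)\<^sup>2 * ln ((f x)\<^sup>2 / m))"
      "(\<integral>x. (f x)\<^sup>2 * ln ((f x)\<^sup>2 / m) \<partial>\<nu>) \<le> 2 * C * (\<integral>x. (norm (g x))\<^sup>2 \<partial>\<nu>)"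
      using L[of f g] df cg if2 ig2 unfolding m_def by auto
    have "(\<integral>x. (norm (g x))\<^sup>2 \<partial>\<nu>) \<le> (\<integral>x. \<delta>\<^sup>2 * (f x)\<^sup>2 \<partial>\<nu>)"
      by (intro integral_mono ig2 gle) (use if2 in simp)
    also have "\<dots> = \<delta>\<^sup>2 * m" by (simp add: m_def)
    finally have "2 * C * (\<integral>x. (norm (g x))\<^sup>2 \<partial>\<nu>) \<le> 2 * C * (\<delta>\<^sup>2 * m)" using C by simp
    also have "\<dots> = m / 2" using \<delta>2 by (metis (no_types, lifting) mult.assoc mult.commute times_divide_eq_left mult_2 field_sum_of_halves mult_numeral_1 numeral_One mult.left_commute divide_numeral_1 four_x_squared add_divide_distrib numeral_Bit0 divide_divide_eq_left')
    finally have entm: "(\<integral>x. (f x)\<^sup>2 * ln ((f x)\<^sup>2 / m) \<partial>\<nu>) \<le> m / 2" using ent(2) by linarith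
    define S where "S = {x::'k. norm x > real K}"
    have S: "S \<in> sets \<nu>" unfolding S_def sets by (intro borel_open open_Collect_less continuous_intros)
    define w where "w = (\<lambda>x. (f x)\<^sup>2 / m)"
    have iw: "integrable \<nu> w" "integral\<^sup>L \<nu> w = 1"
      using if2 m1 by (auto simp: w_def[abs_def] m_def[symmetric])
    have iwS: "integrable \<nu> (\<lambda>x. w x * indicator S x)"
      using integrable_mult_indicator[OF S iw(1)] by (simp add: mult.commute)
    have iwl: "integrable \<nu> (\<lambda>x. w x * ln (w x))"
      using ent(1) m1 integrable_divide_zero[of m \<nu> "\<lambda>x. (f x)\<^sup>2 * ln ((f x)\<^sup>2 / m)"]
      by (simp add: w_def)
    have wl: "(\<integral>x. w x * ln (w x) \<partial>\<nu>) \<le> 1 / 2"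
    proof -
      have "(\<integral>x. w x * ln (w x) \<partial>\<nu>) = (\<integral>x. (f x)\<^sup>2 * ln ((f x)\<^sup>2 / m) / m \<partial>\<nu>)" by (simp add: w_def)
      also have "\<dots> = (\<integral>x. (f x)\<^sup>2 * ln ((f x)\<^sup>2 / m) \<partial>\<nu>) / m" by simp
      also have "\<dots> \<le> 1/2" using entm m1 by (simp add: field_simps)
      finally show ?thesis .
    qed
    have e2: "integrable \<nu> (\<lambda>x. exp (2 * indicator S x) :: real)" 
      by (rule integrable_const_bound[where B = "exp 2"]) (use S in \<open>auto simp: indicator_def\<close>)
    \<comment> \<open>\<open>entropy_duality\<close> with y = 2 on \<open>S\<close> and y = 0
      elsewhere: entropy at most 1/2 and a small \<open>prob S\<close> leave at most half of the
      mass of \<open>w\<close> on \<open>S\<close>.\<close>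
    have "2 * (\<integral>x. w x * indicator S x \<partial>\<nu>) = (\<integral>x. w x * (2 * indicator S x) \<partial>\<nu>)"
      by (subst integral_mult_right_zero[symmetric]) (simp add: mult_ac)
    also have "\<dots> \<le> (\<integral>x. w x * ln (w x) - w x + exp (2 * indicator S x) \<partial>\<nu>)"
    proof (rule integral_mono)
      show "integrable \<nu> (\<lambda>x. w x * (2 * indicator S x))"
        using integrable_mult_right[of "2::real" \<nu> "\<lambda>x. w x * indicator S x"] iwS by (simp add: mult.left_commute)
      show "integrable \<nu> (\<lambda>x. w x * ln (w x) - w x + exp (2 * indicator S x))"
        using iwl iw e2 by simp
      show "w x * (2 * indicator S x) \<le> w x * ln (w x) - w x + exp (2 * indicator S x)" for x
        by (rule entropy_duality) (use m1 in \<open>simp add: w_def\<close>)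
    qed
    also have "\<dots> = (\<integral>x. w x * ln (w x) \<partial>\<nu>) - 1 + (\<integral>x. exp (2 * indicator S x) \<partial>\<nu>)"
      using iwl iw e2 by simp
    also have "(\<integral>x. exp (2 * indicator S x) \<partial>\<nu>) = (\<integral>x. 1 + (exp 2 - 1) * indicator S x \<partial>\<nu>)"
      by (rule Bochner_Integration.integral_cong) (auto simp: indicator_def)
    also have "\<dots> = 1 + (exp 2 - 1) * prob S"
    proof -
      have "integrable \<nu> (indicat_real S)"
        using S by (intro integrable_real_indicator) (auto simp: emeasure_eq_measure)
      then have "(\<integral>x. 1 + (exp 2 - 1) * indicator S x \<partial>\<nu>) = (\<integral>x. 1 \<partial>\<nu>) + (exp 2 - 1) * (\<integral>x. indicat_real S x \<partial>\<nu>)"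
        by (subst Bochner_Integration.integral_add) auto
      then show ?thesis using S prob_space by simp
    qed
    finally have wS: "2 * (\<integral>x. w x * indicator S x \<partial>\<nu>) \<le> 1/2 + (exp 2 - 1) * prob S" using wl by linarith
    have "exp (2::real) \<le> 9"
    proof -
      have "exp (2::real) = (exp 1)\<^sup>2" by (simp add: power2_eq_square exp_add[symmetric])
      also have "\<dots> \<le> 3\<^sup>2" using exp_le by (intro power_mono) auto
      finally show ?thesis by simp
    qed
    then have "(exp 2 - 1) * prob S \<le> 8 * (1/16)" using K
      by (intro mult_mono) (auto simp: S_def)
    then have wS2: "(\<integral>x. w x * indicator S x \<partial>\<nu>) \<le> 1/2" using wS by simp
    have "1 = (\<integral>x. w x * indicator S x \<partial>\<nu>) + (\<integral>x. w x * indicator (-S) x \<partial>\<nu>)"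
    proof -
      have "(\<integral>x. w x \<partial>\<nu>) = (\<integral>x. w x * indicator S x + w x * indicator (-S) x \<partial>\<nu>)"
        by (rule Bochner_Integration.integral_cong) (auto simp: indicator_def)
      also have "\<dots> = (\<integral>x. w x * indicator S x \<partial>\<nu>) + (\<integral>x. w x * indicator (-S) x \<partial>\<nu>)"
      proof (rule Bochner_Integration.integral_add[OF iwS])
        have "-S \<in> sets \<nu>" using S by (metis Compl_eq_Diff_UNIV sets.compl_sets space)
        from integrable_mult_indicator[OF this iw(1)]
        show "integrable \<nu> (\<lambda>x. w x * indicator (-S) x)" by (simp add: mult.commute)
      qed
      finally show ?thesis using iw by simp
    qed
    \<comment> \<open>At least half of the mass lies off \<open>S\<close>, where w <= (B/2)/m; hence
      m <= B.\<close>
    then have "1/2 \<le> (\<integral>x. w x * indicator (-S) x \<partial>\<nu>)" using wS2 by linarith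
    also have "\<dots> \<le> (\<integral>x. (B / 2) / m \<partial>\<nu>)"
    proof (rule integral_mono_AE')
      show "AE x in \<nu>. w x * indicator (- S) x \<le> B / 2 / m"
      proof (rule AE_I2)
        fix x :: 'k
        have "(f x)\<^sup>2 \<le> B / 2" if "x \<notin> S"
        proof -
          have "smooth_norm x \<le> sqrt (1 + (real K)\<^sup>2)"
            using that by (auto simp: S_def smooth_norm_def not_less power2_norm_eq_inner[symmetric] intro!: power_mono)
          then have "trunc_norm \<epsilon> x \<le> sqrt (1 + (real K)\<^sup>2)"
            using trunc_norm_bounds(3)[OF \<epsilon>, of x] by linarith
          then show ?thesis using \<delta> by (simp add: f2 B_def)
        qed
        then show "w x * indicator (- S) x \<le> B / 2 / m"
          using m1 by (auto simp: indicator_def w_def B_def divide_right_mono)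
      qed
    qed (use m1 in \<open>auto simp: B_def w_def\<close>)
    also have "\<dots> = (B / 2) / m" using prob_space by simp
    finally have "m \<le> B" using m1 by (simp add: field_simps)
    then show ?thesis by (simp add: m_def f2)
  qed
  \<comment> \<open>Fatou's lemma along \<epsilon> = 1/(n + 1).\<close>
  have lim: "(\<integral>\<^sup>+x. ennreal (exp (2 * \<delta> * smooth_norm x)) \<partial>\<nu>) \<le> ennreal B"
  proof -
    define F where "F = (\<lambda>(n::nat) (x::'k). ennreal (exp (2 * \<delta> * trunc_norm (1 / real (Suc n)) x)))"
    have cont: "continuous_on UNIV (\<lambda>x::'k. exp (2 * \<delta> * trunc_norm (1 / real (Suc n)) x))" for n
    proof -
      have "1 + 1 / real (Suc n) * smooth_norm x \<noteq> 0" for x :: 'k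
        using smooth_norm_ge(1)[of x] by (smt (verit) divide_nonneg_nonneg mult_nonneg_nonneg of_nat_0_le_iff)
      then show ?thesis unfolding trunc_norm_def by (intro continuous_intros) auto
    qed
    have "(\<lambda>n. exp (2 * \<delta> * trunc_norm (1 / real (Suc n)) x)) \<longlonglongrightarrow> exp (2 * \<delta> * (smooth_norm x / (1 + 0 * smooth_norm x)))" for x :: 'k
      unfolding trunc_norm_def
      by (intro tendsto_intros LIMSEQ_Suc[OF lim_1_over_n]) auto
    then have "(\<lambda>n. F n x) \<longlonglongrightarrow> ennreal (exp (2 * \<delta> * smooth_norm x))" for x
      unfolding F_def by (intro tendsto_ennrealI) simp
    then have "(\<integral>\<^sup>+x. ennreal (exp (2 * \<delta> * smooth_norm x)) \<partial>\<nu>) = (\<integral>\<^sup>+x. liminf (\<lambda>n. F n x) \<partial>\<nu>)"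
      by (intro nn_integral_cong lim_imp_Liminf[symmetric]) auto
    also have "\<dots> \<le> liminf (\<lambda>n. \<integral>\<^sup>+x. F n x \<partial>\<nu>)"
      by (rule nn_integral_liminf) (use meas[OF cont] in \<open>simp add: F_def\<close>)
    also have "\<dots> \<le> liminf (\<lambda>n. ennreal B)"
    proof (rule Liminf_mono, rule always_eventually, rule allI)
      fix n
      have int: "integrable \<nu> (\<lambda>x. exp (2 * \<delta> * trunc_norm (1 / real (Suc n)) x))"
      proof (rule integrable_const_bound[where B = "exp (2 * \<delta> * real (Suc n))"])
        show "AE x in \<nu>. norm (exp (2 * \<delta> * trunc_norm (1 / real (Suc n)) x)) \<le> exp (2 * \<delta> * real (Suc n))"
        proof (rule AE_I2)
          fix x :: 'k
          have "trunc_norm (1 / real (Suc n)) x \<le> real (Suc n)"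
            using trunc_norm_bounds(2)[of "1 / real (Suc n)" x] by simp
          then show "norm (exp (2 * \<delta> * trunc_norm (1 / real (Suc n)) x)) \<le> exp (2 * \<delta> * real (Suc n))"
            using \<delta> by simp
        qed
      qed (rule meas[OF cont])
      show "(\<integral>\<^sup>+x. F n x \<partial>\<nu>) \<le> ennreal B"
        unfolding F_def
        by (subst nn_integral_eq_integral[OF int]) (auto intro!: ennreal_leI bound)
    qed
    finally show ?thesis by (simp add: Liminf_const)
  qed
  have cont2: "continuous_on UNIV (\<lambda>x::'k. exp (2 * \<delta> * smooth_norm x))" by (intro continuous_intros)
  have "integrable \<nu> (\<lambda>x. exp (2 * \<delta> * smooth_norm x))"
    using lim meas[OF cont2] by (intro integrableI_bounded) (auto simp: le_less_trans ennreal_less_top)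
  then show ?thesis using that[of "2 * \<delta>"] \<delta> by simp
qed

lemma log_sobolev_integrable_norm_power:
  fixes \<nu> :: "'k::euclidean_space measure"
  assumes "prob_space \<nu>" and sets: "sets \<nu> = sets borel" and "log_sobolev \<nu>"
  shows "integrable \<nu> (\<lambda>x. norm x ^ p)"
proof -
  obtain \<delta> where \<delta>: "\<delta> > 0" and int: "integrable \<nu> (\<lambda>x. exp (\<delta> * smooth_norm x))"
    using log_sobolev_exp_moment assms by blast
  show ?thesis
  proof (rule Bochner_Integration.integrable_bound)
    show "integrable \<nu> (\<lambda>x. (fact p / \<delta> ^ p) * exp (\<delta> * smooth_norm x))" using int by simp
    show "(\<lambda>x. norm x ^ p) \<in> borel_measurable \<nu>"
      using sets by (simp cong: measurable_cong_sets)
    show "AE x in \<nu>. norm (norm x ^ p) \<le> norm ((fact p / \<delta> ^ p) * exp (\<delta> * smooth_norm x))"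
    proof (rule AE_I2)
      fix x :: 'k
      have s: "norm x \<le> smooth_norm x" by (rule smooth_norm_ge)
      have "(\<delta> * norm x) ^ p / fact p \<le> exp (\<delta> * norm x)"
      proof -
        have "(\<Sum>n\<in>{p}. (\<delta> * norm x) ^ n /\<^sub>R fact n) \<le> (\<Sum>n. (\<delta> * norm x) ^ n /\<^sub>R fact n)"
          by (rule sum_le_suminf) (use \<delta> in \<open>auto simp: summable_exp\<close>)
        then show ?thesis by (simp add: exp_def divide_inverse mult.commute)
      qed
      also have "\<dots> \<le> exp (\<delta> * smooth_norm x)" using s \<delta> by simp
      finally show "norm (norm x ^ p) \<le> norm ((fact p / \<delta> ^ p) * exp (\<delta> * smooth_norm x))"
        using \<delta> by (simp add: power_mult_distrib field_simps abs_mult)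
    qed
  qed
qed

section \<open>Fourth moments of linear and quadratic forms in independent variables\<close>

definition L4 :: "'a measure \<Rightarrow> ('a \<Rightarrow> complex) \<Rightarrow> bool" where
  "L4 M f \<longleftrightarrow> f \<in> borel_measurable M \<and> integrable M (\<lambda>x. cmod (f x) ^ 4)"

definition E4 :: "'a measure \<Rightarrow> ('a \<Rightarrow> complex) \<Rightarrow> real" where
  "E4 M f = (\<integral>x. cmod (f x) ^ 4 \<partial>M)"

lemma power4_add_le: "cmod (x + y) ^ 4 \<le> 8 * (cmod x ^ 4 + cmod y ^ 4)"
proof -
  have *: "(a + b)\<^sup>2 \<le> 2 * (a\<^sup>2 + b\<^sup>2)" for a b :: real
    using sum_squares_bound[of a b] by (simp add: power2_sum)
  have "cmod (x + y) ^ 4 \<le> (cmod x + cmod y) ^ 4"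
    by (intro power_mono norm_triangle_ineq norm_ge_zero)
  also have "\<dots> = ((cmod x + cmod y)\<^sup>2)\<^sup>2" by simp
  also have "\<dots> \<le> (2 * ((cmod x)\<^sup>2 + (cmod y)\<^sup>2))\<^sup>2" by (intro power_mono *) auto
  also have "\<dots> = 4 * ((cmod x)\<^sup>2 + (cmod y)\<^sup>2)\<^sup>2" by (simp only: power_mult_distrib) simp
  also have "\<dots> \<le> 4 * (2 * (((cmod x)\<^sup>2)\<^sup>2 + ((cmod y)\<^sup>2)\<^sup>2))" by (intro mult_left_mono *) auto
  also have "\<dots> = 8 * (cmod x ^ 4 + cmod y ^ 4)" by simp
  finally show ?thesis .
qed

lemma E4_nonneg: "0 \<le> E4 M f"
  unfolding E4_def by simp

lemma L4_add:
  assumes "L4 M f" "L4 M g"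
  shows "L4 M (\<lambda>x. f x + g x)" "E4 M (\<lambda>x. f x + g x) \<le> 8 * (E4 M f + E4 M g)"
proof -
  have m [measurable]: "f \<in> borel_measurable M" "g \<in> borel_measurable M"
    and i: "integrable M (\<lambda>x. cmod (f x) ^ 4)" "integrable M (\<lambda>x. cmod (g x) ^ 4)"
    using assms by (auto simp: L4_def)
  have i2: "integrable M (\<lambda>x. 8 * (cmod (f x) ^ 4 + cmod (g x) ^ 4))" using i by simp
  have i3: "integrable M (\<lambda>x. cmod (f x + g x) ^ 4)"
    by (rule Bochner_Integration.integrable_bound[OF i2]) (use power4_add_le in auto)
  then show "L4 M (\<lambda>x. f x + g x)" by (simp add: L4_def)
  have "E4 M (\<lambda>x. f x + g x) \<le> (\<integral>x. 8 * (cmod (f x) ^ 4 + cmod (g x) ^ 4) \<partial>M)"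
    unfolding E4_def by (rule integral_mono[OF i3 i2 power4_add_le])
  then show "E4 M (\<lambda>x. f x + g x) \<le> 8 * (E4 M f + E4 M g)" using i by (simp add: E4_def)
qed

lemma L4_cmult:
  assumes "L4 M f"
  shows "L4 M (\<lambda>x. c * f x)" "E4 M (\<lambda>x. c * f x) = cmod c ^ 4 * E4 M f"
  using assms by (auto simp: L4_def E4_def norm_mult power_mult_distrib)

lemma L4_cnj:
  assumes "L4 M f" shows "L4 M (\<lambda>x. cnj (f x))"
proof -
  have "(\<lambda>x. cnj (f x)) \<in> borel_measurable M"
    using assms by (intro borel_measurable_continuous_on[where f = cnj]) (auto simp: L4_def intro: continuous_intros)
  then show ?thesis using assms by (simp add: L4_def)
qed

lemma (in prob_space) L4_const: "L4 M (\<lambda>x. c)"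
  by (simp add: L4_def)

lemma (in prob_space) L4_indep_mult:
  assumes "indep_var borel f borel g" "L4 M f" "L4 M g"
  shows "L4 M (\<lambda>x. f x * g x)" "E4 M (\<lambda>x. f x * g x) = E4 M f * E4 M g"
proof -
  have ind: "indep_var borel (\<lambda>x. cmod (f x) ^ 4) borel (\<lambda>x. cmod (g x) ^ 4)"
    using indep_var_compose[OF assms(1), of "\<lambda>z. cmod z ^ 4" borel "\<lambda>z. cmod z ^ 4" borel] by (simp add: o_def)
  have i: "integrable M (\<lambda>x. cmod (f x) ^ 4)" "integrable M (\<lambda>x. cmod (g x) ^ 4)"
    using assms by (auto simp: L4_def)
  show "L4 M (\<lambda>x. f x * g x)" using assms(2,3) indep_var_integrable[OF ind i]
    by (auto simp: L4_def norm_mult power_mult_distrib intro: borel_measurable_times)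
  show "E4 M (\<lambda>x. f x * g x) = E4 M f * E4 M g"
    using indep_var_lebesgue_integral[OF ind i] by (simp add: E4_def norm_mult power_mult_distrib)
qed

text \<open>The term of first order in d is kept exactly, because its expectation will vanish. The
  other mixed terms are absorbed by |Re(cnj q d)| <= |q| |d| and the arithmetic-geometric
  inequality.\<close>

lemma cmod_add_power4_le:
  "cmod (q + d) ^ 4 \<le> cmod q ^ 4 + 4 * ((cmod q)\<^sup>2 * Re (cnj q * d))
     + 8 * ((cmod q)\<^sup>2 * (cmod d)\<^sup>2) + 3 * cmod d ^ 4"
proof -
  define r where "r = Re (cnj q * d)"
  have r: "\<bar>r\<bar> \<le> cmod q * cmod d"
    using abs_Re_le_cmod[of "cnj q * d"] by (simp add: r_def norm_mult)
  have sq: "(cmod (q + d))\<^sup>2 = (cmod q)\<^sup>2 + 2 * r + (cmod d)\<^sup>2"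
    unfolding r_def cmod_power2 by (simp add: power2_eq_square algebra_simps)
  have r2: "r\<^sup>2 \<le> (cmod q)\<^sup>2 * (cmod d)\<^sup>2"
    using power_mono[OF r, of 2] by (simp add: power_mult_distrib)
  have "r * (cmod d)\<^sup>2 \<le> (cmod q * cmod d) * (cmod d)\<^sup>2"
    using r by (intro mult_right_mono) auto
  also have "\<dots> \<le> ((cmod q)\<^sup>2 * (cmod d)\<^sup>2 + cmod d ^ 4) / 2"
  proof -
    have "2 * (cmod q * cmod d) * (cmod d)\<^sup>2 \<le> (cmod q * cmod d)\<^sup>2 + ((cmod d)\<^sup>2)\<^sup>2"
      by (rule sum_squares_bound)
    then show ?thesis by (simp add: power_mult_distrib)
  qed
  finally have r3: "4 * (r * (cmod d)\<^sup>2) \<le> 2 * ((cmod q)\<^sup>2 * (cmod d)\<^sup>2) + 2 * cmod d ^ 4" by simp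
  have "cmod (q + d) ^ 4 = ((cmod (q + d))\<^sup>2)\<^sup>2" by simp
  also have "\<dots> = cmod q ^ 4 + 4 * ((cmod q)\<^sup>2 * r) + 2 * ((cmod q)\<^sup>2 * (cmod d)\<^sup>2)
      + 4 * r\<^sup>2 + 4 * (r * (cmod d)\<^sup>2) + cmod d ^ 4"
    unfolding sq by (simp add: power2_eq_square power4_eq_xxxx algebra_simps)
  finally show ?thesis using r2 r3 unfolding r_def[symmetric] by linarith
qed

text \<open>Domination by |q|^3 |d| <= |q|^4 + |d|^4.\<close>

lemma L4_cube_mult_integrable:
  assumes Q: "L4 M q" and D: "L4 M d"
  shows "integrable M (\<lambda>x. of_real ((cmod (q x))\<^sup>2) * (cnj (q x) * d x))"
proof (rule Bochner_Integration.integrable_bound)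
  have m [measurable]: "q \<in> borel_measurable M" "d \<in> borel_measurable M"
    and i: "integrable M (\<lambda>x. cmod (q x) ^ 4)" "integrable M (\<lambda>x. cmod (d x) ^ 4)"
    using assms by (auto simp: L4_def)
  have mc [measurable]: "(\<lambda>x. cnj (q x)) \<in> borel_measurable M" using L4_cnj[OF Q] by (simp add: L4_def)
  show "(\<lambda>x. of_real ((cmod (q x))\<^sup>2) * (cnj (q x) * d x)) \<in> borel_measurable M" by measurable
  show "integrable M (\<lambda>x. cmod (q x) ^ 4 + cmod (d x) ^ 4)" using i by simp
  show "AE x in M. norm (of_real ((cmod (q x))\<^sup>2) * (cnj (q x) * d x)) \<le> norm (cmod (q x) ^ 4 + cmod (d x) ^ 4)"
  proof (rule AE_I2)
    fix x
    have *: "a ^ 2 * (a * b) \<le> a ^ 4 + b ^ 4" if "0 \<le> a" "0 \<le> b" for a b :: real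
    proof (cases "a \<le> b")
      case True
      then have "a ^ 2 * (a * b) \<le> b ^ 2 * (b * b)" using that by (intro mult_mono power_mono) auto
      also have "\<dots> = b ^ 4" by (simp add: power4_eq_xxxx power2_eq_square)
      finally show ?thesis by (rule order_trans) simp
    next
      case False
      then have "a ^ 2 * (a * b) \<le> a ^ 2 * (a * a)" using that by (intro mult_mono power_mono) auto
      also have "\<dots> = a ^ 4" by (simp add: power4_eq_xxxx power2_eq_square)
      finally show ?thesis by (rule order_trans) simp
    qed
    show "norm (of_real ((cmod (q x))\<^sup>2) * (cnj (q x) * d x)) \<le> norm (cmod (q x) ^ 4 + cmod (d x) ^ 4)"
      using *[of "cmod (q x)" "cmod (d x)"] by (simp add: norm_mult norm_power)
  qed
qed

text \<open>The weight \<open>t\<close> is chosen by the caller so that the recursion for the fourth moments closes.\<close>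
lemma (in prob_space) E4_add_orthogonal:
  assumes Q: "L4 M q" and D: "L4 M d" and t: "t > 0"
    and orth: "expectation (\<lambda>x. of_real ((cmod (q x))\<^sup>2) * (cnj (q x) * d x)) = 0"
  shows "E4 M (\<lambda>x. q x + d x) \<le> (1 + 4 / t) * E4 M q + (4 * t + 3) * E4 M d"
proof -
  have m [measurable]: "q \<in> borel_measurable M" "d \<in> borel_measurable M"
    and i: "integrable M (\<lambda>x. cmod (q x) ^ 4)" "integrable M (\<lambda>x. cmod (d x) ^ 4)"
    using assms by (auto simp: L4_def)
  have amgm: "(cmod x)\<^sup>2 * (cmod y)\<^sup>2 \<le> (1 / (2 * t)) * cmod x ^ 4 + (t / 2) * cmod y ^ 4" for x y
  proof -
    have "2 * (cmod x)\<^sup>2 * (t * (cmod y)\<^sup>2) \<le> ((cmod x)\<^sup>2)\<^sup>2 + (t * (cmod y)\<^sup>2)\<^sup>2"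
      by (rule sum_squares_bound)
    then have "2 * (cmod x)\<^sup>2 * (t * (cmod y)\<^sup>2) \<le> cmod x ^ 4 + t * t * cmod y ^ 4"
      by (simp add: power_mult_distrib power2_eq_square[of t])
    then show ?thesis using t by (simp add: field_simps)
  qed
  define R where "R = (\<lambda>x. of_real ((cmod (q x))\<^sup>2) * (cnj (q x) * d x))"
  have iR: "integrable M R" unfolding R_def by (rule L4_cube_mult_integrable[OF Q D])
  have Re0: "expectation (\<lambda>x. Re (R x)) = 0"
    using orth iR unfolding R_def[symmetric] by simp
  have ReR: "Re (R x) = (cmod (q x))\<^sup>2 * Re (cnj (q x) * d x)" for x
    by (simp add: R_def)
  have "E4 M (\<lambda>x. q x + d x) \<le>
    expectation (\<lambda>x. (1 + 4 / t) * cmod (q x) ^ 4 + 4 * Re (R x) + (4 * t + 3) * cmod (d x) ^ 4)"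
    unfolding E4_def
  proof (rule integral_mono)
    show "integrable M (\<lambda>x. cmod (q x + d x) ^ 4)" using L4_add(1)[OF Q D] by (simp add: L4_def)
    show "integrable M (\<lambda>x. (1 + 4 / t) * cmod (q x) ^ 4 + 4 * Re (R x) + (4 * t + 3) * cmod (d x) ^ 4)"
      using i iR by simp
    fix x
    show "cmod (q x + d x) ^ 4 \<le> (1 + 4 / t) * cmod (q x) ^ 4 + 4 * Re (R x) + (4 * t + 3) * cmod (d x) ^ 4"
      using cmod_add_power4_le[of "q x" "d x"] amgm[of "q x" "d x"] unfolding ReR
      by (simp add: algebra_simps)
  qed
  also have "\<dots> = (1 + 4 / t) * E4 M q + (4 * t + 3) * E4 M d"
    using i iR Re0 by (simp add: E4_def)
  finally show ?thesis .
qed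

text \<open>Real and complex entries are covered together: the normalization is E h = 0 and E |h|^2
  = 1. The constant \<open>m\<close> bounds the fourth moments of h and of |h|^2 - 1; the latter is
  what the diagonal of a quadratic form contributes.\<close>

locale standardized_family = prob_space +
  fixes h :: "nat \<Rightarrow> 'a \<Rightarrow> complex" and N :: nat and m :: real
  assumes indep: "indep_vars (\<lambda>_. borel) h {..<N}"
    and h_int: "\<And>i. i < N \<Longrightarrow> integrable M (h i)"
    and h_mean: "\<And>i. i < N \<Longrightarrow> expectation (h i) = 0"
    and h2_int: "\<And>i. i < N \<Longrightarrow> integrable M (\<lambda>\<omega>. (cmod (h i \<omega>))\<^sup>2)"
    and h2_mean: "\<And>i. i < N \<Longrightarrow> expectation (\<lambda>\<omega>. (cmod (h i \<omega>))\<^sup>2) = 1"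
    and h_L4: "\<And>i. i < N \<Longrightarrow> L4 M (h i)"
    and h_E4: "\<And>i. i < N \<Longrightarrow> E4 M (h i) \<le> m"
    and h2_L4: "\<And>i. i < N \<Longrightarrow> L4 M (\<lambda>\<omega>. of_real ((cmod (h i \<omega>))\<^sup>2) - 1)"
    and h2_E4: "\<And>i. i < N \<Longrightarrow> E4 M (\<lambda>\<omega>. of_real ((cmod (h i \<omega>))\<^sup>2) - 1) \<le> m"
begin

lemma h_measurable [measurable]: "i < N \<Longrightarrow> h i \<in> borel_measurable M"
  using h_L4 by (auto simp: L4_def)

lemma indep_past:
  assumes k: "k < N" and F: "F \<in> borel_measurable (PiM {..<k} (\<lambda>_. borel))"
    and p: "p \<in> borel_measurable borel"
    and G: "\<And>\<omega>. G \<omega> = F (restrict (\<lambda>i. h i \<omega>) {..<k})"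
  shows "indep_var borel G borel (\<lambda>\<omega>. p (h k \<omega>))"
proof -
  have ind: "indep_var (PiM {..<k} (\<lambda>_. borel)) (\<lambda>\<omega>. restrict (\<lambda>i. h i \<omega>) {..<k})
      (PiM {k} (\<lambda>_. borel)) (\<lambda>\<omega>. restrict (\<lambda>i. h i \<omega>) {k})"
    using k by (intro indep_var_restrict[OF indep]) auto
  have "(\<lambda>f. p (f k)) \<in> borel_measurable (PiM {k} (\<lambda>_. borel))"
    by (rule measurable_compose[OF _ p]) simp
  from indep_var_compose[OF ind F this]
  have "indep_var borel (\<lambda>\<omega>. F (restrict (\<lambda>i. h i \<omega>) {..<k})) borel (\<lambda>\<omega>. p (h k \<omega>))" by (simp add: o_def)
  then show ?thesis by (simp only: G[symmetric])
qed

lemma m_nonneg: "0 < N \<Longrightarrow> 0 \<le> m"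
  using h_E4[of 0] E4_nonneg[of M "h 0"] by simp

text \<open>The new summand b_k h_k is centred and independent of the past, so
  \<open>E4_add_orthogonal\<close> applies at every step, and the recursion closes on the square of
  the sum of the |b_i|^2.\<close>

lemma linear_form_E4:
  assumes "k \<le> N"
  shows "L4 M (\<lambda>\<omega>. \<Sum>i<k. b i * h i \<omega>) \<and>
    E4 M (\<lambda>\<omega>. \<Sum>i<k. b i * h i \<omega>) \<le> 16 * m * (\<Sum>i<k. (cmod (b i))\<^sup>2)\<^sup>2"
  using assms
proof (induction k)
  case 0
  then show ?case using L4_const[of 0] by (simp add: E4_def)
next
  case (Suc k)
  then have k: "k < N" by simp
  define q where "q = (\<lambda>\<omega>. \<Sum>i<k. b i * h i \<omega>)"
  define d where "d = (\<lambda>\<omega>. b k * h k \<omega>)"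
  define \<beta> where "\<beta> = (\<Sum>i<k. (cmod (b i))\<^sup>2)"
  define c where "c = (cmod (b k))\<^sup>2"
  have m0: "0 \<le> m" using m_nonneg k by simp
  have q: "L4 M q" "E4 M q \<le> 16 * m * \<beta>\<^sup>2" using Suc by (auto simp: q_def \<beta>_def)
  have d: "L4 M d" using L4_cmult(1)[OF h_L4[OF k]] by (simp add: d_def)
  have "E4 M d = c\<^sup>2 * E4 M (h k)"
    unfolding d_def c_def by (subst L4_cmult(2)[OF h_L4[OF k]]) (simp flip: power_mult)
  then have dE: "E4 M d \<le> c\<^sup>2 * m" using h_E4[OF k] by (simp add: mult_left_mono)
  have nn: "0 \<le> \<beta>" "0 \<le> c" by (auto simp: \<beta>_def c_def intro: sum_nonneg)
  have eq: "(\<lambda>\<omega>. \<Sum>i<Suc k. b i * h i \<omega>) = (\<lambda>\<omega>. q \<omega> + d \<omega>)" by (simp add: q_def d_def)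
  have orth: "expectation (\<lambda>x. of_real ((cmod (q x))\<^sup>2) * (cnj (q x) * d x)) = 0"
  proof -
    define G where "G = (\<lambda>\<omega>. of_real ((cmod (q \<omega>))\<^sup>2) * (cnj (q \<omega>) * b k))"
    have ind: "indep_var borel G borel (\<lambda>\<omega>. h k \<omega>)"
    proof (rule indep_past[OF k, where p = "\<lambda>z. z" and F =
      "\<lambda>f. of_real ((cmod (\<Sum>i<k. b i * f i))\<^sup>2) * (cnj (\<Sum>i<k. b i * f i) * b k)"])
      have [measurable]: "cnj \<in> borel_measurable borel"
        by (intro borel_measurable_continuous_onI continuous_intros)
      show "(\<lambda>f. of_real ((cmod (\<Sum>i<k. b i * f i))\<^sup>2) * (cnj (\<Sum>i<k. b i * f i) * b k)) \<in> borel_measurable (PiM {..<k} (\<lambda>_. borel))"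
        by measurable
    qed (auto simp: G_def q_def)
    have "integrable M G" unfolding G_def by (rule L4_cube_mult_integrable[OF q(1) L4_const])
    from indep_var_lebesgue_integral[OF ind this h_int[OF k]] h_mean[OF k]
    show ?thesis by (simp add: G_def d_def mult_ac)
  qed
  have "E4 M (\<lambda>\<omega>. q \<omega> + d \<omega>) \<le> 16 * m * (\<beta> + c)\<^sup>2"
  proof (cases "c = 0")
    case True
    then have "b k = 0" by (simp add: c_def)
    then show ?thesis using q True by (simp add: d_def)
  next
    case c: False
    then have cp: "c > 0" using nn by simp
    show ?thesis
    proof (cases "\<beta> = 0")
      case True
      then have "E4 M (\<lambda>\<omega>. q \<omega> + d \<omega>) \<le> 7 * E4 M d"
        using E4_add_orthogonal[OF q(1) d _ orth, of 1] q(2) E4_nonneg[of M q] by simp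
      also have "\<dots> \<le> 16 * (m * c\<^sup>2)"
      proof -
        have "0 \<le> m * c\<^sup>2" using m0 by simp
        moreover have "E4 M d \<le> m * c\<^sup>2" using dE by (simp add: mult.commute)
        ultimately show ?thesis by linarith
      qed
      finally show ?thesis using True by simp
    next
      case False
      then have \<beta>: "\<beta> > 0" using nn by simp
      \<comment> \<open>The weight 4 \<beta>/c turns each of the two error terms into 16 m \<beta>
        c; together they are the cross term of 16 m (\<beta> + c)^2.\<close>
      have "E4 M (\<lambda>\<omega>. q \<omega> + d \<omega>) \<le> (1 + 4 / (4 * \<beta> / c)) * E4 M q + (4 * (4 * \<beta> / c) + 3) * E4 M d"
        by (rule E4_add_orthogonal[OF q(1) d _ orth]) (use \<beta> cp in simp)
      also have "\<dots> \<le> (1 + 4 / (4 * \<beta> / c)) * (16 * m * \<beta>\<^sup>2) + (4 * (4 * \<beta> / c) + 3) * (c\<^sup>2 * m)"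
        using \<beta> cp by (intro add_mono mult_left_mono q dE) auto
      also have "\<dots> = 16 * m * \<beta>\<^sup>2 + 32 * m * \<beta> * c + 3 * m * c\<^sup>2"
        using \<beta> cp by (simp add: field_simps power2_eq_square)
      also have "\<dots> \<le> 16 * m * \<beta>\<^sup>2 + 32 * m * \<beta> * c + 16 * m * c\<^sup>2"
        using m0 by (intro add_left_mono mult_right_mono) auto
      also have "\<dots> = 16 * m * (\<beta> + c)\<^sup>2" by (simp add: power2_eq_square algebra_simps)
      finally show ?thesis .
    qed
  qed
  then show ?case unfolding eq using L4_add(1)[OF q(1) d] by (simp add: \<beta>_def c_def)
qed

text \<open>Enlarging the leading block by one index adds a diagonal term A_kk (|h_k|^2 - 1) and two
  products of \<open>h k\<close> or its conjugate with a linear form in the past. All three are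
  orthogonal to functions of the past, and their fourth moments are bounded independently of
  \<open>k\<close> because rows and columns have norm at most 1. A sum of k orthogonal bounded
  increments has fourth moment O(k^2), which after division by n^4 is summable.\<close>

lemma quadratic_form_E4:
  assumes rows: "\<And>i. i < N \<Longrightarrow> (\<Sum>j<N. (cmod (A i j))\<^sup>2) \<le> 1"
    and cols: "\<And>j. j < N \<Longrightarrow> (\<Sum>i<N. (cmod (A i j))\<^sup>2) \<le> 1"
    and "k \<le> N"
  shows "L4 M (\<lambda>\<omega>. (\<Sum>i<k. \<Sum>j<k. A i j * cnj (h i \<omega>) * h j \<omega>) - (\<Sum>i<k. A i i)) \<and>
    E4 M (\<lambda>\<omega>. (\<Sum>i<k. \<Sum>j<k. A i j * cnj (h i \<omega>) * h j \<omega>) - (\<Sum>i<k. A i i))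
      \<le> 16 * (8 * m + 2048 * m\<^sup>2) * (real k)\<^sup>2"
  using assms(3)
proof (induction k)
  case 0
  then show ?case using L4_const[of 0] by (simp add: E4_def)
next
  case (Suc k)
  then have k: "k < N" by simp
  have m0: "0 \<le> m" using m_nonneg k by simp
  define q where "q = (\<lambda>\<omega>. (\<Sum>i<k. \<Sum>j<k. A i j * cnj (h i \<omega>) * h j \<omega>) - (\<Sum>i<k. A i i))"
  define l where "l = (\<lambda>\<omega>. \<Sum>j<k. A k j * h j \<omega>)"
  define l' where "l' = (\<lambda>\<omega>. \<Sum>i<k. cnj (A i k) * h i \<omega>)"
  define d0 where "d0 = (\<lambda>\<omega>. A k k * (of_real ((cmod (h k \<omega>))\<^sup>2) - 1))"
  define d1 where "d1 = (\<lambda>\<omega>. l \<omega> * cnj (h k \<omega>))"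
  define d2 where "d2 = (\<lambda>\<omega>. cnj (l' \<omega>) * h k \<omega>)"
  define d where "d = (\<lambda>\<omega>. d0 \<omega> + (d1 \<omega> + d2 \<omega>))"
  \<comment> \<open>Bound for the increment: m for the diagonal part, 16 m^2 for each linear part,
    combined by two uses of |x + y|^4 <= 8 (|x|^4 + |y|^4), that is 8 (m + 8 * 32 m^2).\<close>
  define D where "D = 8 * m + 2048 * m\<^sup>2"
  have D0: "0 \<le> D" using m0 by (simp add: D_def)
  have q: "L4 M q" "E4 M q \<le> 16 * D * (real k)\<^sup>2" using Suc by (auto simp: q_def D_def)
  have eq: "(\<lambda>\<omega>. (\<Sum>i<Suc k. \<Sum>j<Suc k. A i j * cnj (h i \<omega>) * h j \<omega>) - (\<Sum>i<Suc k. A i i)) = (\<lambda>\<omega>. q \<omega> + d \<omega>)"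
  proof
    fix \<omega>
    have "of_real ((cmod (h k \<omega>))\<^sup>2) = cnj (h k \<omega>) * h k \<omega>"
      by (metis complex_norm_square mult.commute)
    then show "(\<Sum>i<Suc k. \<Sum>j<Suc k. A i j * cnj (h i \<omega>) * h j \<omega>) - (\<Sum>i<Suc k. A i i) = q \<omega> + d \<omega>"
      by (simp add: q_def d_def d0_def d1_def d2_def l_def l'_def sum.distrib sum_distrib_right sum_distrib_left algebra_simps cnj_sum)
  qed
  have [measurable]: "cnj \<in> borel_measurable borel"
    by (intro borel_measurable_continuous_onI continuous_intros)
  have sub: "(\<Sum>j<k. f j) \<le> (1::real)" if "(\<Sum>j<N. f j) \<le> 1" "\<And>j. 0 \<le> f j" for f
  proof -
    have "(\<Sum>j<k. f j) \<le> (\<Sum>j<N. f j)" using k that by (intro sum_mono2) auto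
    then show ?thesis using that by simp
  qed
  have lE: "L4 M l" "E4 M l \<le> 16 * m"
  proof -
    have 1: "(\<Sum>j<k. (cmod (A k j))\<^sup>2) \<le> 1" by (rule sub[OF rows[OF k]]) simp
    have "(\<Sum>j<k. (cmod (A k j))\<^sup>2)\<^sup>2 \<le> 1"
      using power_mono[OF 1, of 2] by (simp add: sum_nonneg)
    then have "16 * m * (\<Sum>j<k. (cmod (A k j))\<^sup>2)\<^sup>2 \<le> 16 * m * 1" using m0 by (intro mult_left_mono) auto
    then show "L4 M l" "E4 M l \<le> 16 * m"
      using linear_form_E4[of k "A k"] k by (auto simp: l_def)
  qed
  have lE': "L4 M l'" "E4 M l' \<le> 16 * m"
  proof -
    have 1: "(\<Sum>j<k. (cmod (A j k))\<^sup>2) \<le> 1" by (rule sub[OF cols[OF k]]) simp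
    have "(\<Sum>j<k. (cmod (A j k))\<^sup>2)\<^sup>2 \<le> 1"
      using power_mono[OF 1, of 2] by (simp add: sum_nonneg)
    then have "16 * m * (\<Sum>j<k. (cmod (A j k))\<^sup>2)\<^sup>2 \<le> 16 * m * 1" using m0 by (intro mult_left_mono) auto
    then show "L4 M l'" "E4 M l' \<le> 16 * m"
      using linear_form_E4[of k "\<lambda>i. cnj (A i k)"] k by (auto simp: l'_def)
  qed
  have cl: "L4 M (\<lambda>\<omega>. cnj (l' \<omega>))" "E4 M (\<lambda>\<omega>. cnj (l' \<omega>)) \<le> 16 * m"
    using lE' L4_cnj by (auto simp: E4_def)
  have ch: "L4 M (\<lambda>\<omega>. cnj (h k \<omega>))" "E4 M (\<lambda>\<omega>. cnj (h k \<omega>)) \<le> m"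
    using h_L4[OF k] h_E4[OF k] L4_cnj by (auto simp: E4_def)
  have ind1: "indep_var borel l borel (\<lambda>\<omega>. cnj (h k \<omega>))"
    by (rule indep_past[OF k, where F = "\<lambda>f. \<Sum>j<k. A k j * f j"]) (auto simp: l_def)
  have ind2: "indep_var borel (\<lambda>\<omega>. cnj (l' \<omega>)) borel (\<lambda>\<omega>. h k \<omega>)"
    by (rule indep_past[OF k, where F = "\<lambda>f. cnj (\<Sum>j<k. cnj (A j k) * f j)" and p = "\<lambda>z. z"])
       (auto simp: l'_def)
  have d0: "L4 M d0" "E4 M d0 \<le> m"
  proof -
    show "L4 M d0" unfolding d0_def by (rule L4_cmult(1)[OF h2_L4[OF k]])
    have "(cmod (A k k))\<^sup>2 = (\<Sum>j\<in>{k}. (cmod (A k j))\<^sup>2)" by simp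
    also have "\<dots> \<le> (\<Sum>j<N. (cmod (A k j))\<^sup>2)" using k by (intro sum_mono2) auto
    also have "\<dots> \<le> 1" by (rule rows[OF k])
    finally have "((cmod (A k k))\<^sup>2)\<^sup>2 \<le> 1\<^sup>2" by (intro power_mono) auto
    then have "cmod (A k k) ^ 4 \<le> 1" unfolding power_mult[symmetric] by simp
    then have "cmod (A k k) ^ 4 * E4 M (\<lambda>\<omega>. of_real ((cmod (h k \<omega>))\<^sup>2) - 1) \<le> 1 * m"
      by (intro mult_mono h2_E4[OF k] E4_nonneg) auto
    then show "E4 M d0 \<le> m" unfolding d0_def L4_cmult(2)[OF h2_L4[OF k]] by simp
  qed
  have d1: "L4 M d1" "E4 M d1 \<le> 16 * m * m"
    unfolding d1_def using L4_indep_mult[OF ind1 lE(1) ch(1)] mult_mono[OF lE(2) ch(2)] m0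
    by (auto simp: E4_nonneg)
  have d2: "L4 M d2" "E4 M d2 \<le> 16 * m * m"
    unfolding d2_def using L4_indep_mult[OF ind2 cl(1) h_L4[OF k]] mult_mono[OF cl(2) h_E4[OF k]] m0
    by (auto simp: E4_nonneg)
  have d12: "L4 M (\<lambda>\<omega>. d1 \<omega> + d2 \<omega>)" "E4 M (\<lambda>\<omega>. d1 \<omega> + d2 \<omega>) \<le> 8 * (16 * m * m + 16 * m * m)"
    using L4_add[OF d1(1) d2(1)] d1(2) d2(2) by auto
  have d: "L4 M d" "E4 M d \<le> D"
    using L4_add[OF d0(1) d12(1)] d0(2) d12(2) by (auto simp: d_def D_def power2_eq_square)
  \<comment> \<open>Each part of the increment is a function of the past times one of |h_k|^2 - 1,
    cnj h_k, h_k; all three have mean zero, so each expectation factors and vanishes.\<close>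
  have orth: "expectation (\<lambda>x. of_real ((cmod (q x))\<^sup>2) * (cnj (q x) * d x)) = 0"
  proof -
    define Q where "Q = (\<lambda>f. (\<Sum>i<k. \<Sum>j<k. A i j * cnj (f i) * f j) - (\<Sum>i<k. A i i))"
    have Qm [measurable]: "Q \<in> borel_measurable (PiM {..<k} (\<lambda>_. borel))" unfolding Q_def by measurable
    have qQ: "q \<omega> = Q (restrict (\<lambda>i. h i \<omega>) {..<k})" for \<omega> by (simp add: q_def Q_def)
    define G where "G = (\<lambda>r \<omega>. of_real ((cmod (q \<omega>))\<^sup>2) * (cnj (q \<omega>) * r \<omega>))"
    have GI: "integrable M (G r)" if "L4 M r" for r
      unfolding G_def by (rule L4_cube_mult_integrable[OF q(1) that])
    have z: "expectation (\<lambda>\<omega>. G r \<omega> * p (h k \<omega>)) = 0"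
      if r: "L4 M r" "R \<in> borel_measurable (PiM {..<k} (\<lambda>_. borel))" "\<And>\<omega>. r \<omega> = R (restrict (\<lambda>i. h i \<omega>) {..<k})"
        and p: "p \<in> borel_measurable borel" "integrable M (\<lambda>\<omega>. p (h k \<omega>))" "expectation (\<lambda>\<omega>. p (h k \<omega>)) = 0"
      for r R p
    proof -
      note r(2) [measurable]
      have ind: "indep_var borel (G r) borel (\<lambda>\<omega>. p (h k \<omega>))"
        by (rule indep_past[OF k _ p(1), where F = "\<lambda>f. of_real ((cmod (Q f))\<^sup>2) * (cnj (Q f) * R f)"])
           (auto simp: G_def qQ r(3))
      show ?thesis using indep_var_lebesgue_integral[OF ind GI[OF r(1)] p(2)] p(3) by simp
    qed
    have z0: "expectation (\<lambda>\<omega>. G (\<lambda>_. A k k) \<omega> * (of_real ((cmod (h k \<omega>))\<^sup>2) - 1)) = 0"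
    proof (rule z[of "\<lambda>_. A k k" "\<lambda>_. A k k" "\<lambda>z. of_real ((cmod z)\<^sup>2) - 1"])
      have i: "integrable M (\<lambda>\<omega>. complex_of_real ((cmod (h k \<omega>))\<^sup>2))"
        using h2_int[OF k] by (rule integrable_of_real)
      then show "integrable M (\<lambda>\<omega>. complex_of_real ((cmod (h k \<omega>))\<^sup>2) - 1)" by simp
      have "expectation (\<lambda>\<omega>. complex_of_real ((cmod (h k \<omega>))\<^sup>2)) = 1"
        using h2_mean[OF k] by (simp only: integral_complex_of_real) simp
      then show "expectation (\<lambda>\<omega>. complex_of_real ((cmod (h k \<omega>))\<^sup>2) - 1) = 0"
        using i by (simp add: prob_space del: of_real_power)
    qed (auto simp: L4_const)
    have z1: "expectation (\<lambda>\<omega>. G l \<omega> * cnj (h k \<omega>)) = 0"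
      by (rule z[of l "\<lambda>f. \<Sum>j<k. A k j * f j" cnj, OF lE(1)])
         (use h_int[OF k] h_mean[OF k] in \<open>auto simp: l_def\<close>)
    have z2: "expectation (\<lambda>\<omega>. G (\<lambda>\<omega>. cnj (l' \<omega>)) \<omega> * h k \<omega>) = 0"
      by (rule z[of "\<lambda>\<omega>. cnj (l' \<omega>)" "\<lambda>f. cnj (\<Sum>j<k. cnj (A j k) * f j)" "\<lambda>z. z", OF cl(1)])
         (use h_int[OF k] h_mean[OF k] in \<open>auto simp: l'_def\<close>)
    have e0: "(\<lambda>\<omega>. G (\<lambda>_. A k k) \<omega> * (of_real ((cmod (h k \<omega>))\<^sup>2) - 1)) = G d0"
      and e1: "(\<lambda>\<omega>. G l \<omega> * cnj (h k \<omega>)) = G d1"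
      and e2: "(\<lambda>\<omega>. G (\<lambda>\<omega>. cnj (l' \<omega>)) \<omega> * h k \<omega>) = G d2"
      by (auto simp: G_def d0_def d1_def d2_def mult_ac)
    have "expectation (\<lambda>x. of_real ((cmod (q x))\<^sup>2) * (cnj (q x) * d x)) = expectation (\<lambda>x. G d0 x + (G d1 x + G d2 x))"
      by (simp add: G_def d_def algebra_simps)
    also have "\<dots> = 0"
      using z0 z1 z2 GI[OF d0(1)] GI[OF d1(1)] GI[OF d2(1)] unfolding e0 e1 e2 by simp
    finally show ?thesis .
  qed
  have "E4 M (\<lambda>\<omega>. q \<omega> + d \<omega>) \<le> 16 * D * (real (Suc k))\<^sup>2"
  proof (cases "k = 0")
    case True
    then have "E4 M q = 0" using q(2) E4_nonneg[of M q] by simp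
    then have "E4 M (\<lambda>\<omega>. q \<omega> + d \<omega>) \<le> 7 * E4 M d"
      using E4_add_orthogonal[OF q(1) d(1) _ orth, of 1] by simp
    then show ?thesis using d(2) D0 True by simp
  next
    case False
    then have kp: "real k > 0" by simp
    \<comment> \<open>With weight 4 k the right-hand side becomes 16 D k^2 + 32 D k + 3 D, which is
      below 16 D (k + 1)^2.\<close>
    have "E4 M (\<lambda>\<omega>. q \<omega> + d \<omega>) \<le> (1 + 4 / (4 * real k)) * E4 M q + (4 * (4 * real k) + 3) * E4 M d"
      by (rule E4_add_orthogonal[OF q(1) d(1) _ orth]) (use kp in simp)
    also have "\<dots> \<le> (1 + 4 / (4 * real k)) * (16 * D * (real k)\<^sup>2) + (4 * (4 * real k) + 3) * D"
      using kp by (intro add_mono mult_left_mono q d) auto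
    also have "\<dots> = 16 * D * (real k)\<^sup>2 + 32 * D * real k + 3 * D"
      using kp by (simp add: field_simps power2_eq_square)
    also have "\<dots> \<le> 16 * D * (real (Suc k))\<^sup>2" using D0 by (simp add: power2_eq_square algebra_simps)
    finally show ?thesis .
  qed
  then show ?case unfolding eq using L4_add(1)[OF q(1) d(1)] by (simp add: D_def)
qed

end

section \<open>Orthonormal bases and the spectral theorem for Hermitian matrices\<close>

text \<open>\<open>w l\<close> is the l-th vector and \<open>w l i\<close> its i-th entry. Bases are
  plain functions, so that matrix identities become manipulations of finite sums.\<close>

definition orthonormal :: "nat \<Rightarrow> nat \<Rightarrow> (nat \<Rightarrow> nat \<Rightarrow> complex) \<Rightarrow> bool" where
  "orthonormal n k w \<longleftrightarrow> (\<forall>l<k. \<forall>m<k. (\<Sum>i<n. w l i * cnj (w m i)) = (if l = m then 1 else 0))"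

lemma orthonormalD:
  "orthonormal n k w \<Longrightarrow> l < k \<Longrightarrow> m < k \<Longrightarrow> (\<Sum>i<n. w l i * cnj (w m i)) = (if l = m then 1 else 0)"
  by (simp add: orthonormal_def)

text \<open>A one-sided inverse of a square matrix is two-sided, so orthonormal rows have
  orthonormal columns.\<close>

lemma orthonormal_complete:
  assumes w: "orthonormal n n w" and ij: "i < n" "j < n"
  shows "(\<Sum>l<n. w l i * cnj (w l j)) = (if i = j then 1 else 0)"
proof -
  define A where "A = mat n n (\<lambda>(l, i). w l i)"
  define B where "B = mat n n (\<lambda>(i, m). cnj (w m i))"
  have AB: "A \<in> carrier_mat n n" "B \<in> carrier_mat n n" by (auto simp: A_def B_def)
  have "A * B = 1\<^sub>m n"
    by (rule eq_matI) (use orthonormalD[OF w] in \<open>auto simp: A_def B_def scalar_prod_def atLeast0LessThan\<close>)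
  then have "B * A = 1\<^sub>m n" by (rule mat_mult_left_right_inverse[OF AB])
  then have "(B * A) $$ (j, i) = (1\<^sub>m n) $$ (j, i)" by simp
  then show ?thesis using ij
    by (auto simp: A_def B_def scalar_prod_def atLeast0LessThan mult.commute split: if_splits)
qed

definition coord :: "nat \<Rightarrow> (nat \<Rightarrow> nat \<Rightarrow> complex) \<Rightarrow> (nat \<Rightarrow> complex) \<Rightarrow> nat \<Rightarrow> complex" where
  "coord n w x l = (\<Sum>i<n. x i * cnj (w l i))"

lemma coord_expand:
  assumes w: "orthonormal n n w" and i: "i < n"
  shows "(\<Sum>l<n. coord n w x l * w l i) = x i"
proof -
  have "(\<Sum>l<n. coord n w x l * w l i) = (\<Sum>l<n. \<Sum>j<n. x j * (w l i * cnj (w l j)))"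
    by (intro sum.cong refl) (simp add: coord_def sum_distrib_left mult_ac)
  also have "\<dots> = (\<Sum>j<n. \<Sum>l<n. x j * (w l i * cnj (w l j)))" by (rule sum.swap)
  also have "\<dots> = (\<Sum>j<n. x j * (if i = j then 1 else 0))"
    by (intro sum.cong refl) (simp add: sum_distrib_left[symmetric] orthonormal_complete[OF w i])
  also have "\<dots> = x i" using i by (simp add: if_distrib cong: if_cong)
  finally show ?thesis .
qed

lemma coord_parseval:
  assumes w: "orthonormal n n w"
  shows "(\<Sum>l<n. coord n w x l * cnj (coord n w y l)) = (\<Sum>i<n. x i * cnj (y i))"
proof -
  have "(\<Sum>l<n. coord n w x l * cnj (coord n w y l)) = (\<Sum>l<n. \<Sum>i<n. coord n w x l * (w l i * cnj (y i)))"
    by (simp add: coord_def[of n w y] sum_distrib_left mult_ac)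
  also have "\<dots> = (\<Sum>i<n. \<Sum>l<n. (coord n w x l * w l i) * cnj (y i))"
    by (subst sum.swap) (simp add: mult_ac)
  also have "\<dots> = (\<Sum>i<n. x i * cnj (y i))"
    by (intro sum.cong refl) (simp add: sum_distrib_right[symmetric] coord_expand[OF w])
  finally show ?thesis .
qed

lemma sum_mult_cnj: "(\<Sum>i\<in>I. f i * cnj (f i)) = complex_of_real (\<Sum>i\<in>I. (cmod (f i))\<^sup>2)"
  by (simp only: complex_norm_square[symmetric] of_real_sum)

lemma coord_norm:
  assumes w: "orthonormal n n w"
  shows "(\<Sum>l<n. (cmod (coord n w x l))\<^sup>2) = (\<Sum>i<n. (cmod (x i))\<^sup>2)"
proof -
  have "complex_of_real (\<Sum>l<n. (cmod (coord n w x l))\<^sup>2) = complex_of_real (\<Sum>i<n. (cmod (x i))\<^sup>2)"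
    using coord_parseval[OF w, of x x] unfolding sum_mult_cnj .
  then show ?thesis using of_real_eq_iff by blast
qed

lemma mat_apply_index:
  assumes "A \<in> carrier_mat n m" "i < n" "x \<in> carrier_vec m"
  shows "(A *\<^sub>v x) $ i = (\<Sum>j<m. A $$ (i, j) * x $ j)"
  using assms by (simp add: scalar_prod_def atLeast0LessThan)

text \<open>The trace is invariant under similarity, and the Schur form carries the eigenvalues on
  its diagonal.\<close>

lemma trace_sum_eigenvalues:
  fixes A :: "complex mat"
  assumes A: "A \<in> carrier_mat n n" and c: "char_poly A = (\<Prod>a\<leftarrow>as. [:- a, 1:])"
  shows "(\<Sum>i<n. A $$ (i, i)) = sum_list as"
proof -
  obtain B P Q where s: "schur_decomposition A as = (B, P, Q)" by (cases "schur_decomposition A as") auto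
  from schur_decomposition[OF A c s]
  have sim: "similar_mat_wit A B P Q" and diag: "diag_mat B = as" by auto
  note d = similar_mat_witD2[OF A sim]
  have tr: "(\<Sum>i<n. (U * V) $$ (i, i)) = (\<Sum>i<n. (V * U) $$ (i, i))"
    if "U \<in> carrier_mat n n" "V \<in> carrier_mat n n" for U V :: "complex mat"
  proof -
    have "(\<Sum>i<n. (U * V) $$ (i, i)) = (\<Sum>i<n. \<Sum>j<n. U $$ (i, j) * V $$ (j, i))"
      using that by (intro sum.cong refl) (auto simp: scalar_prod_def atLeast0LessThan)
    also have "\<dots> = (\<Sum>j<n. \<Sum>i<n. V $$ (j, i) * U $$ (i, j))" by (subst sum.swap) (simp add: mult.commute)
    also have "\<dots> = (\<Sum>i<n. (V * U) $$ (i, i))"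
      using that by (intro sum.cong refl) (auto simp: scalar_prod_def atLeast0LessThan)
    finally show ?thesis .
  qed
  have "(\<Sum>i<n. A $$ (i, i)) = (\<Sum>i<n. (P * B * Q) $$ (i, i))" using d by simp
  also have "\<dots> = (\<Sum>i<n. (Q * (P * B)) $$ (i, i))" using d by (intro tr) auto
  also have "Q * (P * B) = B"
  proof -
    have "Q * (P * B) = Q * P * B" using d by (intro assoc_mult_mat[symmetric]) auto
    then show ?thesis using d by simp
  qed
  also have "(\<Sum>i<n. B $$ (i, i)) = sum_list (diag_mat B)"
    using d by (simp add: diag_mat_def interv_sum_list_conv_sum_set_nat atLeast0LessThan)
  finally show ?thesis by (simp add: diag)
qed

text \<open>Deflation: T = H + sum (c - lam_l) w_l w_l^* moves the known eigenvalues to c. If c is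
  chosen so that the trace of T is not n c, then T has an eigenvalue other than c. Its eigenvector
  is orthogonal to all known ones, and is therefore an eigenvector of H, with a real eigenvalue
  because H is Hermitian.\<close>

lemma hermitian_next_eigenvector:
  fixes H :: "nat \<Rightarrow> nat \<Rightarrow> complex" and lam :: "nat \<Rightarrow> real"
  assumes herm: "\<And>i j. i < n \<Longrightarrow> j < n \<Longrightarrow> H j i = cnj (H i j)"
    and w: "orthonormal n k w" and kn: "k < n"
    and ev: "\<And>l i. l < k \<Longrightarrow> i < n \<Longrightarrow> (\<Sum>j<n. H i j * w l j) = of_real (lam l) * w l i"
  obtains x \<mu> where "(\<Sum>i<n. x i * cnj (x i)) = 1" "\<And>l. l < k \<Longrightarrow> (\<Sum>i<n. x i * cnj (w l i)) = 0"
    "\<And>i. i < n \<Longrightarrow> (\<Sum>j<n. H i j * x j) = of_real (\<mu>::real) * x i"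
proof -
  define \<tau> where "\<tau> = (\<Sum>i<n. H i i) - of_real (\<Sum>l<k. lam l)"
  \<comment> \<open>\<tau> is the part of the trace not yet accounted for, and T has trace \<tau> +
    k c; were all n eigenvalues equal to c, this would force (n - k) c = \<tau>.\<close>
  obtain c :: real where c: "of_nat (n - k) * complex_of_real c \<noteq> \<tau>"
  proof (cases "\<tau> = 0")
    case True
    then show ?thesis using that[of 1] kn by simp
  next
    case False
    then show ?thesis using that[of 0] by simp
  qed
  define \<gamma> where "\<gamma> = (\<lambda>l. complex_of_real (c - lam l))"
  define T where "T = mat n n (\<lambda>(i, j). H i j + (\<Sum>l<k. \<gamma> l * (w l i * cnj (w l j))))"
  have T: "T \<in> carrier_mat n n" by (simp add: T_def)
  obtain as where as: "char_poly T = (\<Prod>a\<leftarrow>as. [:- a, 1:])" "length as = n"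
    using char_poly_factorized[OF T] by blast
  have tr: "sum_list as = \<tau> + of_nat k * of_real c"
  proof -
    have "sum_list as = (\<Sum>i<n. H i i) + (\<Sum>i<n. \<Sum>l<k. \<gamma> l * (w l i * cnj (w l i)))"
      using trace_sum_eigenvalues[OF T as(1)] by (simp add: T_def sum.distrib)
    also have "(\<Sum>i<n. \<Sum>l<k. \<gamma> l * (w l i * cnj (w l i))) = (\<Sum>l<k. \<gamma> l)"
      by (subst sum.swap) (intro sum.cong refl, simp add: sum_distrib_left[symmetric] orthonormalD[OF w])
    finally show ?thesis by (simp add: \<tau>_def sum_subtractf \<gamma>_def)
  qed
  have "\<exists>\<mu>\<in>set as. \<mu> \<noteq> of_real c"
  proof (rule ccontr)
    assume "\<not> ?thesis"
    then have "as = replicate n (of_real c)" using as(2) by (metis replicate_eqI)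
    then have "sum_list as = of_nat n * of_real c" by (simp add: sum_list_replicate)
    then have "of_nat (n - k) * complex_of_real c = \<tau>" using tr kn
      by (simp add: of_nat_diff algebra_simps)
    then show False using c by simp
  qed
  then obtain \<mu> where \<mu>: "\<mu> \<in> set as" "\<mu> \<noteq> of_real c" by blast
  have "poly (char_poly T) \<mu> = 0" unfolding as(1) using \<mu>(1) by (auto simp: poly_prod_list prod_list_zero_iff)
  then have "eigenvalue T \<mu>" by (simp add: eigenvalue_root_char_poly[OF T])
  then obtain v where v: "v \<in> carrier_vec n" "v \<noteq> 0\<^sub>v n" "T *\<^sub>v v = \<mu> \<cdot>\<^sub>v v"
    using T by (auto simp: eigenvalue_def eigenvector_def)
  define y where "y = (\<lambda>i. v $ i)"
  define p where "p = (\<lambda>l. \<Sum>j<n. y j * cnj (w l j))"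
  have Ty: "(\<Sum>j<n. H i j * y j) + (\<Sum>l<k. \<gamma> l * (w l i * p l)) = \<mu> * y i" if i: "i < n" for i
  proof -
    have "\<mu> * y i = (T *\<^sub>v v) $ i" using v i by (simp add: y_def)
    also have "\<dots> = (\<Sum>j<n. (H i j + (\<Sum>l<k. \<gamma> l * (w l i * cnj (w l j)))) * y j)"
      unfolding mat_apply_index[OF T i v(1)] using i by (simp add: T_def y_def)
    also have "\<dots> = (\<Sum>j<n. H i j * y j) + (\<Sum>j<n. \<Sum>l<k. \<gamma> l * (w l i * (y j * cnj (w l j))))"
      by (simp add: distrib_right sum.distrib) (simp add: sum_distrib_left sum_distrib_right mult_ac)
    also have "(\<Sum>j<n. \<Sum>l<k. \<gamma> l * (w l i * (y j * cnj (w l j)))) = (\<Sum>l<k. \<gamma> l * (w l i * p l))"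
      by (subst sum.swap) (simp add: p_def sum_distrib_left)
    finally show ?thesis by simp
  qed
  have herm': "cnj (H j i) = H i j" if "i < n" "j < n" for i j
    unfolding herm[OF that] by simp
  have Hadj: "(\<Sum>i<n. (\<Sum>j<n. H i j * f j) * cnj (g i)) = (\<Sum>j<n. f j * cnj (\<Sum>i<n. H j i * g i))" for f g
  proof -
    have "(\<Sum>i<n. (\<Sum>j<n. H i j * f j) * cnj (g i)) = (\<Sum>j<n. \<Sum>i<n. H i j * f j * cnj (g i))"
      unfolding sum_distrib_right by (rule sum.swap)
    also have "\<dots> = (\<Sum>j<n. \<Sum>i<n. f j * cnj (H j i * g i))"
      by (intro sum.cong refl) (simp add: herm' mult_ac)
    finally show ?thesis by (simp add: sum_distrib_left)
  qed
  \<comment> \<open>Pairing the eigenvalue equation of T with w_m gives \<mu> p = (lam_m + c -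
    lam_m) p = c p, and \<mu> differs from c.\<close>
  have p0: "p m = 0" if m: "m < k" for m
  proof -
    have "\<mu> * p m = (\<Sum>i<n. (\<mu> * y i) * cnj (w m i))" by (simp add: p_def sum_distrib_left mult_ac)
    also have "\<dots> = (\<Sum>i<n. (\<Sum>j<n. H i j * y j) * cnj (w m i)) + (\<Sum>i<n. \<Sum>l<k. \<gamma> l * p l * (w l i * cnj (w m i)))"
      unfolding sum.distrib[symmetric]
      by (intro sum.cong refl) (simp add: Ty[symmetric] distrib_right, simp add: sum_distrib_left sum_distrib_right mult_ac)
    also have "(\<Sum>i<n. (\<Sum>j<n. H i j * y j) * cnj (w m i)) = of_real (lam m) * p m"
      unfolding Hadj using ev[OF m] by (simp add: p_def sum_distrib_left mult_ac)
    also have "(\<Sum>i<n. \<Sum>l<k. \<gamma> l * p l * (w l i * cnj (w m i))) = \<gamma> m * p m"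
    proof -
      have "(\<Sum>i<n. \<Sum>l<k. \<gamma> l * p l * (w l i * cnj (w m i))) = (\<Sum>l<k. \<gamma> l * p l * (if l = m then 1 else 0))"
        by (subst sum.swap) (intro sum.cong refl, simp add: sum_distrib_left[symmetric] orthonormalD[OF w _ m])
      also have "\<dots> = \<gamma> m * p m" using m by (simp add: if_distrib cong: if_cong)
      finally show ?thesis .
    qed
    finally have "\<mu> * p m = of_real c * p m" by (simp add: \<gamma>_def algebra_simps)
    then show ?thesis using \<mu>(2) by simp
  qed
  have Hy: "(\<Sum>j<n. H i j * y j) = \<mu> * y i" if "i < n" for i
    using Ty[OF that] p0 by simp
  define s where "s = (\<Sum>i<n. (cmod (y i))\<^sup>2)"
  have yy: "(\<Sum>i<n. y i * cnj (y i)) = of_real s" by (simp add: s_def sum_mult_cnj)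
  have s: "s > 0"
  proof -
    obtain i where "i < n" "y i \<noteq> 0" using v(1,2) unfolding y_def
      by (metis carrier_vecD eq_vecI index_zero_vec)
    then show ?thesis unfolding s_def by (intro sum_pos2[of _ i]) auto
  qed
  have "\<mu> * of_real s = cnj \<mu> * of_real s"
  proof -
    have "\<mu> * of_real s = (\<Sum>i<n. (\<Sum>j<n. H i j * y j) * cnj (y i))"
      unfolding yy[symmetric] sum_distrib_left by (intro sum.cong refl) (simp add: Hy mult.assoc)
    also have "\<dots> = cnj \<mu> * of_real s"
      unfolding Hadj yy[symmetric] sum_distrib_left
      by (intro sum.cong refl, subst Hy) (auto simp: mult_ac)
    finally show ?thesis .
  qed
  then have "\<mu> = cnj \<mu>" using s by simp
  then obtain \<rho> :: real where \<mu>r: "\<mu> = of_real \<rho>" by (metis Reals_cnj_iff Reals_cases)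
  define x where "x = (\<lambda>i. y i / of_real (sqrt s))"
  show ?thesis
  proof (rule that[of x \<rho>])
    have "complex_of_real (sqrt s) * complex_of_real (sqrt s) = of_real s"
      using s unfolding of_real_mult[symmetric] by simp
    then have "x i * cnj (x i) = y i * cnj (y i) / of_real s" for i by (simp add: x_def)
    then have "(\<Sum>i<n. x i * cnj (x i)) = (\<Sum>i<n. y i * cnj (y i)) / of_real s"
      by (simp only: sum_divide_distrib)
    then show "(\<Sum>i<n. x i * cnj (x i)) = 1" using s by (simp add: yy)
    show "(\<Sum>i<n. x i * cnj (w l i)) = 0" if "l < k" for l
      using p0[OF that] by (simp add: x_def p_def sum_divide_distrib[symmetric])
    show "(\<Sum>j<n. H i j * x j) = of_real \<rho> * x i" if "i < n" for i
      using Hy[OF that] \<mu>r by (simp add: x_def sum_divide_distrib[symmetric])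
  qed
qed

lemma hermitian_eigenbasis:
  fixes H :: "nat \<Rightarrow> nat \<Rightarrow> complex"
  assumes herm: "\<And>i j. i < n \<Longrightarrow> j < n \<Longrightarrow> H j i = cnj (H i j)"
  shows "\<exists>w lam. orthonormal n n w \<and> (\<forall>l<n. \<forall>i<n. (\<Sum>j<n. H i j * w l j) = complex_of_real (lam l) * w l i)"
proof -
  have "\<exists>w lam. orthonormal n k w \<and> (\<forall>l<k. \<forall>i<n. (\<Sum>j<n. H i j * w l j) = complex_of_real (lam l) * w l i)" if "k \<le> n" for k
    using that
  proof (induction k)
    case 0
    then show ?case by (simp add: orthonormal_def)
  next
    case (Suc k)
    then obtain w lam where w: "orthonormal n k w" and kn: "k < n"
      and ev: "\<And>l i. l < k \<Longrightarrow> i < n \<Longrightarrow> (\<Sum>j<n. H i j * w l j) = complex_of_real (lam l) * w l i" by auto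
    obtain x \<mu> where x: "(\<Sum>i<n. x i * cnj (x i)) = 1" "\<And>l. l < k \<Longrightarrow> (\<Sum>i<n. x i * cnj (w l i)) = 0"
      "\<And>i. i < n \<Longrightarrow> (\<Sum>j<n. H i j * x j) = complex_of_real \<mu> * x i"
      using hermitian_next_eigenvector[OF herm w kn ev] by blast
    have x2: "(\<Sum>i<n. w l i * cnj (x i)) = 0" if "l < k" for l
    proof -
      have "cnj (\<Sum>i<n. w l i * cnj (x i)) = (\<Sum>i<n. x i * cnj (w l i))" by (simp add: mult.commute)
      then show ?thesis using x(2)[OF that] by (metis complex_cnj_zero_iff)
    qed
    have "orthonormal n (Suc k) (w(k := x))"
      using orthonormalD[OF w] x(1,2) x2 by (auto simp: orthonormal_def less_Suc_eq)
    moreover have "\<forall>l<Suc k. \<forall>i<n. (\<Sum>j<n. H i j * (w(k := x)) l j) = complex_of_real ((lam(k := \<mu>)) l) * (w(k := x)) l i"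
      using ev x(3) by (auto simp: less_Suc_eq)
    ultimately show ?case by blast
  qed
  from this[of n] show ?thesis by simp
qed

section \<open>Singular values and singular value decompositions\<close>

lemma mat_adjoint_index [simp]:
  assumes "i < dim_col A" "j < dim_row A"
  shows "mat_adjoint A $$ (i, j) = conjugate (A $$ (j, i))"
  using assms by (simp add: mat_adjoint_def mat_of_rows_def)

lemma mat_adjoint_dim [simp]: "dim_row (mat_adjoint A) = dim_col A" "dim_col (mat_adjoint A) = dim_row A"
  by (auto simp: mat_adjoint_def)

lemma mat_adjoint_carrier [simp]: "A \<in> carrier_mat n m \<Longrightarrow> mat_adjoint A \<in> carrier_mat m n"
  by (rule carrier_matI) simp_all

lemma char_poly_eigenbasis:
  fixes A :: "complex mat"
  assumes A: "A \<in> carrier_mat n n" and w: "orthonormal n n w"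
    and ev: "\<And>l i. l < n \<Longrightarrow> i < n \<Longrightarrow> (\<Sum>j<n. A $$ (i, j) * w l j) = lam l * w l i"
  shows "char_poly A = (\<Prod>l\<leftarrow>[0..<n]. [:- lam l, 1:])"
proof -
  define P where "P = mat n n (\<lambda>(i, l). w l i)"
  define Q where "Q = mat n n (\<lambda>(l, i). cnj (w l i))"
  define D where "D = mat n n (\<lambda>(i, j). if i = j then lam i else 0)"
  have c: "P \<in> carrier_mat n n" "Q \<in> carrier_mat n n" "D \<in> carrier_mat n n"
    by (auto simp: P_def Q_def D_def)
  have PQ: "P * Q = 1\<^sub>m n"
    by (rule eq_matI) (use orthonormal_complete[OF w] in \<open>auto simp: P_def Q_def scalar_prod_def atLeast0LessThan\<close>)
  have QP: "Q * P = 1\<^sub>m n" by (rule mat_mult_left_right_inverse[OF c(1,2) PQ])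
  have AP: "A * P = P * D"
  proof (rule eq_matI)
    fix i l assume "i < dim_row (P * D)" "l < dim_col (P * D)"
    then have il: "i < n" "l < n" using c by auto
    have "(A * P) $$ (i, l) = lam l * w l i" using A il ev[OF il(2,1)]
      by (simp add: P_def scalar_prod_def atLeast0LessThan)
    moreover have "(P * D) $$ (i, l) = (\<Sum>j<n. w j i * (if j = l then lam j else 0))"
      using il by (simp add: P_def D_def scalar_prod_def atLeast0LessThan)
    moreover have "\<dots> = lam l * w l i" using il by (simp add: if_distrib cong: if_cong)
    ultimately show "(A * P) $$ (i, l) = (P * D) $$ (i, l)" by simp
  qed (use A c in auto)
  have "A = A * (P * Q)" using A by (simp add: PQ)
  also have "\<dots> = A * P * Q" using A c by (intro assoc_mult_mat[symmetric]) auto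
  also have "\<dots> = P * D * Q" by (simp add: AP)
  finally have "similar_mat_wit A D P Q"
    using A c PQ QP by (intro similar_mat_witI[of _ _ n]) auto
  then have "char_poly A = char_poly D" by (intro char_poly_similar) (auto simp: similar_mat_def)
  also have "\<dots> = (\<Prod>a\<leftarrow>diag_mat D. [:- a, 1:])"
    using c by (intro char_poly_upper_triangular[of _ n]) (auto simp: D_def)
  also have "diag_mat D = map lam [0..<n]" by (auto simp: diag_mat_def D_def)
  finally show ?thesis by (simp add: o_def)
qed

lemma proots_linear_factors: "proots (\<Prod>l\<leftarrow>xs. [:- f l, 1:]) = image_mset f (mset xs)"
  for f :: "'a \<Rightarrow> 'b::field"
proof (induction xs)
  case (Cons x xs)
  have "(\<Prod>l\<leftarrow>xs. [:- f l, 1:]) \<noteq> 0" by (auto simp: prod_list_zero_iff)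
  then show ?case using Cons by (simp add: proots_mult[of "[:- f x, 1:]"] del: mult_pCons_left)
qed auto

text \<open>An orthonormal basis \<open>w\<close> of right singular vectors, with singular values \<open>s\<close> in no particular order.\<close>
definition right_singular_basis :: "nat \<Rightarrow> complex mat \<Rightarrow> (nat \<Rightarrow> nat \<Rightarrow> complex) \<Rightarrow> (nat \<Rightarrow> real) \<Rightarrow> bool" where
  "right_singular_basis n X w s \<longleftrightarrow> orthonormal n n w \<and> (\<forall>l<n. 0 \<le> s l) \<and>
     (\<forall>l<n. \<forall>i<n. (\<Sum>j<n. (\<Sum>k<n. cnj (X $$ (k, i)) * X $$ (k, j)) * w l j) = of_real ((s l)\<^sup>2) * w l i)"

lemma right_singular_basis_exists:
  obtains w s where "right_singular_basis n X w s"
proof -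
  define H where "H = (\<lambda>i j. \<Sum>k<n. cnj (X $$ (k, i)) * X $$ (k, j))"
  have herm: "\<And>i j. i < n \<Longrightarrow> j < n \<Longrightarrow> H j i = cnj (H i j)" by (simp add: H_def mult.commute)
  obtain w lam where w: "orthonormal n n w"
    and ev': "\<forall>l<n. \<forall>i<n. (\<Sum>j<n. H i j * w l j) = complex_of_real (lam l) * w l i"
    using hermitian_eigenbasis[of n H, OF herm] by blast
  from ev' have ev: "(\<Sum>j<n. H i j * w l j) = complex_of_real (lam l) * w l i" if "l < n" "i < n" for l i
    using that by blast
  have "0 \<le> lam l" if l: "l < n" for l
  proof -
    define y where "y = (\<lambda>k. \<Sum>j<n. X $$ (k, j) * w l j)"
    have "complex_of_real (lam l) = (\<Sum>i<n. (of_real (lam l) * w l i) * cnj (w l i))"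
      unfolding mult.assoc sum_distrib_left[symmetric] using orthonormalD[OF w l l] by simp
    also have "\<dots> = (\<Sum>i<n. (\<Sum>j<n. H i j * w l j) * cnj (w l i))" using ev[OF l] by simp
    also have "\<dots> = (\<Sum>i<n. \<Sum>j<n. \<Sum>k<n. cnj (X $$ (k, i) * w l i) * (X $$ (k, j) * w l j))"
      by (simp add: H_def sum_distrib_left sum_distrib_right mult_ac)
    also have "\<dots> = (\<Sum>i<n. \<Sum>k<n. \<Sum>j<n. cnj (X $$ (k, i) * w l i) * (X $$ (k, j) * w l j))"
      by (intro sum.cong refl sum.swap)
    also have "\<dots> = (\<Sum>k<n. \<Sum>i<n. cnj (X $$ (k, i) * w l i) * y k)"
      by (subst sum.swap) (simp add: y_def sum_distrib_left)
    also have "\<dots> = (\<Sum>k<n. y k * cnj (y k))"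
    proof -
      have "(\<Sum>i<n. cnj (X $$ (k, i) * w l i)) = cnj (y k)" for k by (simp add: y_def)
      then show ?thesis unfolding sum_distrib_right[symmetric] by (simp only: mult.commute)
    qed
    also have "\<dots> = of_real (\<Sum>k<n. (cmod (y k))\<^sup>2)" by (rule sum_mult_cnj)
    finally have "lam l = (\<Sum>k<n. (cmod (y k))\<^sup>2)" using of_real_eq_iff by blast
    then show ?thesis by (simp add: sum_nonneg)
  qed
  then have "right_singular_basis n X w (\<lambda>l. sqrt (lam l))"
    unfolding right_singular_basis_def using w ev by (auto simp: H_def simp flip: of_real_power)
  then show ?thesis using that by blast
qed

lemma right_singular_basis_inner:
  assumes b: "right_singular_basis n X w s" and l: "l < n" and m: "m < n"
  shows "(\<Sum>k<n. (\<Sum>j<n. X $$ (k, j) * w l j) * cnj (\<Sum>i<n. X $$ (k, i) * w m i)) = (if l = m then of_real ((s l)\<^sup>2) else 0)"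
proof -
  have w: "orthonormal n n w" using b by (simp add: right_singular_basis_def)
  have "(\<Sum>k<n. (\<Sum>j<n. X $$ (k, j) * w l j) * cnj (\<Sum>i<n. X $$ (k, i) * w m i)) =
    (\<Sum>k<n. \<Sum>i<n. (\<Sum>j<n. cnj (X $$ (k, i)) * X $$ (k, j) * w l j) * cnj (w m i))"
    by (simp add: sum_distrib_left sum_distrib_right mult_ac)
  also have "\<dots> = (\<Sum>i<n. (\<Sum>k<n. \<Sum>j<n. cnj (X $$ (k, i)) * X $$ (k, j) * w l j) * cnj (w m i))"
    by (subst sum.swap) (simp add: sum_distrib_right)
  also have "\<dots> = (\<Sum>i<n. (\<Sum>j<n. (\<Sum>k<n. cnj (X $$ (k, i)) * X $$ (k, j)) * w l j) * cnj (w m i))"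
  proof -
    have "(\<Sum>k<n. \<Sum>j<n. cnj (X $$ (k, i)) * X $$ (k, j) * w l j) = (\<Sum>j<n. (\<Sum>k<n. cnj (X $$ (k, i)) * X $$ (k, j)) * w l j)" for i
      by (subst sum.swap) (simp add: sum_distrib_right)
    then show ?thesis by simp
  qed
  also have "\<dots> = (\<Sum>i<n. of_real ((s l)\<^sup>2) * (w l i * cnj (w m i)))"
    using b l by (intro sum.cong refl) (simp add: right_singular_basis_def mult.assoc)
  also have "\<dots> = (if l = m then of_real ((s l)\<^sup>2) else 0)"
    by (simp add: sum_distrib_left[symmetric] orthonormalD[OF w l m])
  finally show ?thesis .
qed

lemma right_singular_basis_norm:
  assumes b: "right_singular_basis n X w s"
  shows "(\<Sum>k<n. (cmod (\<Sum>j<n. X $$ (k, j) * x j))\<^sup>2) = (\<Sum>l<n. (s l)\<^sup>2 * (cmod (coord n w x l))\<^sup>2)"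
proof -
  have w: "orthonormal n n w" using b by (simp add: right_singular_basis_def)
  define c where "c = coord n w x"
  define y where "y = (\<lambda>l k. \<Sum>j<n. X $$ (k, j) * w l j)"
  have Xx: "(\<Sum>j<n. X $$ (k, j) * x j) = (\<Sum>l<n. c l * y l k)" for k
  proof -
    have "(\<Sum>j<n. X $$ (k, j) * x j) = (\<Sum>j<n. X $$ (k, j) * (\<Sum>l<n. c l * w l j))"
      by (intro sum.cong refl) (simp add: c_def coord_expand[OF w])
    also have "\<dots> = (\<Sum>j<n. \<Sum>l<n. c l * (X $$ (k, j) * w l j))" by (simp add: sum_distrib_left mult_ac)
    also have "\<dots> = (\<Sum>l<n. c l * y l k)" by (subst sum.swap) (simp add: y_def sum_distrib_left)
    finally show ?thesis .
  qed
  have "complex_of_real (\<Sum>k<n. (cmod (\<Sum>j<n. X $$ (k, j) * x j))\<^sup>2) = (\<Sum>k<n. (\<Sum>l<n. c l * y l k) * cnj (\<Sum>m<n. c m * y m k))"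
    unfolding Xx sum_mult_cnj[symmetric] ..
  also have "\<dots> = (\<Sum>k<n. \<Sum>m<n. \<Sum>l<n. c l * cnj (c m) * (y l k * cnj (y m k)))"
    by (simp add: sum_distrib_left sum_distrib_right mult_ac)
  also have "\<dots> = (\<Sum>m<n. \<Sum>k<n. \<Sum>l<n. c l * cnj (c m) * (y l k * cnj (y m k)))" by (rule sum.swap)
  also have "\<dots> = (\<Sum>m<n. \<Sum>l<n. c l * cnj (c m) * (\<Sum>k<n. y l k * cnj (y m k)))"
  proof -
    have "(\<Sum>k<n. \<Sum>l<n. c l * cnj (c m) * (y l k * cnj (y m k))) = (\<Sum>l<n. c l * cnj (c m) * (\<Sum>k<n. y l k * cnj (y m k)))" for m
      by (subst sum.swap) (simp add: sum_distrib_left)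
    then show ?thesis by simp
  qed
  also have "\<dots> = (\<Sum>m<n. \<Sum>l<n. c l * cnj (c m) * (if l = m then of_real ((s l)\<^sup>2) else 0))"
    by (intro sum.cong refl) (use right_singular_basis_inner[OF b] in \<open>simp add: y_def\<close>)
  also have "\<dots> = (\<Sum>m<n. (c m * cnj (c m)) * of_real ((s m)\<^sup>2))"
    by (intro sum.cong refl) (simp add: if_distrib cong: if_cong)
  also have "\<dots> = complex_of_real (\<Sum>l<n. (s l)\<^sup>2 * (cmod (c l))\<^sup>2)"
    unfolding complex_norm_square[symmetric] by (simp add: mult.commute)
  finally show ?thesis using of_real_eq_iff unfolding c_def by blast
qed

lemma char_poly_adjoint_mult:
  assumes X: "X \<in> carrier_mat n n" and b: "right_singular_basis n X w s"
  shows "char_poly (mat_adjoint X * X) = (\<Prod>l\<leftarrow>[0..<n]. [:- complex_of_real ((s l)\<^sup>2), 1:])"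
proof (rule char_poly_eigenbasis)
  show "mat_adjoint X * X \<in> carrier_mat n n" using X by auto
  show "orthonormal n n w" using b by (simp add: right_singular_basis_def)
  fix l i assume "l < n" "i < n"
  then show "(\<Sum>j<n. (mat_adjoint X * X) $$ (i, j) * w l j) = complex_of_real ((s l)\<^sup>2) * w l i"
    using b X by (simp add: right_singular_basis_def scalar_prod_def atLeast0LessThan)
qed

text \<open>Bridge from the definition by roots of a characteristic polynomial to an arbitrary basis
  of right singular vectors; from here on only such bases are used.\<close>

lemma singular_values_mset:
  assumes X: "X \<in> carrier_mat n n" and b: "right_singular_basis n X w s"
  shows "mset (singular_values X) = image_mset s (mset_set {..<n})"
proof -
  have "mset (singular_values X) = image_mset (\<lambda>l. sqrt (norm l)) (proots (char_poly (mat_adjoint X * X)))"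
    by (simp add: singular_values_def)
  also have "\<dots> = image_mset (\<lambda>l. sqrt (norm (complex_of_real ((s l)\<^sup>2)))) (mset [0..<n])"
    unfolding char_poly_adjoint_mult[OF X b] proots_linear_factors by (simp add: multiset.map_comp o_def)
  also have "\<dots> = image_mset s (mset [0..<n])"
    using b by (intro image_mset_cong) (auto simp: right_singular_basis_def norm_power)
  finally show ?thesis by (simp add: atLeast0LessThan mset_upt)
qed

lemma smallest_singular_value_Min:
  assumes X: "X \<in> carrier_mat n n" and b: "right_singular_basis n X w s" and n: "n > 0"
  shows "smallest_singular_value X = Min (s ` {..<n})"
proof -
  define L where "L = sorted_list_of_multiset (image_mset (\<lambda>l. sqrt (norm l)) (proots (char_poly (mat_adjoint X * X))))"
  have m: "mset L = image_mset s (mset_set {..<n})"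
    using singular_values_mset[OF X b] by (simp add: singular_values_def L_def)
  then have set: "set L = s ` {..<n}" by (metis finite_set_mset_mset_set finite_lessThan set_image_mset set_mset_mset)
  then have ne: "L \<noteq> []" using n by auto
  have "sorted L" by (simp add: L_def)
  then have "hd L = Min (set L)" using ne
    by (cases L) (auto intro!: Min_eqI[symmetric])
  then show ?thesis using ne unfolding smallest_singular_value_def singular_values_def L_def[symmetric]
    by (simp add: last_rev set)
qed

lemma smallest_singular_value_le:
  assumes X: "X \<in> carrier_mat n n" and b: "right_singular_basis n X w s" and l: "l < n"
  shows "smallest_singular_value X \<le> s l"
  using smallest_singular_value_Min[OF X b] l by simp

lemma smallest_singular_value_nonneg:
  fixes X :: "complex mat"
  assumes X: "X \<in> carrier_mat n n" and n: "n > 0"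
  shows "0 \<le> smallest_singular_value X"
proof -
  obtain w s where b: "right_singular_basis n X w s" by (rule right_singular_basis_exists)
  have "Min (s ` {..<n}) \<in> s ` {..<n}" using n by (intro Min_in) auto
  then show ?thesis using b unfolding smallest_singular_value_Min[OF X b n] by (auto simp: right_singular_basis_def)
qed

lemma smallest_singular_value_lower:
  fixes X :: "complex mat"
  assumes X: "X \<in> carrier_mat n n" and n: "n > 0"
  shows "(smallest_singular_value X)\<^sup>2 * (\<Sum>i<n. (cmod (x i))\<^sup>2) \<le> (\<Sum>k<n. (cmod (\<Sum>j<n. X $$ (k, j) * x j))\<^sup>2)"
proof -
  obtain w s where b: "right_singular_basis n X w s" by (rule right_singular_basis_exists)
  have w: "orthonormal n n w" using b by (simp add: right_singular_basis_def)
  have "(smallest_singular_value X)\<^sup>2 * (\<Sum>i<n. (cmod (x i))\<^sup>2) = (\<Sum>l<n. (smallest_singular_value X)\<^sup>2 * (cmod (coord n w x l))\<^sup>2)"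
    by (simp only: coord_norm[OF w] sum_distrib_left[symmetric])
  also have "\<dots> \<le> (\<Sum>l<n. (s l)\<^sup>2 * (cmod (coord n w x l))\<^sup>2)"
    using smallest_singular_value_le[OF X b] smallest_singular_value_nonneg[OF X n]
    by (intro sum_mono mult_right_mono power_mono) auto
  also have "\<dots> = (\<Sum>k<n. (cmod (\<Sum>j<n. X $$ (k, j) * x j))\<^sup>2)" by (simp only: right_singular_basis_norm[OF b])
  finally show ?thesis .
qed

lemma integral_singular_value_measure:
  fixes f :: "real \<Rightarrow> real"
  assumes X: "X \<in> carrier_mat n n" and b: "right_singular_basis n X w s" and n: "n > 0"
    and f: "f \<in> borel_measurable borel"
  shows "(\<integral>t. f t \<partial>singular_value_measure X) = (\<Sum>l<n. f (s l)) / n"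
proof -
  have len: "length (singular_values X) = n"
    using arg_cong[OF singular_values_mset[OF X b], of size] by simp
  have "(\<integral>t. f t \<partial>singular_value_measure X) = (\<integral>i. f (singular_values X ! i) \<partial>uniform_count_measure {..<n})"
    unfolding singular_value_measure_def using X f by (subst integral_distr) (auto simp: uniform_count_measure_def)
  also have "\<dots> = (\<Sum>i<n. f (singular_values X ! i)) / n"
    unfolding uniform_count_measure_def
    by (subst lebesgue_integral_point_measure_finite) (auto simp: sum_divide_distrib)
  also have "(\<Sum>i<n. f (singular_values X ! i)) = sum_mset (image_mset f (mset (singular_values X)))"
  proof -
    have "sum_mset (image_mset f (mset (singular_values X))) = sum_list (map f (singular_values X))"
      by (metis mset_map sum_mset_sum_list)
    also have "\<dots> = (\<Sum>i<n. f (singular_values X ! i))"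
      by (simp add: sum_list_sum_nth len atLeast0LessThan)
    finally show ?thesis by simp
  qed
  also have "\<dots> = (\<Sum>l<n. f (s l))"
    unfolding singular_values_mset[OF X b] by (simp add: multiset.map_comp o_def sum_unfold_sum_mset)
  finally show ?thesis .
qed

lemma real_distribution_singular_value_measure:
  fixes X :: "complex mat"
  assumes X: "X \<in> carrier_mat n n" and n: "n > 0"
  shows "real_distribution (singular_value_measure X)"
proof -
  have "prob_space (uniform_count_measure {..<dim_col X})"
    using X n by (intro prob_space_uniform_count_measure) (auto simp: lessThan_empty_iff)
  then interpret prob_space "uniform_count_measure {..<dim_col X}" .
  show ?thesis
    unfolding singular_value_measure_def
    by (intro real_distribution_distr) (auto simp: uniform_count_measure_def)
qed

text \<open>The singular values are strictly positive, so the left vectors are determined by the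
  right ones as X w_l / s_l.\<close>

definition svd :: "nat \<Rightarrow> complex mat \<Rightarrow> (nat \<Rightarrow> nat \<Rightarrow> complex) \<Rightarrow> (nat \<Rightarrow> nat \<Rightarrow> complex) \<Rightarrow> (nat \<Rightarrow> real) \<Rightarrow> bool" where
  "svd n X w z s \<longleftrightarrow> orthonormal n n w \<and> orthonormal n n z \<and> (\<forall>l<n. 0 < s l) \<and>
     (\<forall>l<n. \<forall>k<n. (\<Sum>j<n. X $$ (k, j) * w l j) = of_real (s l) * z l k) \<and>
     (\<forall>l<n. \<forall>i<n. (\<Sum>k<n. cnj (X $$ (k, i)) * z l k) = of_real (s l) * w l i)"

lemma svd_exists:
  assumes b: "right_singular_basis n X w s" and s: "\<And>l. l < n \<Longrightarrow> 0 < s l"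
  shows "\<exists>z. svd n X w z s"
proof -
  define y where "y = (\<lambda>l k. \<Sum>j<n. X $$ (k, j) * w l j)"
  define z where "z = (\<lambda>l k. y l k / of_real (s l))"
  have w: "orthonormal n n w" using b by (simp add: right_singular_basis_def)
  have s0: "complex_of_real (s l) \<noteq> 0" if "l < n" for l using s[OF that] by simp
  have "orthonormal n n z"
    unfolding orthonormal_def
  proof (intro allI impI)
    fix l m assume l: "l < n" and m: "m < n"
    have "(\<Sum>i<n. z l i * cnj (z m i)) = (\<Sum>k<n. y l k * cnj (y m k)) / (of_real (s l) * of_real (s m))"
      by (simp add: z_def sum_divide_distrib)
    also have "\<dots> = (if l = m then 1 else 0)"
      unfolding y_def right_singular_basis_inner[OF b l m] using s0[OF l] by (auto simp: power2_eq_square)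
    finally show "(\<Sum>i<n. z l i * cnj (z m i)) = (if l = m then 1 else 0)" .
  qed
  moreover have "(\<Sum>j<n. X $$ (k, j) * w l j) = of_real (s l) * z l k" if "l < n" for l k
    using s0[OF that] by (simp add: z_def y_def)
  moreover have "(\<Sum>k<n. cnj (X $$ (k, i)) * z l k) = of_real (s l) * w l i" if l: "l < n" and i: "i < n" for l i
  proof -
    have "(\<Sum>k<n. cnj (X $$ (k, i)) * z l k) = (\<Sum>k<n. \<Sum>j<n. cnj (X $$ (k, i)) * X $$ (k, j) * w l j) / of_real (s l)"
      by (simp add: z_def y_def sum_divide_distrib sum_distrib_left mult.assoc)
    also have "(\<Sum>k<n. \<Sum>j<n. cnj (X $$ (k, i)) * X $$ (k, j) * w l j) = (\<Sum>j<n. (\<Sum>k<n. cnj (X $$ (k, i)) * X $$ (k, j)) * w l j)"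
      by (subst sum.swap) (simp add: sum_distrib_right)
    also have "\<dots> = of_real ((s l)\<^sup>2) * w l i" using b l i by (simp add: right_singular_basis_def)
    finally show ?thesis using s0[OF l] by (simp add: power2_eq_square)
  qed
  ultimately show ?thesis using w s unfolding svd_def by blast
qed

text \<open>Both sides express that X has trivial kernel. The determinant serves later as a
  measurable test for the existence of a decomposition in the sense of \<open>svd\<close>.\<close>

lemma det_nonzero_iff_singular_values_pos:
  assumes X: "X \<in> carrier_mat n n" and b: "right_singular_basis n X w s"
  shows "det X \<noteq> 0 \<longleftrightarrow> (\<forall>l<n. 0 < s l)"
proof
  have w: "orthonormal n n w" using b by (simp add: right_singular_basis_def)
  assume d: "det X \<noteq> 0"
  show "\<forall>l<n. 0 < s l"
  proof (intro allI impI, rule ccontr)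
    fix l assume l: "l < n" and "\<not> 0 < s l"
    then have sl: "s l = 0" using b by (force simp: right_singular_basis_def)
    have "complex_of_real (\<Sum>k<n. (cmod (\<Sum>j<n. X $$ (k, j) * w l j))\<^sup>2) = 0"
      using right_singular_basis_inner[OF b l l] sl unfolding sum_mult_cnj by simp
    then have "(\<Sum>k<n. (cmod (\<Sum>j<n. X $$ (k, j) * w l j))\<^sup>2) = 0" by (simp only: of_real_eq_0_iff)
    then have 0: "(\<Sum>j<n. X $$ (k, j) * w l j) = 0" if "k < n" for k
      using that by (simp add: sum_nonneg_eq_0_iff)
    define v where "v = vec n (w l)"
    have v: "v \<in> carrier_vec n" by (simp add: v_def)
    have "X *\<^sub>v v = 0\<^sub>v n"
    proof (rule eq_vecI)
      show "dim_vec (X *\<^sub>v v) = dim_vec (0\<^sub>v n)" using X by simp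
      fix i assume "i < dim_vec (0\<^sub>v n)"
      then have i: "i < n" by simp
      show "(X *\<^sub>v v) $ i = 0\<^sub>v n $ i"
        unfolding mat_apply_index[OF X i v] using i 0[OF i] by (simp add: v_def)
    qed
    moreover have "v \<noteq> 0\<^sub>v n"
    proof
      assume v0: "v = 0\<^sub>v n"
      have "w l i = 0" if "i < n" for i
        using arg_cong[OF v0, of "\<lambda>x. x $ i"] that by (simp add: v_def)
      then show False using orthonormalD[OF w l l] by simp
    qed
    ultimately have "det X = 0" using v det_0_iff_vec_prod_zero_field[OF X] by blast
    then show False using d by simp
  qed
next
  have w: "orthonormal n n w" using b by (simp add: right_singular_basis_def)
  assume s: "\<forall>l<n. 0 < s l"
  show "det X \<noteq> 0"
  proof
    assume "det X = 0"
    then obtain v where v: "v \<in> carrier_vec n" "v \<noteq> 0\<^sub>v n" "X *\<^sub>v v = 0\<^sub>v n"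
      using det_0_iff_vec_prod_zero_field[OF X] by blast
    have "(\<Sum>j<n. X $$ (k, j) * v $ j) = 0" if "k < n" for k
      using mat_apply_index[OF X that v(1)] v(3) that by simp
    then have "(\<Sum>l<n. (s l)\<^sup>2 * (cmod (coord n w (\<lambda>i. v $ i) l))\<^sup>2) = 0"
      using right_singular_basis_norm[OF b, of "\<lambda>i. v $ i"] by simp
    then have "(s l)\<^sup>2 * (cmod (coord n w (\<lambda>i. v $ i) l))\<^sup>2 = 0" if "l < n" for l
      using that by (subst (asm) sum_nonneg_eq_0_iff) auto
    then have "cmod (coord n w (\<lambda>i. v $ i) l) = 0" if "l < n" for l
      using s that by fastforce
    then have "(\<Sum>i<n. (cmod (v $ i))\<^sup>2) = 0"
      using coord_norm[OF w, of "\<lambda>i. v $ i"] by simp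
    then have "v $ i = 0" if "i < n" for i using that by (simp add: sum_nonneg_eq_0_iff)
    then have "v = 0\<^sub>v n" using v(1) by (intro eq_vecI) auto
    then show False using v(2) by simp
  qed
qed

lemma svd_adjoint:
  assumes X: "X \<in> carrier_mat n n" and d: "svd n X w z s"
  shows "svd n (mat_adjoint X) z w s"
  using d X unfolding svd_def by auto

lemma svd_entry:
  assumes d: "svd n X w z s" and ij: "i < n" "j < n"
  shows "X $$ (i, j) = (\<Sum>l<n. z l i * of_real (s l) * cnj (w l j))"
proof -
  have w: "orthonormal n n w" using d by (simp add: svd_def)
  have "(\<Sum>l<n. z l i * of_real (s l) * cnj (w l j)) = (\<Sum>l<n. (\<Sum>k<n. X $$ (i, k) * w l k) * cnj (w l j))"
    using d ij by (intro sum.cong refl) (simp add: svd_def mult.commute)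
  also have "\<dots> = (\<Sum>k<n. \<Sum>l<n. X $$ (i, k) * w l k * cnj (w l j))"
    unfolding sum_distrib_right by (rule sum.swap)
  also have "\<dots> = (\<Sum>k<n. X $$ (i, k) * (if k = j then 1 else 0))"
    by (intro sum.cong refl) (simp add: mult.assoc sum_distrib_left[symmetric] orthonormal_complete[OF w _ ij(2)])
  also have "\<dots> = X $$ (i, j)" using ij by (simp add: if_distrib cong: if_cong)
  finally show ?thesis by simp
qed

section \<open>Functional calculus for powers of the resolvent\<close>

text \<open>One entry of the multiplication rule of the functional calculus: x and y hold the outer
  coordinates at a fixed row and column, and summing over the inner index m cancels the basis
  z.\<close>

lemma spectral_product:
  assumes z: "orthonormal n n z"
  shows "(\<Sum>m<n. (\<Sum>l<n. x l * a l * cnj (z l m)) * (\<Sum>l<n. z l m * b l * y l)) = (\<Sum>l<n. x l * (a l * b l) * y l)"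
proof -
  have "(\<Sum>m<n. (\<Sum>l<n. x l * a l * cnj (z l m)) * (\<Sum>p<n. z p m * b p * y p)) =
    (\<Sum>m<n. \<Sum>l<n. \<Sum>p<n. x l * a l * b p * y p * (z p m * cnj (z l m)))"
    unfolding sum_product by (simp add: mult_ac)
  also have "\<dots> = (\<Sum>l<n. \<Sum>m<n. \<Sum>p<n. x l * a l * b p * y p * (z p m * cnj (z l m)))" by (rule sum.swap)
  also have "\<dots> = (\<Sum>l<n. \<Sum>p<n. x l * a l * b p * y p * (\<Sum>m<n. z p m * cnj (z l m)))"
  proof (rule sum.cong[OF refl])
    fix l
    show "(\<Sum>m<n. \<Sum>p<n. x l * a l * b p * y p * (z p m * cnj (z l m))) = (\<Sum>p<n. x l * a l * b p * y p * (\<Sum>m<n. z p m * cnj (z l m)))"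
      by (subst sum.swap) (simp add: sum_distrib_left)
  qed
  also have "\<dots> = (\<Sum>l<n. \<Sum>p<n. x l * a l * b p * y p * (if p = l then 1 else 0))"
    by (intro sum.cong refl) (simp add: orthonormalD[OF z])
  also have "\<dots> = (\<Sum>l<n. x l * (a l * b l) * y l)"
    by (intro sum.cong refl) (simp add: if_distrib mult.assoc cong: if_cong)
  finally show ?thesis .
qed

text \<open>The inverse of 1 + X X^*, written with the adjugate so that its entries are rational
  functions of the entries of X and hence measurable.\<close>

definition resolvent :: "nat \<Rightarrow> complex mat \<Rightarrow> complex mat" where
  "resolvent n X = (1 / det (1\<^sub>m n + X * mat_adjoint X)) \<cdot>\<^sub>m adj_mat (1\<^sub>m n + X * mat_adjoint X)"

lemma resolvent_carrier [simp]:
  assumes "X \<in> carrier_mat n n" shows "resolvent n X \<in> carrier_mat n n"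
  using adj_mat(1)[of "1\<^sub>m n + X * mat_adjoint X" n] assms by (simp add: resolvent_def)

lemma mult_mat_index:
  assumes "A \<in> carrier_mat n n" "B \<in> carrier_mat n n" "i < n" "j < n"
  shows "(A * B) $$ (i, j) = (\<Sum>k<n. A $$ (i, k) * B $$ (k, j))"
  using assms by (simp add: scalar_prod_def atLeast0LessThan)

text \<open>The spectral sum \<open>K\<close> with weights 1/(1 + s^2) is checked to be a right
  inverse of 1 + X X^*; uniqueness of the inverse identifies it with the adjugate formula.\<close>

lemma resolvent_entry:
  assumes X: "X \<in> carrier_mat n n" and d: "svd n X w z s" and ij: "i < n" "j < n"
  shows "resolvent n X $$ (i, j) = (\<Sum>l<n. z l i * of_real (1 / (1 + (s l)\<^sup>2)) * cnj (z l j))"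
proof -
  define M where "M = 1\<^sub>m n + X * mat_adjoint X"
  define K where "K = mat n n (\<lambda>(i, j). \<Sum>l<n. z l i * of_real (1 / (1 + (s l)\<^sup>2)) * cnj (z l j))"
  have w: "orthonormal n n w" and z: "orthonormal n n z" using d by (auto simp: svd_def)
  have M: "M \<in> carrier_mat n n" and K: "K \<in> carrier_mat n n" using X by (auto simp: M_def K_def)
  have XX: "(X * mat_adjoint X) $$ (i, j) = (\<Sum>l<n. z l i * (of_real (s l) * of_real (s l)) * cnj (z l j))" if "i < n" "j < n" for i j
  proof -
    have "(X * mat_adjoint X) $$ (i, j) = (\<Sum>k<n. X $$ (i, k) * cnj (X $$ (j, k)))"
      unfolding mult_mat_index[OF X mat_adjoint_carrier[OF X] that] using X that by simp
    also have "\<dots> = (\<Sum>k<n. (\<Sum>l<n. z l i * of_real (s l) * cnj (w l k)) * (\<Sum>l<n. w l k * of_real (s l) * cnj (z l j)))"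
      using that by (intro sum.cong refl) (simp add: svd_entry[OF d] mult_ac)
    also have "\<dots> = (\<Sum>l<n. z l i * (of_real (s l) * of_real (s l)) * cnj (z l j))"
      by (rule spectral_product[OF w])
    finally show ?thesis .
  qed
  have Me: "M $$ (i, j) = (\<Sum>l<n. z l i * of_real (1 + (s l)\<^sup>2) * cnj (z l j))" if "i < n" "j < n" for i j
  proof -
    have "M $$ (i, j) = (if i = j then 1 else 0) + (X * mat_adjoint X) $$ (i, j)"
      using X that by (simp add: M_def)
    also have "(if i = j then 1 else 0) = (\<Sum>l<n. z l i * cnj (z l j))"
      by (rule orthonormal_complete[OF z that, symmetric])
    finally show ?thesis unfolding XX[OF that] sum.distrib[symmetric]
      by (rule trans) (intro sum.cong refl, simp add: algebra_simps power2_eq_square)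
  qed
  have MK: "M * K = 1\<^sub>m n"
  proof (rule eq_matI)
    fix i j assume "i < dim_row (1\<^sub>m n)" "j < dim_col (1\<^sub>m n)"
    then have ij: "i < n" "j < n" by auto
    have "(M * K) $$ (i, j) = (\<Sum>m<n. (\<Sum>l<n. z l i * of_real (1 + (s l)\<^sup>2) * cnj (z l m)) * (\<Sum>l<n. z l m * of_real (1 / (1 + (s l)\<^sup>2)) * cnj (z l j)))"
      unfolding mult_mat_index[OF M K ij] using ij by (intro sum.cong refl) (simp add: Me K_def)
    also have "\<dots> = (\<Sum>l<n. z l i * (of_real (1 + (s l)\<^sup>2) * of_real (1 / (1 + (s l)\<^sup>2))) * cnj (z l j))"
      by (rule spectral_product[OF z])
    also have "\<dots> = (\<Sum>l<n. z l i * cnj (z l j))"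
    proof (intro sum.cong refl)
      fix l
      have "1 + (s l)\<^sup>2 \<noteq> 0" using zero_le_power2[of "s l"] by linarith
      then have "complex_of_real (1 + (s l)\<^sup>2) * of_real (1 / (1 + (s l)\<^sup>2)) = 1"
        unfolding of_real_mult[symmetric] by simp
      then show "z l i * (of_real (1 + (s l)\<^sup>2) * of_real (1 / (1 + (s l)\<^sup>2))) * cnj (z l j) = z l i * cnj (z l j)" by simp
    qed
    also have "\<dots> = (if i = j then 1 else 0)" by (rule orthonormal_complete[OF z ij])
    finally show "(M * K) $$ (i, j) = 1\<^sub>m n $$ (i, j)" using ij by simp
  qed (use M K in auto)
  \<comment> \<open>The right inverse shows that the determinant in the denominator is nonzero, so
    the adjugate formula gives a genuine left inverse.\<close>
  have "det M * det K = 1" using det_mult[OF M K] by (simp add: MK)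
  then have dM: "det M \<noteq> 0" by auto
  have R: "resolvent n X = (1 / det M) \<cdot>\<^sub>m adj_mat M" by (simp add: resolvent_def M_def)
  have Rc: "resolvent n X \<in> carrier_mat n n" using X by simp
  have "resolvent n X * M = (1 / det M) \<cdot>\<^sub>m (adj_mat M * M)"
    unfolding R using adj_mat(1)[OF M] M by (intro mult_smult_assoc_mat) auto
  also have "\<dots> = 1\<^sub>m n"
    unfolding adj_mat(3)[OF M] using dM by (intro eq_matI) auto
  finally have RM: "resolvent n X * M = 1\<^sub>m n" .
  have "resolvent n X = resolvent n X * (M * K)" using Rc by (simp add: MK)
  also have "\<dots> = resolvent n X * M * K" using Rc M K by (intro assoc_mult_mat[symmetric]) auto
  also have "\<dots> = K" using K by (simp add: RM)
  finally show ?thesis using ij by (simp add: K_def)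
qed

lemma resolvent_power_entry:
  assumes X: "X \<in> carrier_mat n n" and d: "svd n X w z s" and ij: "i < n" "j < n"
  shows "(resolvent n X ^\<^sub>m k) $$ (i, j) = (\<Sum>l<n. z l i * of_real ((1 / (1 + (s l)\<^sup>2)) ^ k) * cnj (z l j))"
  using ij
proof (induction k arbitrary: i j)
  case 0
  have z: "orthonormal n n z" using d by (simp add: svd_def)
  show ?case using orthonormal_complete[OF z 0] 0 resolvent_carrier[OF X] by simp
next
  case (Suc k)
  have z: "orthonormal n n z" using d by (simp add: svd_def)
  have c: "resolvent n X \<in> carrier_mat n n" "resolvent n X ^\<^sub>m k \<in> carrier_mat n n"
    using X by (auto intro: pow_carrier_mat)
  have "(resolvent n X ^\<^sub>m Suc k) $$ (i, j) = (\<Sum>m<n. (resolvent n X ^\<^sub>m k) $$ (i, m) * resolvent n X $$ (m, j))"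
    using mult_mat_index[OF c(2,1) Suc.prems] by simp
  also have "\<dots> = (\<Sum>m<n. (\<Sum>l<n. z l i * of_real ((1 / (1 + (s l)\<^sup>2)) ^ k) * cnj (z l m)) * (\<Sum>l<n. z l m * of_real (1 / (1 + (s l)\<^sup>2)) * cnj (z l j)))"
    using Suc by (intro sum.cong refl) (simp add: resolvent_entry[OF X d])
  also have "\<dots> = (\<Sum>l<n. z l i * (of_real ((1 / (1 + (s l)\<^sup>2)) ^ k) * of_real (1 / (1 + (s l)\<^sup>2))) * cnj (z l j))"
    by (rule spectral_product[OF z])
  also have "\<dots> = (\<Sum>l<n. z l i * of_real ((1 / (1 + (s l)\<^sup>2)) ^ Suc k) * cnj (z l j))"
    unfolding of_real_mult[symmetric] power_Suc2 ..
  finally show ?case .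
qed

lemma resolvent_power_mult_entry:
  assumes X: "X \<in> carrier_mat n n" and d: "svd n X w z s" and ij: "i < n" "j < n"
  shows "(resolvent n X ^\<^sub>m k * X) $$ (i, j) = (\<Sum>l<n. z l i * of_real ((1 / (1 + (s l)\<^sup>2)) ^ k * s l) * cnj (w l j))"
proof -
  have z: "orthonormal n n z" using d by (simp add: svd_def)
  have c: "resolvent n X ^\<^sub>m k \<in> carrier_mat n n" using X by (auto intro: pow_carrier_mat)
  have "(resolvent n X ^\<^sub>m k * X) $$ (i, j) = (\<Sum>m<n. (\<Sum>l<n. z l i * of_real ((1 / (1 + (s l)\<^sup>2)) ^ k) * cnj (z l m)) * (\<Sum>l<n. z l m * of_real (s l) * cnj (w l j)))"
    unfolding mult_mat_index[OF c X ij]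
    using ij by (intro sum.cong refl) (simp only: resolvent_power_entry[OF X d] svd_entry[OF d] lessThan_iff)
  also have "\<dots> = (\<Sum>l<n. z l i * (of_real ((1 / (1 + (s l)\<^sup>2)) ^ k) * of_real (s l)) * cnj (w l j))"
    by (rule spectral_product[OF z])
  finally show ?thesis unfolding of_real_mult[symmetric] .
qed

text \<open>The squared norm of row i is the sum of d_l^2 |z_l i|^2, and the |z_l i|^2 sum to 1 by
  completeness.\<close>

lemma spectral_row_bound:
  assumes z: "orthonormal n n z" and w: "orthonormal n n w" and d: "\<And>l. l < n \<Longrightarrow> \<bar>d l\<bar> \<le> 1" and i: "i < n"
  shows "(\<Sum>j<n. (cmod (\<Sum>l<n. z l i * of_real (d l) * cnj (w l j)))\<^sup>2) \<le> 1"
proof -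
  have "complex_of_real (\<Sum>j<n. (cmod (\<Sum>l<n. z l i * of_real (d l) * cnj (w l j)))\<^sup>2) =
    (\<Sum>j<n. (\<Sum>l<n. z l i * of_real (d l) * cnj (w l j)) * (\<Sum>l<n. w l j * of_real (d l) * cnj (z l i)))"
    unfolding sum_mult_cnj[symmetric] by (intro sum.cong refl) (simp add: mult_ac)
  also have "\<dots> = (\<Sum>l<n. z l i * (of_real (d l) * of_real (d l)) * cnj (z l i))"
    by (rule spectral_product[OF w])
  also have "\<dots> = (\<Sum>l<n. of_real ((d l)\<^sup>2 * (cmod (z l i))\<^sup>2))"
    unfolding of_real_mult complex_norm_square by (intro sum.cong refl) (simp add: power2_eq_square mult_ac)
  also have "\<dots> = of_real (\<Sum>l<n. (d l)\<^sup>2 * (cmod (z l i))\<^sup>2)" by simp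
  finally have "(\<Sum>j<n. (cmod (\<Sum>l<n. z l i * of_real (d l) * cnj (w l j)))\<^sup>2) = (\<Sum>l<n. (d l)\<^sup>2 * (cmod (z l i))\<^sup>2)"
    using of_real_eq_iff by blast
  also have "\<dots> \<le> (\<Sum>l<n. 1 * (cmod (z l i))\<^sup>2)"
    using d by (intro sum_mono mult_right_mono) (auto simp: abs_square_le_1)
  also have "\<dots> = 1"
  proof -
    have "complex_of_real (\<Sum>l<n. (cmod (z l i))\<^sup>2) = 1"
      unfolding sum_mult_cnj[symmetric] using orthonormal_complete[OF z i i] by simp
    then show ?thesis by (simp add: of_real_eq_1_iff del: of_real_sum)
  qed
  finally show ?thesis .
qed

lemma spectral_col_bound:
  assumes z: "orthonormal n n z" and w: "orthonormal n n w" and d: "\<And>l. l < n \<Longrightarrow> \<bar>d l\<bar> \<le> 1" and j: "j < n"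
  shows "(\<Sum>i<n. (cmod (\<Sum>l<n. z l i * of_real (d l) * cnj (w l j)))\<^sup>2) \<le> 1"
proof -
  have "cmod (\<Sum>l<n. z l i * of_real (d l) * cnj (w l j)) = cmod (\<Sum>l<n. w l j * of_real (d l) * cnj (z l i))" for i
  proof -
    have "cnj (\<Sum>l<n. z l i * of_real (d l) * cnj (w l j)) = (\<Sum>l<n. w l j * of_real (d l) * cnj (z l i))"
      by (simp add: mult_ac)
    from arg_cong[OF this, of cmod] show ?thesis by (simp only: complex_mod_cnj)
  qed
  then show ?thesis using spectral_row_bound[OF w z d j] by (simp only:)
qed

lemma spectral_trace:
  assumes z: "orthonormal n n z"
  shows "(\<Sum>i<n. \<Sum>l<n. z l i * of_real (d l) * cnj (z l i)) = of_real (\<Sum>l<n. d l)"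
proof -
  have "(\<Sum>i<n. \<Sum>l<n. z l i * of_real (d l) * cnj (z l i)) = (\<Sum>l<n. of_real (d l) * (\<Sum>i<n. z l i * cnj (z l i)))"
    by (subst sum.swap) (simp add: sum_distrib_left mult_ac)
  also have "\<dots> = (\<Sum>l<n. of_real (d l))" by (intro sum.cong refl) (simp add: orthonormalD[OF z])
  finally show ?thesis by simp
qed

lemma spectral_form:
  "(\<Sum>i<n. \<Sum>j<n. (\<Sum>l<n. z l i * of_real (d l) * cnj (w l j)) * cnj (x i) * y j) =
    (\<Sum>l<n. of_real (d l) * coord n w y l * cnj (coord n z x l))"
proof -
  have "(\<Sum>i<n. \<Sum>j<n. (\<Sum>l<n. z l i * of_real (d l) * cnj (w l j)) * cnj (x i) * y j) =
    (\<Sum>i<n. \<Sum>j<n. \<Sum>l<n. of_real (d l) * (y j * cnj (w l j)) * (cnj (x i) * z l i))"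
    by (simp add: sum_distrib_right) (simp add: mult_ac)
  also have "\<dots> = (\<Sum>i<n. \<Sum>l<n. \<Sum>j<n. of_real (d l) * (y j * cnj (w l j)) * (cnj (x i) * z l i))"
    by (intro sum.cong refl sum.swap)
  also have "\<dots> = (\<Sum>l<n. \<Sum>i<n. \<Sum>j<n. of_real (d l) * (y j * cnj (w l j)) * (cnj (x i) * z l i))"
    by (rule sum.swap)
  also have "\<dots> = (\<Sum>l<n. of_real (d l) * coord n w y l * cnj (coord n z x l))"
  proof (rule sum.cong[OF refl])
    fix l
    show "(\<Sum>i<n. \<Sum>j<n. of_real (d l) * (y j * cnj (w l j)) * (cnj (x i) * z l i)) = of_real (d l) * coord n w y l * cnj (coord n z x l)"
      by (subst sum.swap) (simp add: coord_def sum_distrib_left sum_distrib_right mult_ac)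
  qed
  finally show ?thesis .
qed

section \<open>Measurability of matrix-valued functions\<close>

definition random_mat :: "'a measure \<Rightarrow> nat \<Rightarrow> ('a \<Rightarrow> complex mat) \<Rightarrow> bool" where
  "random_mat M n f \<longleftrightarrow> (\<forall>\<omega>\<in>space M. f \<omega> \<in> carrier_mat n n) \<and>
     (\<forall>i<n. \<forall>j<n. (\<lambda>\<omega>. f \<omega> $$ (i, j)) \<in> borel_measurable M)"

lemma random_matD:
  assumes "random_mat M n f"
  shows "\<omega> \<in> space M \<Longrightarrow> f \<omega> \<in> carrier_mat n n"
    and "i < n \<Longrightarrow> j < n \<Longrightarrow> (\<lambda>\<omega>. f \<omega> $$ (i, j)) \<in> borel_measurable M"
  using assms by (auto simp: random_mat_def)

lemma random_matI:
  assumes "\<And>\<omega>. \<omega> \<in> space M \<Longrightarrow> f \<omega> \<in> carrier_mat n n"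
    and "\<And>i j. i < n \<Longrightarrow> j < n \<Longrightarrow> g i j \<in> borel_measurable M"
    and "\<And>i j \<omega>. i < n \<Longrightarrow> j < n \<Longrightarrow> \<omega> \<in> space M \<Longrightarrow> f \<omega> $$ (i, j) = g i j \<omega>"
  shows "random_mat M n f"
  unfolding random_mat_def
proof (intro conjI ballI allI impI)
  fix i j assume ij: "i < n" "j < n"
  have "(\<lambda>\<omega>. f \<omega> $$ (i, j)) \<in> borel_measurable M \<longleftrightarrow> g i j \<in> borel_measurable M"
    by (rule measurable_cong) (use assms(3) ij in auto)
  then show "(\<lambda>\<omega>. f \<omega> $$ (i, j)) \<in> borel_measurable M" using assms(2)[OF ij] by simp
qed (use assms in auto)

lemma random_mat_det:
  assumes f: "random_mat M n f"
  shows "(\<lambda>\<omega>. det (f \<omega>)) \<in> borel_measurable M"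
proof -
  have "(\<lambda>\<omega>. \<Sum>p\<in>{p. p permutes {0..<n}}. signof p * (\<Prod>i=0..<n. f \<omega> $$ (i, p i))) \<in> borel_measurable M"
  proof (intro borel_measurable_sum borel_measurable_times borel_measurable_prod borel_measurable_const)
    fix p i assume "p \<in> {p. p permutes {0..<n}}" "i \<in> {0..<n}"
    then have "i < n" "p i < n" using permutes_in_image[of p "{0..<n}" i] by auto
    then show "(\<lambda>\<omega>. f \<omega> $$ (i, p i)) \<in> borel_measurable M" by (rule random_matD(2)[OF f])
  qed
  also have "?this \<longleftrightarrow> ?thesis"
    by (intro measurable_cong) (simp add: det_def'[OF random_matD(1)[OF f]])
  finally show ?thesis .
qed

lemma random_mat_adj:
  assumes f: "random_mat M n f"
  shows "random_mat M n (\<lambda>\<omega>. adj_mat (f \<omega>))"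
proof (rule random_matI[where g = "\<lambda>i j \<omega>. (-1) ^ (j + i) * det (mat_delete (f \<omega>) j i)"])
  show "adj_mat (f \<omega>) \<in> carrier_mat n n" if "\<omega> \<in> space M" for \<omega>
    by (rule adj_mat(1)[OF random_matD(1)[OF f that]])
  fix i j assume ij: "i < n" "j < n"
  have "random_mat M (n - 1) (\<lambda>\<omega>. mat_delete (f \<omega>) j i)"
  proof (rule random_matI[where g = "\<lambda>i' j' \<omega>. f \<omega> $$ (if i' < j then i' else Suc i', if j' < i then j' else Suc j')"])
    show "mat_delete (f \<omega>) j i \<in> carrier_mat (n - 1) (n - 1)" if "\<omega> \<in> space M" for \<omega>
      by (rule mat_delete_carrier[OF random_matD(1)[OF f that]])
    fix i' j' assume i': "i' < n - 1" "j' < n - 1"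
    show "(\<lambda>\<omega>. f \<omega> $$ (if i' < j then i' else Suc i', if j' < i then j' else Suc j')) \<in> borel_measurable M"
      using i' by (intro random_matD(2)[OF f]) auto
    show "mat_delete (f \<omega>) j i $$ (i', j') = f \<omega> $$ (if i' < j then i' else Suc i', if j' < i then j' else Suc j')"
      if "\<omega> \<in> space M" for \<omega>
      using random_matD(1)[OF f that] i' by (simp add: mat_delete_def)
  qed
  from random_mat_det[OF this]
  show "(\<lambda>\<omega>. (-1) ^ (j + i) * det (mat_delete (f \<omega>) j i)) \<in> borel_measurable M" by simp
  show "adj_mat (f \<omega>) $$ (i, j) = (-1) ^ (j + i) * det (mat_delete (f \<omega>) j i)" if "\<omega> \<in> space M" for \<omega>
    using random_matD(1)[OF f that] ij by (simp add: adj_mat_def cofactor_def)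
qed

lemma random_mat_mult:
  assumes f: "random_mat M n f" and g: "random_mat M n g"
  shows "random_mat M n (\<lambda>\<omega>. f \<omega> * g \<omega>)"
proof (rule random_matI[where g = "\<lambda>i j \<omega>. \<Sum>k<n. f \<omega> $$ (i, k) * g \<omega> $$ (k, j)"])
  show "f \<omega> * g \<omega> \<in> carrier_mat n n" if "\<omega> \<in> space M" for \<omega>
    using random_matD(1)[OF f that] random_matD(1)[OF g that] by simp
  fix i j assume ij: "i < n" "j < n"
  show "(\<lambda>\<omega>. \<Sum>k<n. f \<omega> $$ (i, k) * g \<omega> $$ (k, j)) \<in> borel_measurable M"
    using ij by (intro borel_measurable_sum borel_measurable_times random_matD(2)[OF f] random_matD(2)[OF g]) auto
  show "(f \<omega> * g \<omega>) $$ (i, j) = (\<Sum>k<n. f \<omega> $$ (i, k) * g \<omega> $$ (k, j))" if "\<omega> \<in> space M" for \<omega>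
    by (rule mult_mat_index[OF random_matD(1)[OF f that] random_matD(1)[OF g that] ij])
qed

lemma measurable_cnj [measurable]: "cnj \<in> borel_measurable borel"
  by (intro borel_measurable_continuous_onI continuous_intros)

lemma random_mat_adjoint:
  assumes f: "random_mat M n f"
  shows "random_mat M n (\<lambda>\<omega>. mat_adjoint (f \<omega>))"
proof (rule random_matI[where g = "\<lambda>i j \<omega>. cnj (f \<omega> $$ (j, i))"])
  show "mat_adjoint (f \<omega>) \<in> carrier_mat n n" if "\<omega> \<in> space M" for \<omega>
    using random_matD(1)[OF f that] by simp
  fix i j assume ij: "i < n" "j < n"
  show "(\<lambda>\<omega>. cnj (f \<omega> $$ (j, i))) \<in> borel_measurable M"
    by (rule measurable_compose[OF random_matD(2)[OF f ij(2,1)] measurable_cnj])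
  show "mat_adjoint (f \<omega>) $$ (i, j) = cnj (f \<omega> $$ (j, i))" if "\<omega> \<in> space M" for \<omega>
    using random_matD(1)[OF f that] ij by simp
qed

lemma random_mat_resolvent:
  assumes f: "random_mat M n f"
  shows "random_mat M n (\<lambda>\<omega>. resolvent n (f \<omega>))"
proof -
  note p = random_mat_mult[OF f random_mat_adjoint[OF f]]
  have K: "random_mat M n (\<lambda>\<omega>. 1\<^sub>m n + f \<omega> * mat_adjoint (f \<omega>))"
  proof (rule random_matI[where g = "\<lambda>i j \<omega>. (if i = j then 1 else 0) + (f \<omega> * mat_adjoint (f \<omega>)) $$ (i, j)"])
    show "1\<^sub>m n + f \<omega> * mat_adjoint (f \<omega>) \<in> carrier_mat n n" if "\<omega> \<in> space M" for \<omega>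
      using random_matD(1)[OF p that] by simp
    fix i j assume ij: "i < n" "j < n"
    show "(\<lambda>\<omega>. (if i = j then 1 else 0) + (f \<omega> * mat_adjoint (f \<omega>)) $$ (i, j)) \<in> borel_measurable M"
      using random_matD(2)[OF p ij] by simp
    show "(1\<^sub>m n + f \<omega> * mat_adjoint (f \<omega>)) $$ (i, j) = (if i = j then 1 else 0) + (f \<omega> * mat_adjoint (f \<omega>)) $$ (i, j)"
      if "\<omega> \<in> space M" for \<omega>
      using random_matD(1)[OF f that] ij by simp
  qed
  note a = random_mat_adj[OF K]
  show ?thesis
  proof (rule random_matI[where g = "\<lambda>i j \<omega>. (1 / det (1\<^sub>m n + f \<omega> * mat_adjoint (f \<omega>))) * adj_mat (1\<^sub>m n + f \<omega> * mat_adjoint (f \<omega>)) $$ (i, j)"])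
    show "resolvent n (f \<omega>) \<in> carrier_mat n n" if "\<omega> \<in> space M" for \<omega>
      using random_matD(1)[OF f that] by simp
    fix i j assume ij: "i < n" "j < n"
    show "(\<lambda>\<omega>. (1 / det (1\<^sub>m n + f \<omega> * mat_adjoint (f \<omega>))) * adj_mat (1\<^sub>m n + f \<omega> * mat_adjoint (f \<omega>)) $$ (i, j)) \<in> borel_measurable M"
      by (intro borel_measurable_times borel_measurable_divide borel_measurable_const random_mat_det[OF K] random_matD(2)[OF a ij])
    show "resolvent n (f \<omega>) $$ (i, j) = (1 / det (1\<^sub>m n + f \<omega> * mat_adjoint (f \<omega>))) * adj_mat (1\<^sub>m n + f \<omega> * mat_adjoint (f \<omega>)) $$ (i, j)"
      if "\<omega> \<in> space M" for \<omega>
      using random_matD(1)[OF a that] ij by (simp add: resolvent_def)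
  qed
qed

lemma random_mat_power:
  assumes f: "random_mat M n f"
  shows "random_mat M n (\<lambda>\<omega>. f \<omega> ^\<^sub>m k)"
proof (induction k)
  case 0
  show ?case
  proof (rule random_matI[where g = "\<lambda>i j _. if i = j then 1 else 0"])
    show "f \<omega> ^\<^sub>m 0 \<in> carrier_mat n n" if "\<omega> \<in> space M" for \<omega>
      using random_matD(1)[OF f that] by simp
    show "(f \<omega> ^\<^sub>m 0) $$ (i, j) = (if i = j then 1 else 0)" if "i < n" "j < n" "\<omega> \<in> space M" for i j \<omega>
      using random_matD(1)[OF f that(3)] that by simp
  qed simp
next
  case (Suc k)
  then show ?case using random_mat_mult[OF Suc f] by simp
qed

section \<open>Almost sure concentration of quadratic forms with random coefficients\<close>

text \<open>The form g^* C g minus its expectation: for a standardized family g and a fixed matrix C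
  the expectation is the trace of C.\<close>

definition centered_form :: "nat \<Rightarrow> (nat \<Rightarrow> nat \<Rightarrow> complex) \<Rightarrow> (nat \<Rightarrow> complex) \<Rightarrow> complex" where
  "centered_form N C g = (\<Sum>i<N. \<Sum>j<N. C i j * cnj (g i) * g j) - (\<Sum>i<N. C i i)"

text \<open>The library predicate \<open>indep_var\<close> forces both maps to have the same codomain type.\<close>
definition indep_maps :: "'a measure \<Rightarrow> 'b measure \<Rightarrow> ('a \<Rightarrow> 'b) \<Rightarrow> 'c measure \<Rightarrow> ('a \<Rightarrow> 'c) \<Rightarrow> bool" where
  "indep_maps M S Y T H \<longleftrightarrow> Y \<in> measurable M S \<and> H \<in> measurable M T \<and>
     (\<forall>A\<in>sets S. \<forall>B\<in>sets T. measure M ((Y -` A \<inter> space M) \<inter> (H -` B \<inter> space M)) =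
        measure M (Y -` A \<inter> space M) * measure M (H -` B \<inter> space M))"

lemma (in prob_space) indep_maps_distr:
  assumes "indep_maps M S Y T H"
  shows "distr M (S \<Otimes>\<^sub>M T) (\<lambda>\<omega>. (Y \<omega>, H \<omega>)) = distr M S Y \<Otimes>\<^sub>M distr M T H"
proof (rule pair_measure_eqI[symmetric])
  have Y: "Y \<in> measurable M S" and H: "H \<in> measurable M T"
    using assms by (auto simp: indep_maps_def)
  interpret DY: prob_space "distr M S Y" by (rule prob_space_distr[OF Y])
  interpret DH: prob_space "distr M T H" by (rule prob_space_distr[OF H])
  show "sigma_finite_measure (distr M S Y)" "sigma_finite_measure (distr M T H)" by unfold_locales
  show "sets (distr M S Y \<Otimes>\<^sub>M distr M T H) = sets (distr M (S \<Otimes>\<^sub>M T) (\<lambda>\<omega>. (Y \<omega>, H \<omega>)))"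
    by (simp cong: sets_pair_measure_cong)
  fix A B assume "A \<in> sets (distr M S Y)" "B \<in> sets (distr M T H)"
  then have AB: "A \<in> sets S" "B \<in> sets T" by auto
  have "emeasure (distr M (S \<Otimes>\<^sub>M T) (\<lambda>\<omega>. (Y \<omega>, H \<omega>))) (A \<times> B) = emeasure M ((\<lambda>\<omega>. (Y \<omega>, H \<omega>)) -` (A \<times> B) \<inter> space M)"
    using Y H AB by (intro emeasure_distr) auto
  also have "(\<lambda>\<omega>. (Y \<omega>, H \<omega>)) -` (A \<times> B) \<inter> space M = (Y -` A \<inter> space M) \<inter> (H -` B \<inter> space M)" by auto
  finally show "emeasure (distr M S Y) A * emeasure (distr M T H) B = emeasure (distr M (S \<Otimes>\<^sub>M T) (\<lambda>\<omega>. (Y \<omega>, H \<omega>))) (A \<times> B)"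
    using assms AB Y H by (simp add: emeasure_distr emeasure_eq_measure ennreal_mult[symmetric] indep_maps_def)
qed

text \<open>Independence makes the joint law of Y and h a product, so by Fubini Y can be frozen. For
  each frozen value \<open>quadratic_form_E4\<close> applies with a bound that does not depend on
  it.\<close>

lemma random_form_E4:
  assumes fam: "standardized_family M h N m"
    and ind: "indep_maps M S Y (PiM {..<N} (\<lambda>_. borel)) (\<lambda>\<omega>. \<lambda>i\<in>{..<N}. h i \<omega>)"
    and C: "\<And>i j. i < N \<Longrightarrow> j < N \<Longrightarrow> (\<lambda>y. C y i j) \<in> borel_measurable S"
    and rows: "\<And>y i. y \<in> space S \<Longrightarrow> i < N \<Longrightarrow> (\<Sum>j<N. (cmod (C y i j))\<^sup>2) \<le> 1"
    and cols: "\<And>y j. y \<in> space S \<Longrightarrow> j < N \<Longrightarrow> (\<Sum>i<N. (cmod (C y i j))\<^sup>2) \<le> 1"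
  shows "(\<lambda>\<omega>. centered_form N (C (Y \<omega>)) (\<lambda>i. h i \<omega>)) \<in> borel_measurable M"
    and "(\<integral>\<^sup>+\<omega>. ennreal (cmod (centered_form N (C (Y \<omega>)) (\<lambda>i. h i \<omega>)) ^ 4) \<partial>M)
      \<le> ennreal (16 * (8 * m + 2048 * m\<^sup>2) * (real N)\<^sup>2)"
proof -
  interpret standardized_family M h N m by fact
  define T where "T = PiM {..<N} (\<lambda>_::nat. borel :: complex measure)"
  define H where "H = (\<lambda>\<omega>. \<lambda>i\<in>{..<N}. h i \<omega>)"
  have Y: "Y \<in> measurable M S" and H: "H \<in> measurable M T"
    using ind unfolding indep_maps_def H_def T_def by auto
  define q where "q = (\<lambda>(y, g). centered_form N (C y) g)"
  have q [measurable]: "q \<in> borel_measurable (S \<Otimes>\<^sub>M T)"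
  proof -
    have 1: "(\<lambda>x. C (fst x) i j) \<in> borel_measurable (S \<Otimes>\<^sub>M T)" if "i < N" "j < N" for i j
      by (rule measurable_compose[OF measurable_fst C[OF that]])
    have 2: "(\<lambda>x. snd x i) \<in> borel_measurable (S \<Otimes>\<^sub>M T)" if "i < N" for i
      unfolding T_def by (rule measurable_compose[OF measurable_snd]) (use that in simp)
    have 3: "(\<lambda>x. cnj (snd x i)) \<in> borel_measurable (S \<Otimes>\<^sub>M T)" if "i < N" for i
      by (rule measurable_compose[OF 2[OF that] measurable_cnj])
    have "(\<lambda>x. (\<Sum>i<N. \<Sum>j<N. C (fst x) i j * cnj (snd x i) * snd x j) - (\<Sum>i<N. C (fst x) i i)) \<in> borel_measurable (S \<Otimes>\<^sub>M T)"
      by (intro borel_measurable_diff borel_measurable_sum borel_measurable_times 1 2 3) auto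
    then show ?thesis by (simp add: q_def centered_form_def case_prod_beta)
  qed
  have YH: "(\<lambda>\<omega>. (Y \<omega>, H \<omega>)) \<in> measurable M (S \<Otimes>\<^sub>M T)" using Y H by measurable
  have qe: "q (Y \<omega>, H \<omega>) = centered_form N (C (Y \<omega>)) (\<lambda>i. h i \<omega>)" for \<omega>
    by (simp add: q_def centered_form_def H_def)
  show "(\<lambda>\<omega>. centered_form N (C (Y \<omega>)) (\<lambda>i. h i \<omega>)) \<in> borel_measurable M"
    using measurable_compose[OF YH q] by (simp add: qe)
  interpret DY: prob_space "distr M S Y" by (rule prob_space_distr[OF Y])
  interpret DH: prob_space "distr M T H" by (rule prob_space_distr[OF H])
  have qm: "(\<lambda>x. ennreal (cmod (q x) ^ 4)) \<in> borel_measurable (S \<Otimes>\<^sub>M T)" by measurable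
  have "(\<integral>\<^sup>+\<omega>. ennreal (cmod (q (Y \<omega>, H \<omega>)) ^ 4) \<partial>M) = (\<integral>\<^sup>+x. ennreal (cmod (q x) ^ 4) \<partial>distr M (S \<Otimes>\<^sub>M T) (\<lambda>\<omega>. (Y \<omega>, H \<omega>)))"
    by (rule nn_integral_distr[OF YH, symmetric]) (simp add: qm)
  also have "distr M (S \<Otimes>\<^sub>M T) (\<lambda>\<omega>. (Y \<omega>, H \<omega>)) = distr M S Y \<Otimes>\<^sub>M distr M T H"
    using indep_maps_distr[OF ind] by (simp add: T_def H_def)
  also have "(\<integral>\<^sup>+x. ennreal (cmod (q x) ^ 4) \<partial>(distr M S Y \<Otimes>\<^sub>M distr M T H)) =
      (\<integral>\<^sup>+y. \<integral>\<^sup>+g. ennreal (cmod (q (y, g)) ^ 4) \<partial>distr M T H \<partial>distr M S Y)"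
    by (rule DH.nn_integral_fst[symmetric]) (use qm in \<open>simp cong: measurable_cong_sets sets_pair_measure_cong\<close>)
  also have "\<dots> \<le> (\<integral>\<^sup>+y. ennreal (16 * (8 * m + 2048 * m\<^sup>2) * (real N)\<^sup>2) \<partial>distr M S Y)"
  proof (rule nn_integral_mono)
    fix y assume "y \<in> space (distr M S Y)"
    then have y: "y \<in> space S" by simp
    have qy: "(\<lambda>g. ennreal (cmod (q (y, g)) ^ 4)) \<in> borel_measurable T"
      using measurable_compose[OF measurable_Pair1'[OF y] qm] by simp
    define Q where "Q = (\<lambda>\<omega>. (\<Sum>i<N. \<Sum>j<N. C y i j * cnj (h i \<omega>) * h j \<omega>) - (\<Sum>i<N. C y i i))"
    have Q: "L4 M Q" "E4 M Q \<le> 16 * (8 * m + 2048 * m\<^sup>2) * (real N)\<^sup>2"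
      using quadratic_form_E4[of "C y" N] rows[OF y] cols[OF y] unfolding Q_def by auto
    have "(\<integral>\<^sup>+g. ennreal (cmod (q (y, g)) ^ 4) \<partial>distr M T H) = (\<integral>\<^sup>+\<omega>. ennreal (cmod (q (y, H \<omega>)) ^ 4) \<partial>M)"
      by (rule nn_integral_distr[OF H]) (simp add: qy)
    also have "\<dots> = (\<integral>\<^sup>+\<omega>. ennreal (cmod (Q \<omega>) ^ 4) \<partial>M)"
      by (simp add: q_def Q_def centered_form_def H_def)
    also have "\<dots> = ennreal (E4 M Q)"
      unfolding E4_def using Q(1) by (intro nn_integral_eq_integral) (auto simp: L4_def)
    also have "\<dots> \<le> ennreal (16 * (8 * m + 2048 * m\<^sup>2) * (real N)\<^sup>2)" by (rule ennreal_leI[OF Q(2)])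
    finally show "(\<integral>\<^sup>+g. ennreal (cmod (q (y, g)) ^ 4) \<partial>distr M T H) \<le> ennreal (16 * (8 * m + 2048 * m\<^sup>2) * (real N)\<^sup>2)" .
  qed
  also have "\<dots> = ennreal (16 * (8 * m + 2048 * m\<^sup>2) * (real N)\<^sup>2)"
    using DY.emeasure_space_1 by simp
  finally show "(\<integral>\<^sup>+\<omega>. ennreal (cmod (centered_form N (C (Y \<omega>)) (\<lambda>i. h i \<omega>)) ^ 4) \<partial>M)
      \<le> ennreal (16 * (8 * m + 2048 * m\<^sup>2) * (real N)\<^sup>2)" by (simp add: qe)
qed

text \<open>The fourth moments of f_n / n are at most K / n^2 and hence summable, so the series of
  fourth powers converges almost surely and its terms tend to 0.\<close>

lemma AE_tendsto_0_of_fourth_moments: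
  fixes f :: "nat \<Rightarrow> 'a \<Rightarrow> complex"
  assumes f [measurable]: "\<And>n. f n \<in> borel_measurable M" and K: "0 \<le> K"
    and bound: "\<And>n. (\<integral>\<^sup>+\<omega>. ennreal (cmod (f n \<omega>) ^ 4) \<partial>M) \<le> ennreal (K * (real n)\<^sup>2)"
  shows "AE \<omega> in M. (\<lambda>n. f n \<omega> / of_nat n) \<longlonglongrightarrow> 0"
proof -
  define g where "g = (\<lambda>n \<omega>. ennreal (cmod (f n \<omega> / of_nat n) ^ 4))"
  have [measurable]: "g n \<in> borel_measurable M" for n unfolding g_def by measurable
  have gb: "(\<integral>\<^sup>+\<omega>. g n \<omega> \<partial>M) \<le> ennreal (K * (1 / (real n)\<^sup>2))" for n
  \<comment> \<open>At n = 0 both sides are 0, by the convention x / 0 = 0.\<close>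
  proof (cases "n = 0")
    case True
    then show ?thesis by (simp add: g_def)
  next
    case False
    have "g n \<omega> = ennreal (1 / (real n) ^ 4) * ennreal (cmod (f n \<omega>) ^ 4)" for \<omega>
      unfolding g_def by (subst ennreal_mult[symmetric]) (auto simp: norm_divide power_divide)
    then have "(\<integral>\<^sup>+\<omega>. g n \<omega> \<partial>M) = ennreal (1 / (real n) ^ 4) * (\<integral>\<^sup>+\<omega>. ennreal (cmod (f n \<omega>) ^ 4) \<partial>M)"
      by (simp add: nn_integral_cmult)
    also have "\<dots> \<le> ennreal (1 / (real n) ^ 4) * ennreal (K * (real n)\<^sup>2)" by (intro mult_left_mono bound) simp
    also have "\<dots> = ennreal (1 / (real n) ^ 4 * (K * (real n)\<^sup>2))" using K by (subst ennreal_mult) auto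
    also have "1 / (real n) ^ 4 * (K * (real n)\<^sup>2) = K * (1 / (real n)\<^sup>2)"
      using False by (simp add: power4_eq_xxxx power2_eq_square)
    finally show ?thesis .
  qed
  have sm: "summable (\<lambda>n. K * (1 / (real n)\<^sup>2))"
    using inverse_power_summable[of 2, where 'a = real] by (intro summable_mult) (simp add: divide_inverse)
  have "(\<integral>\<^sup>+\<omega>. (\<Sum>n. g n \<omega>) \<partial>M) = (\<Sum>n. \<integral>\<^sup>+\<omega>. g n \<omega> \<partial>M)" by (rule nn_integral_suminf) measurable
  also have "\<dots> \<le> (\<Sum>n. ennreal (K * (1 / (real n)\<^sup>2)))" by (intro suminf_le gb) auto
  also have "\<dots> = ennreal (\<Sum>n. K * (1 / (real n)\<^sup>2))" by (rule suminf_ennreal2[OF _ sm]) (use K in simp)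
  finally have "(\<integral>\<^sup>+\<omega>. (\<Sum>n. g n \<omega>) \<partial>M) \<noteq> \<infinity>" by (auto simp: top_unique)
  then have "AE \<omega> in M. (\<Sum>n. g n \<omega>) \<noteq> \<infinity>" by (intro nn_integral_noteq_infinite) auto
  then show ?thesis
  proof eventually_elim
    case (elim \<omega>)
    then have "summable (\<lambda>n. cmod (f n \<omega> / of_nat n) ^ 4)"
      unfolding g_def by (intro summable_suminf_not_top) auto
    then have "(\<lambda>n. cmod (f n \<omega> / of_nat n) ^ 4) \<longlonglongrightarrow> 0" by (rule summable_LIMSEQ_zero)
    then have "(\<lambda>n. root 4 (cmod (f n \<omega> / of_nat n) ^ 4)) \<longlonglongrightarrow> root 4 0" by (rule tendsto_real_root)
    then have "(\<lambda>n. cmod (f n \<omega> / of_nat n)) \<longlonglongrightarrow> 0" by (simp add: real_root_power_cancel)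
    then show ?case by (simp add: tendsto_norm_zero_iff)
  qed
qed

lemma sum_double: "(\<Sum>i<2 * n. f i) = (\<Sum>i<n. f i) + (\<Sum>i<n. f (n + i :: nat))"
  for f :: "nat \<Rightarrow> 'b::comm_monoid_add"
proof -
  have "(\<Sum>i<n + m. f i) = (\<Sum>i<n. f i) + (\<Sum>i<m. f (n + i))" for m
    by (induction m) (auto simp: add.assoc)
  from this[of n] show ?thesis by (simp add: mult_2)
qed

text \<open>With g the concatenation of the two random vectors, the coefficients are 2n x 2n
  matrices with one nonzero block: upper left for u against u, lower right for v against v, upper
  right for u against v. They are set to 0 for singular A, so that the row and column bounds hold
  for every A; the random matrices are invertible for all large n
  (\<open>eventually_det_nonzero\<close>).\<close>

definition uu_coeff :: "nat \<Rightarrow> nat \<Rightarrow> complex mat \<Rightarrow> nat \<Rightarrow> nat \<Rightarrow> complex" where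
  "uu_coeff k n A i j = (if det A \<noteq> 0 \<and> i < n \<and> j < n then (resolvent n A ^\<^sub>m k) $$ (i, j) else 0)"

definition vv_coeff :: "nat \<Rightarrow> nat \<Rightarrow> complex mat \<Rightarrow> nat \<Rightarrow> nat \<Rightarrow> complex" where
  "vv_coeff k n A i j = (if det A \<noteq> 0 \<and> n \<le> i \<and> n \<le> j then (resolvent n (mat_adjoint A) ^\<^sub>m k) $$ (i - n, j - n) else 0)"

text \<open>The exponent starts at 1: the factor s contributed by A is unbounded, but s/(1 + s^2) is
  at most 1.\<close>

definition uv_coeff :: "nat \<Rightarrow> nat \<Rightarrow> complex mat \<Rightarrow> nat \<Rightarrow> nat \<Rightarrow> complex" where
  "uv_coeff k n A i j = (if det A \<noteq> 0 \<and> i < n \<and> n \<le> j then (resolvent n A ^\<^sub>m Suc k * A) $$ (i, j - n) else 0)"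

text \<open>What \<open>random_form_E4\<close> asks of the coefficients, for matrices presented
  through their n^2 entries.\<close>

definition admissible_coeff :: "nat \<Rightarrow> (complex mat \<Rightarrow> nat \<Rightarrow> nat \<Rightarrow> complex) \<Rightarrow> bool" where
  "admissible_coeff n C \<longleftrightarrow>
     (\<forall>i<2 * n. \<forall>j<2 * n. (\<lambda>x. C (mat n n x) i j) \<in> borel_measurable (PiM ({..<n} \<times> {..<n}) (\<lambda>_. borel))) \<and>
     (\<forall>A\<in>carrier_mat n n. \<forall>i<2 * n. (\<Sum>j<2 * n. (cmod (C A i j))\<^sup>2) \<le> 1) \<and>
     (\<forall>A\<in>carrier_mat n n. \<forall>j<2 * n. (\<Sum>i<2 * n. (cmod (C A i j))\<^sup>2) \<le> 1)"

lemma random_mat_coordinates: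
  "random_mat (PiM ({..<n} \<times> {..<n}) (\<lambda>_. borel)) n (\<lambda>x. mat n n x)"
  by (rule random_matI[where g = "\<lambda>i j x. x (i, j)"]) auto

lemma measurable_if_det:
  assumes f: "random_mat M n f" and g: "g \<in> borel_measurable M"
  shows "(\<lambda>x. if det (f x) \<noteq> 0 \<and> P then g x else (0::complex)) \<in> borel_measurable M"
proof -
  have [measurable]: "(\<lambda>x. det (f x)) \<in> borel_measurable M" by (rule random_mat_det[OF f])
  show ?thesis using g by measurable
qed

lemma power_inverse_le_1: "\<bar>(1 / (1 + x\<^sup>2)) ^ k\<bar> \<le> (1::real)"
proof -
  have "0 < 1 + x\<^sup>2" by (simp add: add_pos_nonneg)
  then have "0 \<le> 1 / (1 + x\<^sup>2)" "1 / (1 + x\<^sup>2) \<le> 1" by auto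
  then show ?thesis by (simp add: power_le_one)
qed

lemma power_inverse_mult_le_1: "\<bar>(1 / (1 + x\<^sup>2)) ^ Suc k * x\<bar> \<le> (1::real)"
proof -
  have p: "0 < 1 + x\<^sup>2" by (simp add: add_pos_nonneg)
  have "2 * \<bar>x\<bar> \<le> 1 + x\<^sup>2" using sum_squares_bound[of "\<bar>x\<bar>" 1] by simp
  then have "\<bar>x\<bar> \<le> 1 + x\<^sup>2" by linarith
  then have "\<bar>1 / (1 + x\<^sup>2) * x\<bar> \<le> 1" using p by (simp add: abs_mult divide_le_eq)
  then have "\<bar>(1 / (1 + x\<^sup>2)) ^ k\<bar> * \<bar>1 / (1 + x\<^sup>2) * x\<bar> \<le> 1 * 1"
    by (intro mult_mono power_inverse_le_1) auto
  also have "\<bar>(1 / (1 + x\<^sup>2)) ^ k\<bar> * \<bar>1 / (1 + x\<^sup>2) * x\<bar> = \<bar>(1 / (1 + x\<^sup>2)) ^ Suc k * x\<bar>"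
    unfolding abs_mult[symmetric] by simp
  finally show ?thesis by simp
qed

lemma svd_of_det:
  assumes A: "A \<in> carrier_mat n n" and d: "det A \<noteq> 0"
  obtains w z s where "svd n A w z s"
proof -
  obtain w s where b: "right_singular_basis n A w s" by (rule right_singular_basis_exists)
  have "\<exists>z. svd n A w z s"
    using d det_nonzero_iff_singular_values_pos[OF A b] by (intro svd_exists[OF b]) auto
  then show ?thesis using that by auto
qed

lemma admissible_uu: "admissible_coeff n (uu_coeff k n)"
  unfolding admissible_coeff_def
proof (intro conjI allI impI ballI)
  fix i j
  let ?S = "PiM ({..<n} \<times> {..<n}) (\<lambda>_. borel :: complex measure)"
  note rm = random_mat_coordinates[of n]
  show "(\<lambda>x. uu_coeff k n (mat n n x) i j) \<in> borel_measurable ?S"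
  proof (cases "i < n \<and> j < n")
    case True
    then have "(\<lambda>x. (resolvent n (mat n n x) ^\<^sub>m k) $$ (i, j)) \<in> borel_measurable ?S"
      by (intro random_matD(2)[OF random_mat_power[OF random_mat_resolvent[OF rm]]]) auto
    from measurable_if_det[OF rm this, of True] show ?thesis using True by (simp add: uu_coeff_def)
  next
    case False
    then have "uu_coeff k n A i j = 0" for A by (auto simp: uu_coeff_def)
    then show ?thesis by simp
  qed
next
  fix A :: "complex mat" and i assume A: "A \<in> carrier_mat n n"
  show "(\<Sum>j<2 * n. (cmod (uu_coeff k n A i j))\<^sup>2) \<le> 1"
  proof (cases "det A \<noteq> 0 \<and> i < n")
    case True
    then obtain w z s where d: "svd n A w z s" using svd_of_det[OF A] by metis
    have z: "orthonormal n n z" using d by (simp add: svd_def)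
    have "(\<Sum>j<2 * n. (cmod (uu_coeff k n A i j))\<^sup>2) = (\<Sum>j<n. (cmod (\<Sum>l<n. z l i * of_real ((1 / (1 + (s l)\<^sup>2)) ^ k) * cnj (z l j)))\<^sup>2)"
      unfolding sum_double using True by (simp add: uu_coeff_def resolvent_power_entry[OF A d])
    also have "\<dots> \<le> 1" using True by (intro spectral_row_bound[OF z z] power_inverse_le_1) auto
    finally show ?thesis .
  next
    case False
    then show ?thesis by (auto simp: uu_coeff_def)
  qed
next
  fix A :: "complex mat" and j assume A: "A \<in> carrier_mat n n"
  show "(\<Sum>i<2 * n. (cmod (uu_coeff k n A i j))\<^sup>2) \<le> 1"
  proof (cases "det A \<noteq> 0 \<and> j < n")
    case True
    then obtain w z s where d: "svd n A w z s" using svd_of_det[OF A] by metis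
    have z: "orthonormal n n z" using d by (simp add: svd_def)
    have "(\<Sum>i<2 * n. (cmod (uu_coeff k n A i j))\<^sup>2) = (\<Sum>i<n. (cmod (\<Sum>l<n. z l i * of_real ((1 / (1 + (s l)\<^sup>2)) ^ k) * cnj (z l j)))\<^sup>2)"
      unfolding sum_double using True by (simp add: uu_coeff_def resolvent_power_entry[OF A d])
    also have "\<dots> \<le> 1" using True by (intro spectral_col_bound[OF z z] power_inverse_le_1) auto
    finally show ?thesis .
  next
    case False
    then show ?thesis by (auto simp: uu_coeff_def)
  qed
qed

lemma admissible_vv: "admissible_coeff n (vv_coeff k n)"
  unfolding admissible_coeff_def
proof (intro conjI allI impI ballI)
  fix i j assume ij: "i < 2 * n" "j < 2 * n"
  let ?S = "PiM ({..<n} \<times> {..<n}) (\<lambda>_. borel :: complex measure)"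
  note rm = random_mat_coordinates[of n]
  show "(\<lambda>x. vv_coeff k n (mat n n x) i j) \<in> borel_measurable ?S"
  proof (cases "n \<le> i \<and> n \<le> j")
    case True
    then have "(\<lambda>x. (resolvent n (mat_adjoint (mat n n x)) ^\<^sub>m k) $$ (i - n, j - n)) \<in> borel_measurable ?S"
      using ij by (intro random_matD(2)[OF random_mat_power[OF random_mat_resolvent[OF random_mat_adjoint[OF rm]]]]) auto
    from measurable_if_det[OF rm this, of True] show ?thesis using True by (simp add: vv_coeff_def)
  next
    case False
    then have "vv_coeff k n A i j = 0" for A by (auto simp: vv_coeff_def)
    then show ?thesis by simp
  qed
next
  fix A :: "complex mat" and i assume A: "A \<in> carrier_mat n n" and i: "i < 2 * n"
  show "(\<Sum>j<2 * n. (cmod (vv_coeff k n A i j))\<^sup>2) \<le> 1"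
  proof (cases "det A \<noteq> 0 \<and> n \<le> i")
    case True
    then obtain w z s where d: "svd n A w z s" using svd_of_det[OF A] by metis
    have w: "orthonormal n n w" using d by (simp add: svd_def)
    have "(\<Sum>j<2 * n. (cmod (vv_coeff k n A i j))\<^sup>2) = (\<Sum>j<n. (cmod (\<Sum>l<n. w l (i - n) * of_real ((1 / (1 + (s l)\<^sup>2)) ^ k) * cnj (w l j)))\<^sup>2)"
      unfolding sum_double using True i by (simp add: vv_coeff_def resolvent_power_entry[OF mat_adjoint_carrier[OF A] svd_adjoint[OF A d]])
    also have "\<dots> \<le> 1" using True i by (intro spectral_row_bound[OF w w] power_inverse_le_1) auto
    finally show ?thesis .
  next
    case False
    then show ?thesis by (auto simp: vv_coeff_def)
  qed
next
  fix A :: "complex mat" and j assume A: "A \<in> carrier_mat n n" and j: "j < 2 * n"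
  show "(\<Sum>i<2 * n. (cmod (vv_coeff k n A i j))\<^sup>2) \<le> 1"
  proof (cases "det A \<noteq> 0 \<and> n \<le> j")
    case True
    then obtain w z s where d: "svd n A w z s" using svd_of_det[OF A] by metis
    have w: "orthonormal n n w" using d by (simp add: svd_def)
    have "(\<Sum>i<2 * n. (cmod (vv_coeff k n A i j))\<^sup>2) = (\<Sum>i<n. (cmod (\<Sum>l<n. w l i * of_real ((1 / (1 + (s l)\<^sup>2)) ^ k) * cnj (w l (j - n))))\<^sup>2)"
      unfolding sum_double using True j by (simp add: vv_coeff_def resolvent_power_entry[OF mat_adjoint_carrier[OF A] svd_adjoint[OF A d]])
    also have "\<dots> \<le> 1" using True j by (intro spectral_col_bound[OF w w] power_inverse_le_1) auto
    finally show ?thesis .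
  next
    case False
    then show ?thesis by (auto simp: vv_coeff_def)
  qed
qed

lemma admissible_uv: "admissible_coeff n (uv_coeff k n)"
  unfolding admissible_coeff_def
proof (intro conjI allI impI ballI)
  fix i j assume ij: "i < 2 * n" "j < 2 * n"
  let ?S = "PiM ({..<n} \<times> {..<n}) (\<lambda>_. borel :: complex measure)"
  note rm = random_mat_coordinates[of n]
  show "(\<lambda>x. uv_coeff k n (mat n n x) i j) \<in> borel_measurable ?S"
  proof (cases "i < n \<and> n \<le> j")
    case True
    then have "(\<lambda>x. (resolvent n (mat n n x) ^\<^sub>m Suc k * mat n n x) $$ (i, j - n)) \<in> borel_measurable ?S"
      using ij by (intro random_matD(2)[OF random_mat_mult[OF random_mat_power[OF random_mat_resolvent[OF rm]] rm]]) auto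
    from measurable_if_det[OF rm this, of True] show ?thesis using True unfolding uv_coeff_def by simp
  next
    case False
    then have "uv_coeff k n A i j = 0" for A by (auto simp: uv_coeff_def)
    then show ?thesis by simp
  qed
next
  fix A :: "complex mat" and i assume A: "A \<in> carrier_mat n n" and i: "i < 2 * n"
  show "(\<Sum>j<2 * n. (cmod (uv_coeff k n A i j))\<^sup>2) \<le> 1"
  proof (cases "det A \<noteq> 0 \<and> i < n")
    case True
    then obtain w z s where d: "svd n A w z s" using svd_of_det[OF A] by metis
    have w: "orthonormal n n w" and z: "orthonormal n n z" using d by (auto simp: svd_def)
    have "(\<Sum>j<2 * n. (cmod (uv_coeff k n A i j))\<^sup>2) = (\<Sum>j<n. (cmod (\<Sum>l<n. z l i * of_real ((1 / (1 + (s l)\<^sup>2)) ^ Suc k * s l) * cnj (w l j)))\<^sup>2)"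
      unfolding sum_double uv_coeff_def using True i
      by (simp add: resolvent_power_mult_entry[OF A d, of _ _ "Suc k"] del: pow_mat.simps power_Suc)
    also have "\<dots> \<le> 1" using True by (intro spectral_row_bound[OF z w] power_inverse_mult_le_1) auto
    finally show ?thesis .
  next
    case False
    then show ?thesis unfolding uv_coeff_def by auto
  qed
next
  fix A :: "complex mat" and j assume A: "A \<in> carrier_mat n n" and j: "j < 2 * n"
  show "(\<Sum>i<2 * n. (cmod (uv_coeff k n A i j))\<^sup>2) \<le> 1"
  proof (cases "det A \<noteq> 0 \<and> n \<le> j")
    case True
    then obtain w z s where d: "svd n A w z s" using svd_of_det[OF A] by metis
    have w: "orthonormal n n w" and z: "orthonormal n n z" using d by (auto simp: svd_def)
    have "(\<Sum>i<2 * n. (cmod (uv_coeff k n A i j))\<^sup>2) = (\<Sum>i<n. (cmod (\<Sum>l<n. z l i * of_real ((1 / (1 + (s l)\<^sup>2)) ^ Suc k * s l) * cnj (w l (j - n))))\<^sup>2)"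
      unfolding sum_double uv_coeff_def using True j
      by (simp add: resolvent_power_mult_entry[OF A d, of _ _ "Suc k"] del: pow_mat.simps power_Suc)
    also have "\<dots> \<le> 1" using True j by (intro spectral_col_bound[OF z w] power_inverse_mult_le_1) auto
    finally show ?thesis .
  next
    case False
    then show ?thesis unfolding uv_coeff_def by auto
  qed
qed

text \<open>The moment bound \<open>m\<close> is the same for all n, so the fourth moments are at
  most a constant times n^2 and \<open>AE_tendsto_0_of_fourth_moments\<close> applies. No
  independence between different n is involved.\<close>

lemma AE_centered_form_tendsto_0:
  fixes X :: "nat \<Rightarrow> 'a \<Rightarrow> complex mat" and h :: "nat \<Rightarrow> nat \<Rightarrow> 'a \<Rightarrow> complex"
  assumes X: "\<And>n \<omega>. \<omega> \<in> space M \<Longrightarrow> X n \<omega> \<in> carrier_mat n n"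
    and fam: "\<And>n. standardized_family M (h n) (2 * n) m"
    and ind: "\<And>n. indep_maps M (PiM ({..<n} \<times> {..<n}) (\<lambda>_. borel)) (\<lambda>\<omega>. \<lambda>ij\<in>{..<n} \<times> {..<n}. X n \<omega> $$ ij)
        (PiM {..<2 * n} (\<lambda>_. borel)) (\<lambda>\<omega>. \<lambda>i\<in>{..<2 * n}. h n i \<omega>)"
    and C: "\<And>n. admissible_coeff n (C n)"
  shows "AE \<omega> in M. (\<lambda>n. centered_form (2 * n) (C n (X n \<omega>)) (\<lambda>i. h n i \<omega>) / of_nat n) \<longlonglongrightarrow> 0"
proof -
  define K where "K = 16 * (8 * m + 2048 * m\<^sup>2)"
  define f where "f = (\<lambda>n \<omega>. centered_form (2 * n) (C n (mat n n (\<lambda>ij\<in>{..<n} \<times> {..<n}. X n \<omega> $$ ij))) (\<lambda>i. h n i \<omega>))"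
  have fb: "f n \<in> borel_measurable M" "(\<integral>\<^sup>+\<omega>. ennreal (cmod (f n \<omega>) ^ 4) \<partial>M) \<le> ennreal (K * (real (2 * n))\<^sup>2)" for n
  proof -
    have c: "(\<lambda>x. C n (mat n n x) i j) \<in> borel_measurable (PiM ({..<n} \<times> {..<n}) (\<lambda>_. borel))" if "i < 2 * n" "j < 2 * n" for i j
      using C[of n] that by (simp add: admissible_coeff_def)
    have r: "(\<Sum>j<2 * n. (cmod (C n (mat n n x) i j))\<^sup>2) \<le> 1" "(\<Sum>j<2 * n. (cmod (C n (mat n n x) j i))\<^sup>2) \<le> 1"
      if "i < 2 * n" for i x
      using C[of n] that by (simp_all add: admissible_coeff_def)
    show "f n \<in> borel_measurable M" "(\<integral>\<^sup>+\<omega>. ennreal (cmod (f n \<omega>) ^ 4) \<partial>M) \<le> ennreal (K * (real (2 * n))\<^sup>2)"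
      unfolding f_def K_def
      by (rule random_form_E4[OF fam ind, where C = "\<lambda>x. C n (mat n n x)"]; use c r in blast)+
  qed
  have m: "0 \<le> m" using standardized_family.m_nonneg[OF fam[of 1]] by simp
  have "AE \<omega> in M. (\<lambda>n. f n \<omega> / of_nat n) \<longlonglongrightarrow> 0"
  proof (rule AE_tendsto_0_of_fourth_moments)
    show "0 \<le> K * 4" using m by (simp add: K_def)
    show "(\<integral>\<^sup>+\<omega>. ennreal (cmod (f n \<omega>) ^ 4) \<partial>M) \<le> ennreal (K * 4 * (real n)\<^sup>2)" for n
      using fb(2)[of n] by (simp add: power_mult_distrib mult.assoc)
  qed (rule fb)
  moreover have "AE \<omega> in M. \<forall>n. f n \<omega> = centered_form (2 * n) (C n (X n \<omega>)) (\<lambda>i. h n i \<omega>)"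
  proof (rule AE_I2, rule allI)
    fix \<omega> n assume \<omega>: "\<omega> \<in> space M"
    have "mat n n (\<lambda>ij\<in>{..<n} \<times> {..<n}. X n \<omega> $$ ij) = X n \<omega>"
      by (rule eq_matI) (use X[OF \<omega>, of n] in auto)
    then show "f n \<omega> = centered_form (2 * n) (C n (X n \<omega>)) (\<lambda>i. h n i \<omega>)" by (simp add: f_def)
  qed
  ultimately show ?thesis by eventually_elim simp
qed

lemma mult_mult_cnj: "of_real d * c * cnj c = complex_of_real (d * (cmod c)\<^sup>2)"
  by (simp only: of_real_mult complex_norm_square mult.assoc)

text \<open>After division by n this compares two measures through their k-th moments in 1/(1 +
  s^2): the spectral measure of the vector g / sqrt n, and the empirical measure of the singular
  values.\<close>

lemma centered_form_uu:
  assumes A: "A \<in> carrier_mat n n" and det: "det A \<noteq> 0" and d: "svd n A w z s"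
  shows "centered_form (2 * n) (uu_coeff k n A) g =
    of_real ((\<Sum>l<n. (1 / (1 + (s l)\<^sup>2)) ^ k * (cmod (coord n z g l))\<^sup>2) - (\<Sum>l<n. (1 / (1 + (s l)\<^sup>2)) ^ k))"
proof -
  have z: "orthonormal n n z" using d by (simp add: svd_def)
  define e where "e = (\<lambda>i j. \<Sum>l<n. z l i * of_real ((1 / (1 + (s l)\<^sup>2)) ^ k) * cnj (z l j))"
  have e: "uu_coeff k n A i j = e i j" if "i < n" "j < n" for i j
    using that det by (simp only: uu_coeff_def e_def resolvent_power_entry[OF A d that]) simp
  have e0: "uu_coeff k n A i (n + j) = 0" "uu_coeff k n A (n + i) j = 0" for i j by (auto simp: uu_coeff_def)
  have "centered_form (2 * n) (uu_coeff k n A) g = (\<Sum>i<n. \<Sum>j<n. e i j * cnj (g i) * g j) - (\<Sum>i<n. e i i)"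
    unfolding centered_form_def sum_double by (simp add: e e0)
  also have "(\<Sum>i<n. e i i) = of_real (\<Sum>l<n. (1 / (1 + (s l)\<^sup>2)) ^ k)"
    unfolding e_def by (rule spectral_trace[OF z])
  also have "(\<Sum>i<n. \<Sum>j<n. e i j * cnj (g i) * g j) = (\<Sum>l<n. of_real ((1 / (1 + (s l)\<^sup>2)) ^ k) * coord n z g l * cnj (coord n z g l))"
    unfolding e_def by (rule spectral_form)
  also have "\<dots> = of_real (\<Sum>l<n. (1 / (1 + (s l)\<^sup>2)) ^ k * (cmod (coord n z g l))\<^sup>2)"
    unfolding mult_mult_cnj of_real_sum ..
  finally show ?thesis by (simp only: of_real_diff)
qed

lemma centered_form_vv:
  assumes A: "A \<in> carrier_mat n n" and det: "det A \<noteq> 0" and d: "svd n A w z s"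
  shows "centered_form (2 * n) (vv_coeff k n A) g =
    of_real ((\<Sum>l<n. (1 / (1 + (s l)\<^sup>2)) ^ k * (cmod (coord n w (\<lambda>i. g (n + i)) l))\<^sup>2) - (\<Sum>l<n. (1 / (1 + (s l)\<^sup>2)) ^ k))"
proof -
  have w: "orthonormal n n w" using d by (simp add: svd_def)
  define e where "e = (\<lambda>i j. \<Sum>l<n. w l i * of_real ((1 / (1 + (s l)\<^sup>2)) ^ k) * cnj (w l j))"
  have e: "vv_coeff k n A (n + i) (n + j) = e i j" if "i < n" "j < n" for i j
    using that det by (simp only: vv_coeff_def e_def) (simp add: resolvent_power_entry[OF mat_adjoint_carrier[OF A] svd_adjoint[OF A d]])
  have e0: "vv_coeff k n A i j = 0" if "i < n \<or> j < n" for i j using that by (auto simp: vv_coeff_def)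
  have "centered_form (2 * n) (vv_coeff k n A) g = (\<Sum>i<n. \<Sum>j<n. e i j * cnj (g (n + i)) * g (n + j)) - (\<Sum>i<n. e i i)"
    unfolding centered_form_def sum_double by (simp add: e e0)
  also have "(\<Sum>i<n. e i i) = of_real (\<Sum>l<n. (1 / (1 + (s l)\<^sup>2)) ^ k)"
    unfolding e_def by (rule spectral_trace[OF w])
  also have "(\<Sum>i<n. \<Sum>j<n. e i j * cnj (g (n + i)) * g (n + j)) = (\<Sum>l<n. of_real ((1 / (1 + (s l)\<^sup>2)) ^ k) * coord n w (\<lambda>i. g (n + i)) l * cnj (coord n w (\<lambda>i. g (n + i)) l))"
    unfolding e_def by (rule spectral_form)
  also have "\<dots> = of_real (\<Sum>l<n. (1 / (1 + (s l)\<^sup>2)) ^ k * (cmod (coord n w (\<lambda>i. g (n + i)) l))\<^sup>2)"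
    unfolding mult_mult_cnj of_real_sum ..
  finally show ?thesis by (simp only: of_real_diff)
qed

text \<open>The block lies off the diagonal, so no trace is subtracted and the form itself must
  become negligible.\<close>

lemma centered_form_uv:
  assumes A: "A \<in> carrier_mat n n" and det: "det A \<noteq> 0" and d: "svd n A w z s"
  shows "centered_form (2 * n) (uv_coeff k n A) g =
    (\<Sum>l<n. of_real ((1 / (1 + (s l)\<^sup>2)) ^ Suc k * s l) * coord n w (\<lambda>i. g (n + i)) l * cnj (coord n z g l))"
proof -
  define e where "e = (\<lambda>i j. \<Sum>l<n. z l i * of_real ((1 / (1 + (s l)\<^sup>2)) ^ Suc k * s l) * cnj (w l j))"
  have e: "uv_coeff k n A i (n + j) = e i j" if "i < n" "j < n" for i j
    using that det resolvent_power_mult_entry[OF A d that, of "Suc k"]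
    by (simp add: uv_coeff_def e_def del: pow_mat.simps power_Suc)
  have e0: "uv_coeff k n A i j = 0" if "j < n" for i j using that by (auto simp: uv_coeff_def)
  have e1: "uv_coeff k n A (n + i) j = 0" for i j by (auto simp: uv_coeff_def)
  have "centered_form (2 * n) (uv_coeff k n A) g = (\<Sum>i<n. \<Sum>j<n. e i j * cnj (g i) * g (n + j))"
    unfolding centered_form_def sum_double by (simp add: e e0 e1)
  also have "\<dots> = (\<Sum>l<n. of_real ((1 / (1 + (s l)\<^sup>2)) ^ Suc k * s l) * coord n w (\<lambda>i. g (n + i)) l * cnj (coord n z g l))"
    unfolding e_def by (rule spectral_form)
  finally show ?thesis .
qed

section \<open>From moments to continuous test functions\<close>

text \<open>The compactifying variable: it maps all singular values into [0,1], so no control of the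
  large ones is required. Its value at a singular value is an eigenvalue of the resolvent.\<close>

definition yfun :: "real \<Rightarrow> real" where "yfun t = 1 / (1 + t\<^sup>2)"

lemma yfun_bounds: "0 < yfun t" "yfun t \<le> 1"
proof -
  have "0 < 1 + t\<^sup>2" by (simp add: add_pos_nonneg)
  then show "0 < yfun t" "yfun t \<le> 1" by (auto simp: yfun_def)
qed

lemma yfun_in: "yfun t \<in> {0..1}"
  using yfun_bounds[of t] by auto

lemma yfun_inverse: "yfun t * (1 + t\<^sup>2) = 1"
proof -
  have "0 < 1 + t\<^sup>2" by (simp add: add_pos_nonneg)
  then show ?thesis by (simp add: yfun_def)
qed

lemma one_minus_yfun: "1 - yfun t = t\<^sup>2 * yfun t"
  using yfun_inverse[of t] by (simp add: algebra_simps)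

lemma continuous_on_yfun [continuous_intros]: "continuous_on S yfun"
proof -
  have "1 + t\<^sup>2 \<noteq> 0" for t :: real using zero_le_power2[of t] by linarith
  then show ?thesis unfolding yfun_def by (intro continuous_intros) auto
qed

lemma abs_mult_yfun_le: "\<bar>t * yfun t\<bar> \<le> 1"
proof -
  have p: "0 < 1 + t\<^sup>2" by (simp add: add_pos_nonneg)
  have "2 * \<bar>t\<bar> \<le> 1 + t\<^sup>2" using sum_squares_bound[of "\<bar>t\<bar>" 1] by simp
  then show ?thesis using p by (simp add: yfun_def abs_mult divide_le_eq)
qed

lemma integrable_continuous_yfun:
  fixes F :: "real \<Rightarrow> real"
  assumes \<mu>: "real_distribution \<mu>" and F: "continuous_on {0..1} F"
  shows "integrable \<mu> (\<lambda>t. F (yfun t))"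
proof -
  interpret real_distribution \<mu> by fact
  have "compact (F ` {0..1})" by (intro compact_continuous_image F compact_Icc)
  then have "bounded (F ` {0..1})" by (rule compact_imp_bounded)
  then obtain B where "\<forall>x\<in>{0..1}. norm (F x) \<le> B" by (auto simp: bounded_iff)
  then have B: "\<And>x. x \<in> {0..1} \<Longrightarrow> norm (F x) \<le> B" by blast
  have "continuous_on UNIV (\<lambda>t. F (yfun t))"
    by (rule continuous_on_compose2[OF F continuous_on_yfun]) (use yfun_in in auto)
  then have "(\<lambda>t. F (yfun t)) \<in> borel_measurable borel" by (rule borel_measurable_continuous_onI)
  then have "(\<lambda>t. F (yfun t)) \<in> borel_measurable \<mu>" by simp
  moreover have "AE t in \<mu>. norm (F (yfun t)) \<le> B" by (rule AE_I2) (rule B[OF yfun_in])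
  ultimately show ?thesis by (intro integrable_const_bound)
qed

text \<open>Weierstrass approximation on [0,1]: the weights have bounded total mass, so a uniform
  error in the test function stays a uniform error in the sums. The constant \<kappa> is 1 for the
  weights |U|^2 and 0 for the cross weights.\<close>

lemma moments_imp_continuous:
  fixes c :: "nat \<Rightarrow> nat \<Rightarrow> complex" and s :: "nat \<Rightarrow> nat \<Rightarrow> real" and \<kappa> :: real
  assumes \<mu>: "real_distribution \<mu>" and \<kappa>: "\<bar>\<kappa>\<bar> \<le> 1"
    and B: "eventually (\<lambda>n. (\<Sum>l<N n. cmod (c n l)) \<le> B) sequentially"
    and mom: "\<And>k. (\<lambda>n. \<Sum>l<N n. c n l * of_real (yfun (s n l) ^ k)) \<longlonglongrightarrow> of_real (\<kappa> * (\<integral>t. yfun t ^ k \<partial>\<mu>))"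
    and F: "continuous_on {0..1} F"
  shows "(\<lambda>n. \<Sum>l<N n. c n l * of_real (F (yfun (s n l)))) \<longlonglongrightarrow> of_real (\<kappa> * (\<integral>t. F (yfun t) \<partial>\<mu>))"
proof -
  interpret real_distribution \<mu> by fact
  define I where "I = (\<lambda>F :: real \<Rightarrow> real. \<integral>t. F (yfun t) \<partial>\<mu>)"
  define S where "S = (\<lambda>(F :: real \<Rightarrow> real) n. \<Sum>l<N n. c n l * of_real (F (yfun (s n l))))"
  have B0: "0 \<le> B"
  proof -
    obtain n where "(\<Sum>l<N n. cmod (c n l)) \<le> B" using eventually_happens'[OF sequentially_bot B] by blast
    moreover have "0 \<le> (\<Sum>l<N n. cmod (c n l))" by (intro sum_nonneg) auto
    ultimately show ?thesis by linarith
  qed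
  have "(\<lambda>n. S F n) \<longlonglongrightarrow> of_real (\<kappa> * I F)"
  proof (rule tendstoI)
    fix e :: real assume e: "e > 0"
    \<comment> \<open>Chosen so that the errors d B on the sums, d on the limit integral and e/2
      from the convergence for the polynomial add up to less than e.\<close>
    define d where "d = e / (2 * (B + 2))"
    have d: "d > 0" using e B0 by (simp add: d_def)
    have "\<exists>p. real_polynomial_function p \<and> (\<forall>x\<in>{0..1}. \<bar>F x - p x\<bar> < d)"
    proof (rule Stone_Weierstrass_real_polynomial_function[OF compact_Icc F d])
      fix g assume "real_polynomial_function g" and *: "\<And>x. x \<in> {0..1} \<Longrightarrow> \<bar>F x - g x\<bar> < d"
      then show ?thesis by (intro exI[of _ g] conjI ballI *)
    qed
    then obtain p where p: "real_polynomial_function p" "\<And>x. x \<in> {0..1} \<Longrightarrow> \<bar>F x - p x\<bar> < d" by blast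
    obtain a m where am: "p = (\<lambda>x. \<Sum>i\<le>m. a i * x ^ i)"
      using p(1) unfolding real_polynomial_function_iff_sum by blast
    have cp: "continuous_on {0..1} p" unfolding am by (intro continuous_intros)
    have int: "integrable \<mu> (\<lambda>t. F (yfun t))" "integrable \<mu> (\<lambda>t. p (yfun t))"
      using integrable_continuous_yfun[OF \<mu>] F cp by auto
    have "S p n = (\<Sum>i\<le>m. of_real (a i) * (\<Sum>l<N n. c n l * of_real (yfun (s n l) ^ i)))" for n
      unfolding S_def am sum_distrib_left by (subst sum.swap) (simp add: sum_distrib_left mult_ac)
    moreover have "(\<lambda>n. \<Sum>i\<le>m. of_real (a i) * (\<Sum>l<N n. c n l * of_real (yfun (s n l) ^ i))) \<longlonglongrightarrow>
        (\<Sum>i\<le>m. of_real (a i) * of_real (\<kappa> * (\<integral>t. yfun t ^ i \<partial>\<mu>)))"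
      by (intro tendsto_sum tendsto_mult tendsto_const mom)
    moreover have "(\<Sum>i\<le>m. of_real (a i) * of_real (\<kappa> * (\<integral>t. yfun t ^ i \<partial>\<mu>))) = complex_of_real (\<kappa> * I p)"
    proof -
      have "I p = (\<Sum>i\<le>m. a i * (\<integral>t. yfun t ^ i \<partial>\<mu>))"
      proof -
        have "integrable \<mu> (\<lambda>t. yfun t ^ i)" for i
          by (rule integrable_continuous_yfun[OF \<mu>, of "\<lambda>x. x ^ i"]) (intro continuous_intros)
        then show ?thesis unfolding I_def am by (subst Bochner_Integration.integral_sum) auto
      qed
      then show ?thesis by (simp add: sum_distrib_left mult_ac)
    qed
    ultimately have Sp: "(\<lambda>n. S p n) \<longlonglongrightarrow> of_real (\<kappa> * I p)" by simp
    have "eventually (\<lambda>n. dist (S p n) (of_real (\<kappa> * I p)) < e / 2) sequentially"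
      by (rule tendstoD[OF Sp]) (use e in simp)
    then show "eventually (\<lambda>n. dist (S F n) (of_real (\<kappa> * I F)) < e) sequentially"
      using B
    proof eventually_elim
      case (elim n)
      have 1: "cmod (S F n - S p n) \<le> d * B"
      proof -
        have "cmod (S F n - S p n) = cmod (\<Sum>l<N n. c n l * of_real (F (yfun (s n l)) - p (yfun (s n l))))"
          unfolding S_def sum_subtractf[symmetric] by (simp add: algebra_simps)
        also have "\<dots> \<le> (\<Sum>l<N n. cmod (c n l) * d)"
        proof (rule sum_norm_le)
          fix l
          show "cmod (c n l * of_real (F (yfun (s n l)) - p (yfun (s n l)))) \<le> cmod (c n l) * d"
            unfolding norm_mult norm_of_real by (intro mult_left_mono less_imp_le[OF p(2)[OF yfun_in]]) auto
        qed
        also have "\<dots> = (\<Sum>l<N n. cmod (c n l)) * d" by (simp add: sum_distrib_right)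
        also have "\<dots> \<le> B * d" using elim(2) d by (intro mult_right_mono) auto
        finally show ?thesis by (simp add: mult.commute)
      qed
      have 2: "\<bar>I F - I p\<bar> \<le> d"
      proof -
        have "I F - I p = (\<integral>t. F (yfun t) - p (yfun t) \<partial>\<mu>)" unfolding I_def using int by simp
        also have "\<bar>\<dots>\<bar> \<le> (\<integral>t. \<bar>F (yfun t) - p (yfun t)\<bar> \<partial>\<mu>)" by (rule integral_abs_bound)
        also have "\<dots> \<le> (\<integral>t. d \<partial>\<mu>)"
          using int p(2)[OF yfun_in] by (intro integral_mono) (auto intro: less_imp_le)
        finally show ?thesis using prob_space by simp
      qed
      have "dist (S F n) (of_real (\<kappa> * I F)) \<le> cmod (S F n - S p n) + dist (S p n) (of_real (\<kappa> * I p)) + cmod (of_real (\<kappa> * I p) - of_real (\<kappa> * I F))"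
        using dist_triangle[of "S F n" "of_real (\<kappa> * I F)" "S p n"] dist_triangle[of "S p n" "of_real (\<kappa> * I F)" "of_real (\<kappa> * I p)"]
        by (simp add: dist_norm)
      also have "cmod (of_real (\<kappa> * I p) - of_real (\<kappa> * I F)) = \<bar>\<kappa>\<bar> * \<bar>I F - I p\<bar>"
        unfolding of_real_diff[symmetric] norm_of_real abs_mult[symmetric] by (simp add: algebra_simps abs_minus_commute)
      also have "\<dots> \<le> 1 * d" using 2 \<kappa> by (intro mult_mono) auto
      finally have "dist (S F n) (of_real (\<kappa> * I F)) < d * B + e / 2 + d" using 1 elim(1) by linarith
      also have "\<dots> < e"
      proof -
        have "d * (B + 2) = e / 2" using B0 by (simp add: d_def field_simps)
        then show ?thesis using d by (simp add: algebra_simps)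
      qed
      finally show ?case .
    qed
  qed
  then show ?thesis by (simp add: S_def I_def)
qed

section \<open>Limit equations for the overlaps along a subsequence\<close>

text \<open>A subsequence on which \<sigma>, \<alpha> and \<beta> converge; \<open>N n\<close> is
  the matrix size. U and V are the coordinates of u and v in the two singular bases, U' those of the
  perturbed left singular vector, and \<open>eq\<close> is its equation with the right vector
  eliminated. Exchanging U with V and \<alpha> with \<beta> gives the statement for the right
  vector, so everything is proved once and interpreted twice.\<close>

locale edge_limit =
  fixes \<mu> :: "real measure" and N :: "nat \<Rightarrow> nat" and s :: "nat \<Rightarrow> nat \<Rightarrow> real"
    and U V U' :: "nat \<Rightarrow> nat \<Rightarrow> complex" and \<sigma> :: "nat \<Rightarrow> real" and \<alpha> \<beta> :: "nat \<Rightarrow> complex"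
    and \<theta> a b :: real and \<alpha>0 \<beta>0 :: complex
  assumes \<mu>: "real_distribution \<mu>" and \<theta>: "\<theta> > 0" and a: "a > 0"
    and AE_a: "AE t in \<mu>. a \<le> t"
    and eq: "eventually (\<lambda>n. \<forall>l<N n. of_real ((\<sigma> n)\<^sup>2 - (s n l)\<^sup>2) * U' n l =
        of_real \<theta> * (\<alpha> n * of_real (\<sigma> n) * U n l + \<beta> n * of_real (s n l) * V n l)) sequentially"
    and U'_norm: "eventually (\<lambda>n. (\<Sum>l<N n. (cmod (U' n l))\<^sup>2) = 1) sequentially"
    and \<beta>_eq: "eventually (\<lambda>n. \<beta> n = (\<Sum>l<N n. U' n l * cnj (U n l))) sequentially"
    and U_mom: "\<And>k. (\<lambda>n. \<Sum>l<N n. (cmod (U n l))\<^sup>2 * yfun (s n l) ^ k) \<longlonglongrightarrow> (\<integral>t. yfun t ^ k \<partial>\<mu>)"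
    and V_norm: "(\<lambda>n. \<Sum>l<N n. (cmod (V n l))\<^sup>2) \<longlonglongrightarrow> 1"
    and cross_mom: "\<And>k. (\<lambda>n. \<Sum>l<N n. V n l * cnj (U n l) * of_real (s n l * yfun (s n l)) * of_real (yfun (s n l) ^ k)) \<longlonglongrightarrow> 0"
    and s_lower: "\<And>c. c < a \<Longrightarrow> eventually (\<lambda>n. \<forall>l<N n. c < s n l) sequentially"
    and \<sigma>_lim: "\<sigma> \<longlonglongrightarrow> b" and \<alpha>_lim: "\<alpha> \<longlonglongrightarrow> \<alpha>0" and \<beta>_lim: "\<beta> \<longlonglongrightarrow> \<beta>0"
begin

sublocale \<mu>: real_distribution \<mu> by (rule \<mu>)

lemma U_norm: "(\<lambda>n. \<Sum>l<N n. (cmod (U n l))\<^sup>2) \<longlonglongrightarrow> 1"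
  using U_mom[of 0] \<mu>.prob_space by simp

lemma U_le: "eventually (\<lambda>n. (\<Sum>l<N n. (cmod (U n l))\<^sup>2) \<le> 2) sequentially"
  using order_tendstoD(2)[OF U_norm, of 2] by (auto elim: eventually_mono)

lemma V_le: "eventually (\<lambda>n. (\<Sum>l<N n. (cmod (V n l))\<^sup>2) \<le> 2) sequentially"
  using order_tendstoD(2)[OF V_norm, of 2] by (auto elim: eventually_mono)

lemma U_cont:
  assumes "continuous_on {0..1} F"
  shows "(\<lambda>n. \<Sum>l<N n. (cmod (U n l))\<^sup>2 * F (yfun (s n l))) \<longlonglongrightarrow> (\<integral>t. F (yfun t) \<partial>\<mu>)"
proof -
  have "(\<lambda>n. \<Sum>l<N n. of_real ((cmod (U n l))\<^sup>2) * of_real (F (yfun (s n l)))) \<longlonglongrightarrow> complex_of_real (1 * (\<integral>t. F (yfun t) \<partial>\<mu>))"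
  proof (rule moments_imp_continuous[OF \<mu> _ _ _ assms])
    show "eventually (\<lambda>n. (\<Sum>l<N n. cmod (of_real ((cmod (U n l))\<^sup>2))) \<le> 2) sequentially" using U_le by (simp add: norm_power)
    show "(\<lambda>n. \<Sum>l<N n. of_real ((cmod (U n l))\<^sup>2) * of_real (yfun (s n l) ^ k)) \<longlonglongrightarrow> complex_of_real (1 * (\<integral>t. yfun t ^ k \<partial>\<mu>))" for k
      using tendsto_of_real[OF U_mom[of k], where 'a = complex] by simp
  qed simp
  then have "(\<lambda>n. complex_of_real (\<Sum>l<N n. (cmod (U n l))\<^sup>2 * F (yfun (s n l)))) \<longlonglongrightarrow> of_real (\<integral>t. F (yfun t) \<partial>\<mu>)" by simp
  then show ?thesis by (simp only: tendsto_of_real_iff)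
qed

text \<open>The factor s y stays with the weights: it is bounded by 1, whereas s alone is unbounded
  as y tends to 0. Its bound gives the total mass estimate by the arithmetic-geometric
  inequality.\<close>

lemma cross_cont:
  assumes "continuous_on {0..1} F"
  shows "(\<lambda>n. \<Sum>l<N n. V n l * cnj (U n l) * of_real (s n l * yfun (s n l)) * of_real (F (yfun (s n l)))) \<longlonglongrightarrow> 0"
proof -
  have "(\<lambda>n. \<Sum>l<N n. V n l * cnj (U n l) * of_real (s n l * yfun (s n l)) * of_real (F (yfun (s n l)))) \<longlonglongrightarrow> complex_of_real (0 * (\<integral>t. F (yfun t) \<partial>\<mu>))"
  proof (rule moments_imp_continuous[OF \<mu> _ _ _ assms])
    show "eventually (\<lambda>n. (\<Sum>l<N n. cmod (V n l * cnj (U n l) * of_real (s n l * yfun (s n l)))) \<le> 2) sequentially"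
      using U_le V_le
    proof eventually_elim
      case (elim n)
      have "(\<Sum>l<N n. cmod (V n l * cnj (U n l) * of_real (s n l * yfun (s n l)))) \<le> (\<Sum>l<N n. ((cmod (U n l))\<^sup>2 + (cmod (V n l))\<^sup>2) / 2)"
      proof (rule sum_mono)
        fix l
        have "cmod (V n l * cnj (U n l) * of_real (s n l * yfun (s n l))) = (cmod (V n l) * cmod (U n l)) * \<bar>s n l * yfun (s n l)\<bar>"
          by (simp only: norm_mult norm_of_real complex_mod_cnj)
        also have "\<dots> \<le> (cmod (V n l) * cmod (U n l)) * 1" by (intro mult_left_mono abs_mult_yfun_le) auto
        also have "\<dots> \<le> ((cmod (U n l))\<^sup>2 + (cmod (V n l))\<^sup>2) / 2"
          using sum_squares_bound[of "cmod (V n l)" "cmod (U n l)"] by simp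
        finally show "cmod (V n l * cnj (U n l) * of_real (s n l * yfun (s n l))) \<le> ((cmod (U n l))\<^sup>2 + (cmod (V n l))\<^sup>2) / 2" .
      qed
      also have "\<dots> = ((\<Sum>l<N n. (cmod (U n l))\<^sup>2) + (\<Sum>l<N n. (cmod (V n l))\<^sup>2)) / 2"
        by (simp add: sum.distrib sum_divide_distrib[symmetric])
      also have "\<dots> \<le> 2" using elim by simp
      finally show ?case .
    qed
    show "(\<lambda>n. \<Sum>l<N n. V n l * cnj (U n l) * of_real (s n l * yfun (s n l)) * of_real (yfun (s n l) ^ k)) \<longlonglongrightarrow> complex_of_real (0 * (\<integral>t. yfun t ^ k \<partial>\<mu>))" for k
      using cross_mom[of k] by simp
  qed simp
  then show ?thesis by simp
qed

text \<open>When \<open>\<sigma>\<close> tends to the edge \<open>a\<close>, the weight \<open>1 / ((s\<^sup>2 - a\<^sup>2)\<^sup>2 + \<eta>\<^sup>2)\<close> replaces the square of the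
  resolvent at \<open>\<sigma>\<close>, which may be singular.\<close>
lemma edge_bound:
  assumes ba: "b = a" and \<eta>: "\<eta> > 0"
  shows "a\<^sup>2 * (cmod \<alpha>0)\<^sup>2 * (\<integral>t. 1 / ((t\<^sup>2 - a\<^sup>2)\<^sup>2 + \<eta>\<^sup>2) \<partial>\<mu>) \<le> 2 / \<theta>\<^sup>2"
proof -
  \<comment> \<open>At y = \<open>yfun t\<close> this is y^2 ((t^2 - a^2)^2 + \<eta>^2), so F(y) is
    the desired weight written as a continuous function on all of [0,1], also at y = 0. The quotient
    H = F/y is needed because the cross moments already contain one factor y.\<close>
  define D where "D = (\<lambda>y::real. (1 - y - a\<^sup>2 * y)\<^sup>2 + \<eta>\<^sup>2 * y\<^sup>2)"
  define H where "H = (\<lambda>y. y / D y)"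
  define F where "F = (\<lambda>y. y * H y)"
  have D0: "D y \<noteq> 0" for y
  proof
    assume "D y = 0"
    then have "(1 - y - a\<^sup>2 * y)\<^sup>2 = 0" "\<eta>\<^sup>2 * y\<^sup>2 = 0"
      unfolding D_def by (smt (verit) zero_le_power2 zero_le_mult_iff)+
    then show False using \<eta> by simp
  qed
  have cH: "continuous_on {0..1} H" unfolding H_def using D0 by (auto simp: D_def intro!: continuous_intros)
  have cF: "continuous_on {0..1} F" unfolding F_def by (intro continuous_intros cH)
  have Dy: "D (yfun t) = (yfun t)\<^sup>2 * ((t\<^sup>2 - a\<^sup>2)\<^sup>2 + \<eta>\<^sup>2)" for t
    unfolding D_def one_minus_yfun by (simp add: power2_eq_square algebra_simps)
  have Fy: "F (yfun t) = 1 / ((t\<^sup>2 - a\<^sup>2)\<^sup>2 + \<eta>\<^sup>2)" for t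
    using yfun_bounds(1)[of t] unfolding F_def H_def Dy by (simp add: power2_eq_square)
  have pos: "0 < (t\<^sup>2 - a\<^sup>2)\<^sup>2 + \<eta>\<^sup>2" for t using \<eta> by (intro add_nonneg_pos) auto
  define A where "A = (\<lambda>n. \<Sum>l<N n. (cmod (U n l))\<^sup>2 * F (yfun (s n l)))"
  define T where "T = (\<lambda>n. \<Sum>l<N n. V n l * cnj (U n l) * of_real (s n l * yfun (s n l)) * of_real (H (yfun (s n l))))"
  have A: "A \<longlonglongrightarrow> (\<integral>t. 1 / ((t\<^sup>2 - a\<^sup>2)\<^sup>2 + \<eta>\<^sup>2) \<partial>\<mu>)"
    using U_cont[OF cF] unfolding A_def Fy .
  have T: "T \<longlonglongrightarrow> 0" unfolding T_def by (rule cross_cont[OF cH])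
  have "(\<lambda>n. (\<sigma> n)\<^sup>2 - a\<^sup>2) \<longlonglongrightarrow> a\<^sup>2 - a\<^sup>2" using \<sigma>_lim unfolding ba by (intro tendsto_intros)
  then have "(\<lambda>n. ((\<sigma> n)\<^sup>2 - a\<^sup>2)\<^sup>2) \<longlonglongrightarrow> 0\<^sup>2" by (intro tendsto_power) simp
  then have "eventually (\<lambda>n. ((\<sigma> n)\<^sup>2 - a\<^sup>2)\<^sup>2 < \<eta>\<^sup>2) sequentially"
    by (rule order_tendstoD) (use \<eta> in simp)
  then have ev: "eventually (\<lambda>n. (\<sigma> n)\<^sup>2 * (cmod (\<alpha> n))\<^sup>2 * A n + 2 * Re (cnj (\<alpha> n) * of_real (\<sigma> n) * \<beta> n * T n) \<le> 2 / \<theta>\<^sup>2) sequentially"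
    using eq U'_norm
  proof eventually_elim
    case (elim n)
    define x where "x = (\<lambda>l. \<alpha> n * of_real (\<sigma> n) * U n l)"
    define w where "w = (\<lambda>l. \<beta> n * of_real (s n l) * V n l)"
    \<comment> \<open>Since (\<sigma>^2 - a^2)^2 < \<eta>^2 eventually, (\<sigma>^2 - s^2)^2 is at
      most twice the denominator of the weight; this is the source of the 2 in the bound.\<close>
    have term1: "(cmod (x l + w l))\<^sup>2 * F (yfun (s n l)) \<le> 2 / \<theta>\<^sup>2 * (cmod (U' n l))\<^sup>2" if l: "l < N n" for l
    proof -
      define f where "f = ((s n l)\<^sup>2 - a\<^sup>2)\<^sup>2 + \<eta>\<^sup>2"
      have f: "f > 0" unfolding f_def by (rule pos)
      have "of_real ((\<sigma> n)\<^sup>2 - (s n l)\<^sup>2) * U' n l = of_real \<theta> * (x l + w l)"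
        using elim(2) l by (simp add: x_def w_def)
      then have "(cmod (of_real ((\<sigma> n)\<^sup>2 - (s n l)\<^sup>2) * U' n l))\<^sup>2 = (cmod (of_real \<theta> * (x l + w l)))\<^sup>2" by simp
      then have e: "((\<sigma> n)\<^sup>2 - (s n l)\<^sup>2)\<^sup>2 * (cmod (U' n l))\<^sup>2 = \<theta>\<^sup>2 * (cmod (x l + w l))\<^sup>2"
        by (simp only: norm_mult norm_of_real power_mult_distrib power2_abs)
      have "((\<sigma> n)\<^sup>2 - (s n l)\<^sup>2)\<^sup>2 = (((\<sigma> n)\<^sup>2 - a\<^sup>2) + (a\<^sup>2 - (s n l)\<^sup>2))\<^sup>2" by simp
      also have "\<dots> \<le> 2 * ((\<sigma> n)\<^sup>2 - a\<^sup>2)\<^sup>2 + 2 * (a\<^sup>2 - (s n l)\<^sup>2)\<^sup>2"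
        using sum_squares_bound[of "(\<sigma> n)\<^sup>2 - a\<^sup>2" "a\<^sup>2 - (s n l)\<^sup>2"] by (simp only: power2_sum)
      also have "\<dots> \<le> 2 * f" using elim(1) by (simp add: f_def power2_commute[of "a\<^sup>2"])
      finally have "\<theta>\<^sup>2 * (cmod (x l + w l))\<^sup>2 \<le> 2 * f * (cmod (U' n l))\<^sup>2"
        unfolding e[symmetric] by (intro mult_right_mono) auto
      then show ?thesis unfolding Fy f_def[symmetric] using f \<theta>
        by (simp add: field_simps)
    qed
    have "(\<Sum>l<N n. (cmod (x l + w l))\<^sup>2 * F (yfun (s n l))) \<le> (\<Sum>l<N n. 2 / \<theta>\<^sup>2 * (cmod (U' n l))\<^sup>2)"
      by (intro sum_mono term1) simp
    also have "\<dots> = 2 / \<theta>\<^sup>2" unfolding sum_distrib_left[symmetric] elim(3) by simp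
    finally have 1: "(\<Sum>l<N n. (cmod (x l + w l))\<^sup>2 * F (yfun (s n l))) \<le> 2 / \<theta>\<^sup>2" .
    have F0: "0 \<le> F (yfun t)" for t unfolding Fy using pos[of t] by simp
    have "(\<sigma> n)\<^sup>2 * (cmod (\<alpha> n))\<^sup>2 * A n + 2 * Re (cnj (\<alpha> n) * of_real (\<sigma> n) * \<beta> n * T n) =
      (\<Sum>l<N n. ((cmod (x l))\<^sup>2 + 2 * Re (cnj (x l) * w l)) * F (yfun (s n l)))"
    proof -
      have "(\<sigma> n)\<^sup>2 * (cmod (\<alpha> n))\<^sup>2 * A n = (\<Sum>l<N n. (cmod (x l))\<^sup>2 * F (yfun (s n l)))"
        unfolding A_def sum_distrib_left by (intro sum.cong refl) (simp add: x_def norm_mult power_mult_distrib)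
      moreover have "cnj (\<alpha> n) * of_real (\<sigma> n) * \<beta> n * T n = (\<Sum>l<N n. cnj (x l) * w l * of_real (F (yfun (s n l))))"
        unfolding T_def sum_distrib_left by (intro sum.cong refl) (simp add: x_def w_def F_def mult_ac)
      moreover have "Re (\<Sum>l<N n. cnj (x l) * w l * of_real (F (yfun (s n l)))) = (\<Sum>l<N n. Re (cnj (x l) * w l) * F (yfun (s n l)))"
        unfolding Re_sum by (intro sum.cong refl) simp
      ultimately show ?thesis
        by (simp only: distrib_right sum.distrib sum_distrib_left mult.assoc)
    qed
    \<comment> \<open>The nonnegative term |w|^2 is dropped. What remains is the |U|^2 part, which
      converges to the integral, and the cross part, which vanishes.\<close>
    also have "\<dots> \<le> (\<Sum>l<N n. (cmod (x l + w l))\<^sup>2 * F (yfun (s n l)))"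
    proof (intro sum_mono mult_right_mono F0)
      fix l
      have "(cmod (x l + w l))\<^sup>2 = (cmod (x l))\<^sup>2 + 2 * Re (cnj (x l) * w l) + (cmod (w l))\<^sup>2"
        unfolding cmod_power2 by (simp add: power2_eq_square algebra_simps)
      then show "(cmod (x l))\<^sup>2 + 2 * Re (cnj (x l) * w l) \<le> (cmod (x l + w l))\<^sup>2" by simp
    qed
    finally show ?case using 1 by linarith
  qed
  have "(\<lambda>n. (\<sigma> n)\<^sup>2 * (cmod (\<alpha> n))\<^sup>2 * A n + 2 * Re (cnj (\<alpha> n) * of_real (\<sigma> n) * \<beta> n * T n)) \<longlonglongrightarrow>
     b\<^sup>2 * (cmod \<alpha>0)\<^sup>2 * (\<integral>t. 1 / ((t\<^sup>2 - a\<^sup>2)\<^sup>2 + \<eta>\<^sup>2) \<partial>\<mu>) + 2 * Re (cnj \<alpha>0 * of_real b * \<beta>0 * 0)"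
    by (intro tendsto_intros \<sigma>_lim \<alpha>_lim \<beta>_lim A T)
  from tendsto_upperbound[OF this ev] show ?thesis by (simp add: ba)
qed

text \<open>Strictly below the edge, b^2 - s^2 stays away from 0 for large n, so the coordinate
  equation can be divided by it and paired with U. The |U|^2 weights produce phi(b), the cross
  weights contribute nothing, and the left side becomes \<beta>.\<close>

lemma interior_equation:
  assumes b: "0 \<le> b" "b < a"
  shows "\<beta>0 = of_real (\<theta> * phi \<mu> b) * \<alpha>0"
proof -
  define c where "c = (a + b) / 2"
  have c: "b < c" "c < a" "0 < c" using b by (auto simp: c_def)
  have bc: "b\<^sup>2 < c\<^sup>2" using b c by (intro power_strict_mono) auto
  define y0 where "y0 = yfun c"
  \<comment> \<open>For t >= c this is y (b^2 - t^2) at y = \<open>yfun t\<close>. Clamping y at y0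
    = \<open>yfun c\<close> keeps D negative on all of [0,1], so that 1/D is a continuous test
    function, without changing it where the singular values eventually lie.\<close>
  define D where "D = (\<lambda>y. (b\<^sup>2 + 1) * min y y0 - 1)"
  define H where "H = (\<lambda>y. 1 / D y)"
  define G where "G = (\<lambda>y. min y y0 * H y)"
  have D0: "D y < 0" for y
  proof -
    have "(b\<^sup>2 + 1) * min y y0 \<le> (b\<^sup>2 + 1) * y0" by (intro mult_left_mono) auto
    also have "\<dots> < (c\<^sup>2 + 1) * y0" using bc yfun_bounds(1)[of c] by (simp add: y0_def)
    also have "\<dots> = 1" using yfun_inverse[of c] by (simp add: y0_def mult.commute add.commute)
    finally show ?thesis by (simp add: D_def)
  qed
  have cH: "continuous_on {0..1} H"
    unfolding H_def by (intro continuous_intros) (use D0 in \<open>auto simp: D_def intro!: continuous_intros simp: less_imp_neq\<close>)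
  have cG: "continuous_on {0..1} G" unfolding G_def by (intro continuous_intros cH)
  have ymin: "min (yfun t) y0 = yfun t" if "c \<le> t" for t
  proof -
    have "c\<^sup>2 \<le> t\<^sup>2" using that c by (intro power_mono) auto
    then have "yfun t \<le> y0" unfolding y0_def yfun_def by (intro divide_left_mono) (auto simp: add_pos_nonneg)
    then show ?thesis by simp
  qed
  have Gy: "G (yfun t) = 1 / (b\<^sup>2 - t\<^sup>2)" and GH: "G (yfun t) = yfun t * H (yfun t)"
    and bt: "b\<^sup>2 - t\<^sup>2 < 0" if "c \<le> t" for t
  proof -
    have "c\<^sup>2 \<le> t\<^sup>2" using that c by (intro power_mono) auto
    then show bt: "b\<^sup>2 - t\<^sup>2 < 0" using bc by linarith
    show GH: "G (yfun t) = yfun t * H (yfun t)" by (simp add: G_def ymin[OF that])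
    have "D (yfun t) = yfun t * (b\<^sup>2 - t\<^sup>2)"
      using yfun_inverse[of t] by (simp add: D_def ymin[OF that] algebra_simps)
    then show "G (yfun t) = 1 / (b\<^sup>2 - t\<^sup>2)" using yfun_bounds(1)[of t] bt by (simp add: GH H_def)
  qed
  define A where "A = (\<lambda>n. \<Sum>l<N n. (cmod (U n l))\<^sup>2 * G (yfun (s n l)))"
  define T where "T = (\<lambda>n. \<Sum>l<N n. V n l * cnj (U n l) * of_real (s n l * yfun (s n l)) * of_real (H (yfun (s n l))))"
  define R where "R = (\<lambda>n. \<Sum>l<N n. U' n l * cnj (U n l) * of_real (G (yfun (s n l))))"
  have A: "A \<longlonglongrightarrow> (\<integral>t. G (yfun t) \<partial>\<mu>)" unfolding A_def by (rule U_cont[OF cG])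
  have T: "T \<longlonglongrightarrow> 0" unfolding T_def by (rule cross_cont[OF cH])
  have "compact (G ` {0..1})" by (intro compact_continuous_image cG compact_Icc)
  then have "bounded (G ` {0..1})" by (rule compact_imp_bounded)
  then obtain K where "\<forall>x\<in>{0..1}. norm (G x) \<le> K" by (auto simp: bounded_iff)
  then have K: "\<bar>G (yfun t)\<bar> \<le> K" for t using yfun_in[of t] by force
  have K0: "0 \<le> K" using K[of 0] by linarith
  have Rb: "eventually (\<lambda>n. norm (R n) \<le> 2 * K) sequentially"
    using U'_norm U_le
  proof eventually_elim
    case (elim n)
    have "norm (R n) \<le> (\<Sum>l<N n. K * (((cmod (U n l))\<^sup>2 + (cmod (U' n l))\<^sup>2) / 2))"
      unfolding R_def
    proof (rule sum_norm_le)
      fix l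
      have "norm (U' n l * cnj (U n l) * of_real (G (yfun (s n l)))) = \<bar>G (yfun (s n l))\<bar> * (cmod (U' n l) * cmod (U n l))"
        by (simp only: norm_mult norm_of_real complex_mod_cnj mult_ac)
      also have "\<dots> \<le> K * (((cmod (U n l))\<^sup>2 + (cmod (U' n l))\<^sup>2) / 2)"
        using sum_squares_bound[of "cmod (U' n l)" "cmod (U n l)"] K0 by (intro mult_mono K) auto
      finally show "norm (U' n l * cnj (U n l) * of_real (G (yfun (s n l)))) \<le> K * (((cmod (U n l))\<^sup>2 + (cmod (U' n l))\<^sup>2) / 2)" .
    qed
    also have "\<dots> = K * (((\<Sum>l<N n. (cmod (U n l))\<^sup>2) + (\<Sum>l<N n. (cmod (U' n l))\<^sup>2)) / 2)"
      by (simp add: sum_distrib_left[symmetric] sum.distrib sum_divide_distrib[symmetric])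
    also have "\<dots> \<le> K * 2" using elim K0 by (intro mult_left_mono) auto
    finally show ?case by simp
  qed
  \<comment> \<open>On the singular values G = 1/(b^2 - s^2), with b in place of \<sigma>. The
    replacement costs (b^2 - \<sigma>^2) R, and R is bounded.\<close>
  have ev: "eventually (\<lambda>n. \<beta> n = of_real \<theta> * \<alpha> n * of_real (\<sigma> n) * of_real (A n) + of_real \<theta> * \<beta> n * T n + of_real (b\<^sup>2 - (\<sigma> n)\<^sup>2) * R n) sequentially"
    using eq \<beta>_eq s_lower[OF c(2)]
  proof eventually_elim
    case (elim n)
    have "U' n l * cnj (U n l) = of_real \<theta> * \<alpha> n * of_real (\<sigma> n) * of_real ((cmod (U n l))\<^sup>2 * G (yfun (s n l)))
        + of_real \<theta> * \<beta> n * (V n l * cnj (U n l) * of_real (s n l * yfun (s n l)) * of_real (H (yfun (s n l))))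
        + of_real (b\<^sup>2 - (\<sigma> n)\<^sup>2) * (U' n l * cnj (U n l) * of_real (G (yfun (s n l))))" if l: "l < N n" for l
    proof -
      have sl: "c \<le> s n l" using elim(3) l by (simp add: less_imp_le)
      define g where "g = complex_of_real (G (yfun (s n l)))"
      have "of_real (b\<^sup>2 - (s n l)\<^sup>2) * g = 1"
        unfolding g_def Gy[OF sl] of_real_mult[symmetric] using bt[OF sl] by simp
      then have "U' n l * cnj (U n l) = (of_real (b\<^sup>2 - (s n l)\<^sup>2) * U' n l) * g * cnj (U n l)" by (simp add: mult_ac)
      also have "of_real (b\<^sup>2 - (s n l)\<^sup>2) * U' n l = of_real ((\<sigma> n)\<^sup>2 - (s n l)\<^sup>2) * U' n l + of_real (b\<^sup>2 - (\<sigma> n)\<^sup>2) * U' n l"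
        by (simp add: algebra_simps)
      also have "of_real ((\<sigma> n)\<^sup>2 - (s n l)\<^sup>2) * U' n l = of_real \<theta> * (\<alpha> n * of_real (\<sigma> n) * U n l + \<beta> n * of_real (s n l) * V n l)"
        using elim(1) l by blast
      finally have "U' n l * cnj (U n l) = of_real \<theta> * \<alpha> n * of_real (\<sigma> n) * (U n l * cnj (U n l)) * g
        + of_real \<theta> * \<beta> n * (V n l * cnj (U n l) * of_real (s n l)) * g + of_real (b\<^sup>2 - (\<sigma> n)\<^sup>2) * (U' n l * cnj (U n l)) * g"
        by (simp add: algebra_simps)
      moreover have "U n l * cnj (U n l) = of_real ((cmod (U n l))\<^sup>2)" by (rule complex_norm_square[symmetric])
      moreover have "g = of_real (yfun (s n l)) * of_real (H (yfun (s n l)))" unfolding g_def GH[OF sl] by simp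
      ultimately show ?thesis unfolding of_real_mult g_def[symmetric] by (simp add: mult_ac)
    qed
    then have "(\<Sum>l<N n. U' n l * cnj (U n l)) = (\<Sum>l<N n. of_real \<theta> * \<alpha> n * of_real (\<sigma> n) * of_real ((cmod (U n l))\<^sup>2 * G (yfun (s n l)))
        + of_real \<theta> * \<beta> n * (V n l * cnj (U n l) * of_real (s n l * yfun (s n l)) * of_real (H (yfun (s n l))))
        + of_real (b\<^sup>2 - (\<sigma> n)\<^sup>2) * (U' n l * cnj (U n l) * of_real (G (yfun (s n l)))))"
      by (intro sum.cong refl) blast
    also have "\<dots> = of_real \<theta> * \<alpha> n * of_real (\<sigma> n) * of_real (A n) + of_real \<theta> * \<beta> n * T n + of_real (b\<^sup>2 - (\<sigma> n)\<^sup>2) * R n"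
      unfolding A_def T_def R_def of_real_sum sum_distrib_left sum.distrib ..
    finally show ?case using elim(2) by simp
  qed
  have R0: "(\<lambda>n. of_real (b\<^sup>2 - (\<sigma> n)\<^sup>2) * R n) \<longlonglongrightarrow> 0"
  proof (rule Lim_null_comparison)
    have "(\<lambda>n. b\<^sup>2 - (\<sigma> n)\<^sup>2) \<longlonglongrightarrow> b\<^sup>2 - b\<^sup>2" by (intro tendsto_intros \<sigma>_lim)
    then have "(\<lambda>n. b\<^sup>2 - (\<sigma> n)\<^sup>2) \<longlonglongrightarrow> 0" by simp
    from tendsto_mult_left_zero[OF tendsto_rabs_zero[OF this], of "2 * K"]
    show "(\<lambda>n. \<bar>b\<^sup>2 - (\<sigma> n)\<^sup>2\<bar> * (2 * K)) \<longlonglongrightarrow> 0" .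
    show "eventually (\<lambda>n. norm (of_real (b\<^sup>2 - (\<sigma> n)\<^sup>2) * R n) \<le> \<bar>b\<^sup>2 - (\<sigma> n)\<^sup>2\<bar> * (2 * K)) sequentially"
      using Rb by eventually_elim (simp only: norm_mult norm_of_real mult_left_mono abs_ge_zero)
  qed
  have lim: "(\<lambda>n. of_real \<theta> * \<alpha> n * of_real (\<sigma> n) * of_real (A n) + of_real \<theta> * \<beta> n * T n + of_real (b\<^sup>2 - (\<sigma> n)\<^sup>2) * R n) \<longlonglongrightarrow>
     of_real \<theta> * \<alpha>0 * of_real b * of_real (\<integral>t. G (yfun t) \<partial>\<mu>) + of_real \<theta> * \<beta>0 * 0 + 0"
    by (intro tendsto_intros \<sigma>_lim \<alpha>_lim \<beta>_lim A T R0)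
  have fin: "\<beta>0 = of_real \<theta> * \<alpha>0 * of_real b * of_real (\<integral>t. G (yfun t) \<partial>\<mu>)"
    using LIMSEQ_unique[OF \<beta>_lim Lim_transform_eventually[OF lim]] ev by (simp add: eq_commute)
  have "b * (\<integral>t. G (yfun t) \<partial>\<mu>) = phi \<mu> b"
  proof -
    have "b * (\<integral>t. G (yfun t) \<partial>\<mu>) = (\<integral>t. b * G (yfun t) \<partial>\<mu>)" by simp
    also have "\<dots> = (\<integral>t. b / (b\<^sup>2 - t\<^sup>2) \<partial>\<mu>)"
    proof (rule integral_cong_AE)
      show "(\<lambda>t. b * G (yfun t)) \<in> borel_measurable \<mu>"
        using integrable_continuous_yfun[OF \<mu> cG] by simp
      show "AE t in \<mu>. b * G (yfun t) = b / (b\<^sup>2 - t\<^sup>2)"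
        using AE_a by eventually_elim (use c Gy in auto)
    qed simp
    finally show ?thesis by (simp add: phi_def)
  qed
  then have "of_real (\<theta> * phi \<mu> b) * \<alpha>0 = of_real (\<theta> * (b * (\<integral>t. G (yfun t) \<partial>\<mu>))) * \<alpha>0" by simp
  then show ?thesis unfolding fin by (auto simp: mult_ac)
qed

end

section \<open>The limit measure: its edge, \<open>phi\<close> and the threshold\<close>

text \<open>The complement of the support is a union of open null sets; by Lindelof countably many
  of them suffice.\<close>

lemma AE_in_measure_support:
  fixes \<mu> :: "'a::second_countable_topology measure"
  assumes sets: "sets \<mu> = sets borel"
  shows "AE x in \<mu>. x \<in> measure_support \<mu>"
proof -
  define F where "F = {U :: 'a set. open U \<and> emeasure \<mu> U = 0}"
  have op: "\<And>S. S \<in> F \<Longrightarrow> open S" by (simp add: F_def)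
  have "\<exists>F'. F' \<subseteq> F \<and> countable F' \<and> \<Union>F' = \<Union>F"
  proof (rule Lindelof[OF op])
    fix F' assume "F' \<subseteq> F" "countable F'" "\<Union>F' = \<Union>F"
    then show ?thesis by (intro exI[of _ F'] conjI)
  qed
  then obtain F' where F': "F' \<subseteq> F" "countable F'" "\<Union>F' = \<Union>F" by blast
  have "emeasure \<mu> (\<Union>F') = 0"
  proof -
    have "(\<Union>U\<in>F'. U) \<in> null_sets \<mu>"
      using F' sets by (intro null_sets_UN') (auto simp: F_def null_sets_def)
    then show ?thesis by (simp add: null_sets_def)
  qed
  then have null: "\<Union>F' \<in> null_sets \<mu>"
    using F' op sets by (auto simp: null_sets_def intro!: borel_open)
  show ?thesis
  proof (rule AE_I'[OF null])
    have "x \<in> \<Union>F" if "x \<notin> measure_support \<mu>" for x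
      using that by (auto simp: measure_support_def F_def not_gr_zero)
    then show "{x \<in> space \<mu>. x \<notin> measure_support \<mu>} \<subseteq> \<Union>F'" unfolding F'(3) by blast
  qed
qed

lemma closed_measure_support: "closed (measure_support \<mu>)"
proof -
  have "open (- measure_support \<mu>)"
  proof (subst open_subopen, rule ballI)
    fix x assume "x \<in> - measure_support \<mu>"
    then obtain U where U: "open U" "x \<in> U" "\<not> emeasure \<mu> U > 0" unfolding measure_support_def by blast
    then have "U \<subseteq> - measure_support \<mu>" unfolding measure_support_def by blast
    then show "\<exists>T. open T \<and> x \<in> T \<and> T \<subseteq> - measure_support \<mu>" using U by (intro exI[of _ U] conjI)
  qed
  then show ?thesis by (simp add: closed_def)
qed

locale compact_distribution = real_distribution \<mu> for \<mu> +
  fixes a :: real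
  assumes compact_support: "compact (measure_support \<mu>)"
    and a_def: "a = Inf (measure_support \<mu>)"
    and a_pos: "a > 0"
begin

lemma AE_in_support: "AE x in \<mu>. x \<in> measure_support \<mu>"
  by (rule AE_in_measure_support) (rule events_eq_borel)

lemma support_nonempty: "measure_support \<mu> \<noteq> {}"
proof
  assume e: "measure_support \<mu> = {}"
  have "AE x in \<mu>. False" using AE_in_support unfolding e empty_iff .
  then show False by (simp only: AE_False)
qed

lemma a_in_support: "a \<in> measure_support \<mu>"
  unfolding a_def
  by (rule closed_contains_Inf[OF support_nonempty _ closed_measure_support])
     (rule bounded_imp_bdd_below[OF compact_imp_bounded[OF compact_support]])

lemma AE_ge_a: "AE t in \<mu>. a \<le> t"
proof -
  have "a \<le> t" if "t \<in> measure_support \<mu>" for t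
    unfolding a_def by (rule cInf_lower[OF that bounded_imp_bdd_below[OF compact_imp_bounded[OF compact_support]]])
  moreover note AE_in_support
  ultimately show ?thesis by (auto elim!: eventually_mono)
qed

lemma AE_bounded: "\<exists>T. AE t in \<mu>. \<bar>t\<bar> \<le> T"
proof -
  obtain T where "\<forall>t\<in>measure_support \<mu>. norm t \<le> T"
    using compact_imp_bounded[OF compact_support] by (auto simp: bounded_iff)
  moreover note AE_in_support
  ultimately have "AE t in \<mu>. \<bar>t\<bar> \<le> T" by (auto elim!: eventually_mono)
  then show ?thesis by blast
qed

lemma prob_near_a: "a < c \<Longrightarrow> 0 < prob {..<c}"
  using a_in_support unfolding measure_support_def
  by (force simp: emeasure_eq_measure)

lemma integrable_phi:
  assumes "0 < z" "z < a"
  shows "integrable \<mu> (\<lambda>t. z / (z\<^sup>2 - t\<^sup>2))"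
proof (rule integrable_const_bound)
  have za: "z\<^sup>2 < a\<^sup>2" using assms by (intro power_strict_mono) auto
  show "AE t in \<mu>. norm (z / (z\<^sup>2 - t\<^sup>2)) \<le> z / (a\<^sup>2 - z\<^sup>2)"
    using AE_ge_a
  proof eventually_elim
    case (elim t)
    have "a\<^sup>2 \<le> t\<^sup>2" using elim a_pos by (intro power_mono) auto
    then have "norm (z / (z\<^sup>2 - t\<^sup>2)) = z / (t\<^sup>2 - z\<^sup>2)" using za assms by simp
    also have "\<dots> \<le> z / (a\<^sup>2 - z\<^sup>2)" using za \<open>a\<^sup>2 \<le> t\<^sup>2\<close> assms by (intro divide_left_mono) auto
    finally show ?case .
  qed
qed simp

lemma phi_le_0:
  assumes "0 < z" "z < a"
  shows "phi \<mu> z \<le> 0"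
proof -
  have za: "z\<^sup>2 < a\<^sup>2" using assms by (intro power_strict_mono) auto
  have "AE t in \<mu>. z / (z\<^sup>2 - t\<^sup>2) \<le> 0"
    using AE_ge_a
  proof eventually_elim
    case (elim t)
    have "a\<^sup>2 \<le> t\<^sup>2" using elim a_pos by (intro power_mono) auto
    then show ?case using za assms by (simp add: divide_le_0_iff)
  qed
  then have "(\<integral>t. z / (z\<^sup>2 - t\<^sup>2) \<partial>\<mu>) \<le> (\<integral>t. 0 \<partial>\<mu>)"
    by (intro integral_mono_AE integrable_phi assms) auto
  then show ?thesis by (simp add: phi_def)
qed

text \<open>This is the monotonicity of phi(z)/z, the integral of 1/(z^2 - t^2). The factor z/z' < 1
  is what later makes the threshold inequality strict.\<close>

lemma phi_scale:
  assumes "0 < z" "z < z'" "z' < a"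
  shows "(z / z') * phi \<mu> z' \<le> phi \<mu> z"
proof -
  have z: "z\<^sup>2 < z'\<^sup>2" "z'\<^sup>2 < a\<^sup>2" using assms by (auto intro!: power_strict_mono)
  have "(z / z') * phi \<mu> z' = (\<integral>t. (z / z') * (z' / (z'\<^sup>2 - t\<^sup>2)) \<partial>\<mu>)" by (simp only: phi_def integral_mult_right_zero)
  also have "\<dots> \<le> phi \<mu> z"
    unfolding phi_def
  proof (rule integral_mono_AE)
    show "integrable \<mu> (\<lambda>t. (z / z') * (z' / (z'\<^sup>2 - t\<^sup>2)))"
      by (intro integrable_mult_right integrable_phi) (use assms in auto)
    show "integrable \<mu> (\<lambda>t. z / (z\<^sup>2 - t\<^sup>2))" using integrable_phi[of z] assms by simp
    show "AE t in \<mu>. (z / z') * (z' / (z'\<^sup>2 - t\<^sup>2)) \<le> z / (z\<^sup>2 - t\<^sup>2)"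
      using AE_ge_a
    proof eventually_elim
      case (elim t)
      have t: "a\<^sup>2 \<le> t\<^sup>2" using elim a_pos by (intro power_mono) auto
      have "z / (t\<^sup>2 - z\<^sup>2) \<le> z / (t\<^sup>2 - z'\<^sup>2)" using t z assms by (intro divide_left_mono) auto
      moreover have "z / (z\<^sup>2 - t\<^sup>2) = - (z / (t\<^sup>2 - z\<^sup>2))" "z / (z'\<^sup>2 - t\<^sup>2) = - (z / (t\<^sup>2 - z'\<^sup>2))"
        by (simp_all add: minus_divide_right)
      moreover have "(z / z') * (z' / (z'\<^sup>2 - t\<^sup>2)) = z / (z'\<^sup>2 - t\<^sup>2)" using assms by simp
      ultimately show ?case by linarith
    qed
  qed
  finally show ?thesis .
qed

lemma phi_antimono:
  assumes "0 < z" "z < z'" "z' < a"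
  shows "phi \<mu> z' \<le> phi \<mu> z"
proof -
  have "1 * phi \<mu> z' \<le> (z / z') * phi \<mu> z'"
    using assms phi_le_0[of z'] by (intro mult_right_mono_neg) auto
  then show ?thesis using phi_scale[OF assms] by simp
qed

text \<open>Since phi is decreasing on (0,a), its left limit at a exists in the extended reals and
  is its infimum.\<close>

lemma Lim_phi: "Lim (at_left a) (\<lambda>z. ereal (phi \<mu> z)) = (INF z\<in>{0<..<a}. ereal (phi \<mu> z))"
proof (rule tendsto_Lim)
  have ev: "eventually (\<lambda>z. z \<in> {c<..<a}) (at_left a)" if "c < a" for c
    using that by (auto simp: eventually_at_left[OF that])
  show "((\<lambda>z. ereal (phi \<mu> z)) \<longlongrightarrow> (INF z\<in>{0<..<a}. ereal (phi \<mu> z))) (at_left a)"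
  proof (rule decreasing_tendsto)
    show "eventually (\<lambda>z. (INF z\<in>{0<..<a}. ereal (phi \<mu> z)) \<le> ereal (phi \<mu> z)) (at_left a)"
      using ev[OF a_pos] by eventually_elim (auto intro: INF_lower)
    fix x assume "(INF z\<in>{0<..<a}. ereal (phi \<mu> z)) < x"
    then obtain z where z: "z \<in> {0<..<a}" "ereal (phi \<mu> z) < x" by (auto simp: INF_less_iff)
    then have "z < a" by simp
    show "eventually (\<lambda>z. ereal (phi \<mu> z) < x) (at_left a)"
      using ev[OF \<open>z < a\<close>]
    proof eventually_elim
      case (elim z')
      then have "phi \<mu> z' \<le> phi \<mu> z" using z by (intro phi_antimono) auto
      then show ?case using z(2) by (meson ereal_less_eq(3) order_le_less_trans)
    qed
  qed
qed (simp add: trivial_limit_at_left_real)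

text \<open>The threshold gives \<theta> |phi(b')| <= 1 at every b' in (0,a). Taking b' halfway
  between b and a and applying \<open>phi_scale\<close> gains the factor b/b' < 1, so the inequality
  at b is strict even when \<theta> equals the threshold.\<close>

lemma subthreshold:
  assumes \<theta>: "\<theta> > 0" and le: "ereal \<theta> \<le> lower_threshold \<mu>" and b: "0 \<le> b" "b < a"
  shows "\<bar>\<theta> * phi \<mu> b\<bar> < 1"
proof (cases "b = 0")
  case True
  then show ?thesis by (simp add: phi_def)
next
  case False
  then have b0: "0 < b" using b by simp
  define b' where "b' = (a + b) / 2"
  have b': "b < b'" "b' < a" using b by (auto simp: b'_def)
  define L where "L = (INF z\<in>{0<..<a}. ereal (phi \<mu> z))"
  have thr: "lower_threshold \<mu> = inverse (- L)"
    unfolding lower_threshold_def L_def Lim_phi[symmetric] a_def[symmetric] ..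
  have L: "L \<le> ereal (phi \<mu> b')" unfolding L_def using b' b0 by (intro INF_lower) auto
  have "\<theta> * (- phi \<mu> b') \<le> 1"
  proof (cases L)
    case (real r)
    then have r: "r \<le> phi \<mu> b'" using L by simp
    have p0: "phi \<mu> b' \<le> 0" using b' b0 by (intro phi_le_0) auto
    show ?thesis
    \<comment> \<open>For r = 0 the threshold is infinite, but then phi(b'), which lies between r
      and 0, vanishes.\<close>
    proof (cases "r = 0")
      case True
      then show ?thesis using r p0 by simp
    next
      case False
      then have "r < 0" using r p0 by simp
      then have "\<theta> \<le> 1 / (- r)" using le unfolding thr real by (simp add: inverse_eq_divide)
      then have "\<theta> * (- r) \<le> 1" using \<open>r < 0\<close> by (simp add: field_simps)
      moreover have "\<theta> * (- phi \<mu> b') \<le> \<theta> * (- r)" using r \<theta> by (intro mult_left_mono) auto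
      ultimately show ?thesis by linarith
    qed
  next
    case PInf
    then show ?thesis using L by simp
  next
    \<comment> \<open>The limit minus infinity makes the threshold 0, contradicting \<theta> >
      0.\<close>
    case MInf
    then show ?thesis using le \<theta> unfolding thr by simp
  qed
  then have "(b / b') * (\<theta> * (- phi \<mu> b')) \<le> (b / b') * 1"
    using b0 b' by (intro mult_left_mono) auto
  moreover have "- phi \<mu> b \<le> (b / b') * (- phi \<mu> b')" using phi_scale[OF b0 b'] by simp
  then have "\<theta> * (- phi \<mu> b) \<le> \<theta> * ((b / b') * (- phi \<mu> b'))" using \<theta> by (intro mult_left_mono) auto
  moreover have "\<theta> * ((b / b') * (- phi \<mu> b')) = (b / b') * (\<theta> * (- phi \<mu> b'))" by (rule mult.left_commute)
  ultimately have "\<theta> * (- phi \<mu> b) \<le> b / b'" by linarith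
  moreover have "b / b' < 1" using b0 b' by simp
  moreover have "\<theta> * phi \<mu> b \<le> 0" using \<theta> phi_le_0[OF b0 b(2)] by (simp add: mult_le_0_iff)
  ultimately show ?thesis by simp
qed

text \<open>A regularization of the integral of 1/(t^2 - a^2)^2, the singular part of phi' at the
  edge.\<close>

definition edge_integral :: "real \<Rightarrow> real" where
  "edge_integral \<eta> = (\<integral>t. 1 / ((t\<^sup>2 - a\<^sup>2)\<^sup>2 + \<eta>\<^sup>2) \<partial>\<mu>)"

lemma edge_integrable:
  assumes "\<eta> > 0"
  shows "integrable \<mu> (\<lambda>t. 1 / ((t\<^sup>2 - a\<^sup>2)\<^sup>2 + \<eta>\<^sup>2))"
proof (rule integrable_const_bound)
  have "1 / ((t\<^sup>2 - a\<^sup>2)\<^sup>2 + \<eta>\<^sup>2) \<le> 1 / \<eta>\<^sup>2" for t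
    using assms by (intro divide_left_mono mult_pos_pos add_nonneg_pos) auto
  then show "AE t in \<mu>. norm (1 / ((t\<^sup>2 - a\<^sup>2)\<^sup>2 + \<eta>\<^sup>2)) \<le> 1 / \<eta>\<^sup>2" by simp
qed simp

text \<open>With p = t^2 - z^2 and q = t^2 - z'^2 the difference of the integrands is (z' - z)(t^2 +
  z z')/(p q). Here p >= q, and q = (t^2 - a^2) + \<eta> with \<eta> = a^2 - z'^2 and both summands
  nonnegative, so p q >= q^2 >= (t^2 - a^2)^2 + \<eta>^2. Thus the edge integrals control the slopes
  of phi.\<close>

lemma phi_difference_le:
  assumes T: "AE t in \<mu>. \<bar>t\<bar> \<le> T" and z: "0 < z" "z < z'" "z' < a"
  shows "phi \<mu> z - phi \<mu> z' \<le> (z' - z) * ((T\<^sup>2 + a\<^sup>2) * edge_integral (a\<^sup>2 - z'\<^sup>2))"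
proof -
  define \<eta> where "\<eta> = a\<^sup>2 - z'\<^sup>2"
  have zz: "z\<^sup>2 < z'\<^sup>2" "z'\<^sup>2 < a\<^sup>2" using z by (auto intro!: power_strict_mono)
  have \<eta>: "\<eta> > 0" using zz by (simp add: \<eta>_def)
  have "phi \<mu> z - phi \<mu> z' = (\<integral>t. z / (z\<^sup>2 - t\<^sup>2) - z' / (z'\<^sup>2 - t\<^sup>2) \<partial>\<mu>)"
    unfolding phi_def using integrable_phi[of z] integrable_phi[of z'] z by simp
  also have "\<dots> \<le> (\<integral>t. (z' - z) * (T\<^sup>2 + a\<^sup>2) * (1 / ((t\<^sup>2 - a\<^sup>2)\<^sup>2 + \<eta>\<^sup>2)) \<partial>\<mu>)"
  proof (rule integral_mono_AE)
    show "integrable \<mu> (\<lambda>t. z / (z\<^sup>2 - t\<^sup>2) - z' / (z'\<^sup>2 - t\<^sup>2))"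
      using integrable_phi[of z] integrable_phi[of z'] z by simp
    show "integrable \<mu> (\<lambda>t. (z' - z) * (T\<^sup>2 + a\<^sup>2) * (1 / ((t\<^sup>2 - a\<^sup>2)\<^sup>2 + \<eta>\<^sup>2)))"
      by (intro integrable_mult_right edge_integrable \<eta>)
    show "AE t in \<mu>. z / (z\<^sup>2 - t\<^sup>2) - z' / (z'\<^sup>2 - t\<^sup>2) \<le> (z' - z) * (T\<^sup>2 + a\<^sup>2) * (1 / ((t\<^sup>2 - a\<^sup>2)\<^sup>2 + \<eta>\<^sup>2))"
      using AE_ge_a T
    proof eventually_elim
      case (elim t)
      have t: "a\<^sup>2 \<le> t\<^sup>2" using elim a_pos by (intro power_mono) auto
      have tT: "t\<^sup>2 \<le> T\<^sup>2" using elim power_mono[of "\<bar>t\<bar>" T 2] by simp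
      define p q where "p = t\<^sup>2 - z\<^sup>2" and "q = t\<^sup>2 - z'\<^sup>2"
      have pq: "0 < q" "q \<le> p" using t zz by (auto simp: p_def q_def)
      have "z / (z\<^sup>2 - t\<^sup>2) - z' / (z'\<^sup>2 - t\<^sup>2) = z' / q - z / p"
      proof -
        have "z\<^sup>2 - t\<^sup>2 = - p" "z'\<^sup>2 - t\<^sup>2 = - q" by (simp_all add: p_def q_def)
        then show ?thesis by simp
      qed
      also have "\<dots> = (z' * p - z * q) / (p * q)" using pq by (simp add: field_simps)
      also have "z' * p - z * q = (z' - z) * (t\<^sup>2 + z * z')" by (simp add: p_def q_def power2_eq_square algebra_simps)
      also have "(z' - z) * (t\<^sup>2 + z * z') / (p * q) \<le> (z' - z) * (T\<^sup>2 + a\<^sup>2) / ((t\<^sup>2 - a\<^sup>2)\<^sup>2 + \<eta>\<^sup>2)"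
      proof (rule frac_le)
        show "0 \<le> (z' - z) * (T\<^sup>2 + a\<^sup>2)" using z by simp
        have "z * z' \<le> a * a" using z by (intro mult_mono) auto
        then show "(z' - z) * (t\<^sup>2 + z * z') \<le> (z' - z) * (T\<^sup>2 + a\<^sup>2)"
          using z tT by (intro mult_left_mono) (auto simp: power2_eq_square)
        show "0 < (t\<^sup>2 - a\<^sup>2)\<^sup>2 + \<eta>\<^sup>2" using \<eta> by (simp add: add_nonneg_pos)
        have "(t\<^sup>2 - a\<^sup>2)\<^sup>2 + \<eta>\<^sup>2 \<le> ((t\<^sup>2 - a\<^sup>2) + \<eta>)\<^sup>2"
          using t \<eta> by (simp add: power2_sum)
        also have "(t\<^sup>2 - a\<^sup>2) + \<eta> = q" by (simp add: \<eta>_def q_def)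
        also have "q\<^sup>2 \<le> p * q" using pq by (simp add: power2_eq_square)
        finally show "(t\<^sup>2 - a\<^sup>2)\<^sup>2 + \<eta>\<^sup>2 \<le> p * q" .
      qed
      finally show ?case by simp
    qed
  qed
  also have "\<dots> = (z' - z) * ((T\<^sup>2 + a\<^sup>2) * edge_integral \<eta>)"
    unfolding edge_integral_def by (simp only: integral_mult_right_zero mult.assoc)
  finally show ?thesis by (simp add: \<eta>_def)
qed

text \<open>If the integrals stayed bounded, \<open>phi\<close> would be Lipschitz near the edge. Where \<open>phi\<close> is not
  differentiable, \<open>deriv\<close> has an arbitrary value, but always the same one.\<close>
lemma edge_integral_unbounded:
  assumes deriv: "filterlim (deriv (phi \<mu>)) at_bot (at_left a)"
  shows "\<exists>\<eta>>0. K < edge_integral \<eta>"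
proof (rule ccontr)
  assume "\<not> ?thesis"
  then have K: "edge_integral \<eta> \<le> K" if "\<eta> > 0" for \<eta> using that by (meson not_less)
  obtain T where T: "AE t in \<mu>. \<bar>t\<bar> \<le> T" using AE_bounded by blast
  define C where "C = (T\<^sup>2 + a\<^sup>2) * K"
  have lip: "phi \<mu> z - phi \<mu> z' \<le> (z' - z) * C" if z: "0 < z" "z < z'" "z' < a" for z z'
  proof -
    have "z'\<^sup>2 < a\<^sup>2" using z by (intro power_strict_mono) auto
    then have "(T\<^sup>2 + a\<^sup>2) * edge_integral (a\<^sup>2 - z'\<^sup>2) \<le> C" unfolding C_def by (intro mult_left_mono K) auto
    then have "(z' - z) * ((T\<^sup>2 + a\<^sup>2) * edge_integral (a\<^sup>2 - z'\<^sup>2)) \<le> (z' - z) * C" using z by (intro mult_left_mono) auto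
    then show ?thesis using phi_difference_le[OF T z] by linarith
  qed
  define J where "J = (SOME D::real. False)"
  have lower: "min (- C) J \<le> deriv (phi \<mu>) z" if z: "0 < z" "z < a" for z
  proof (cases "\<exists>D. DERIV (phi \<mu>) z :> D")
    case True
    then obtain D where D: "DERIV (phi \<mu>) z :> D" by blast
    then have "((\<lambda>y. (phi \<mu> y - phi \<mu> z) / (y - z)) \<longlongrightarrow> D) (at_right z)"
      using has_field_derivative_at_within[OF D] by (simp add: has_field_derivative_iff)
    moreover have "eventually (\<lambda>y. - C \<le> (phi \<mu> y - phi \<mu> z) / (y - z)) (at_right z)"
    proof -
      have "eventually (\<lambda>y. y \<in> {z<..<a}) (at_right z)" using z by (auto simp: eventually_at_right[OF z(2)])
      then show ?thesis
      proof eventually_elim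
        case (elim y)
        have "phi \<mu> z - phi \<mu> y \<le> (y - z) * C" using elim z by (intro lip) auto
        then show ?case using elim by (simp add: pos_le_divide_eq algebra_simps)
      qed
    qed
    ultimately have "- C \<le> D" by (rule tendsto_lowerbound) (simp add: trivial_limit_at_right_real)
    then show ?thesis using DERIV_imp_deriv[OF D] by simp
  next
    case False
    then have "(\<lambda>D. DERIV (phi \<mu>) z :> D) = (\<lambda>D. False)" by blast
    then have "deriv (phi \<mu>) z = J" unfolding deriv_def J_def by simp
    then show ?thesis by simp
  qed
  have "eventually (\<lambda>z. deriv (phi \<mu>) z < min (- C) J) (at_left a)"
    using deriv unfolding filterlim_at_bot_dense by blast
  moreover have "eventually (\<lambda>z. z \<in> {0<..<a}) (at_left a)"
    using a_pos by (auto simp: eventually_at_left[OF a_pos])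
  ultimately have "eventually (\<lambda>z. False) (at_left a)"
  proof eventually_elim
    case (elim z)
    then have "min (- C) J \<le> deriv (phi \<mu>) z" by (intro lower) auto
    then show ?case using elim(1) by linarith
  qed
  then show False by (simp add: trivial_limit_at_left_real)
qed

end

section \<open>Rank one interlacing and convergence of the overlaps\<close>

text \<open>Some nonzero combination of two right singular vectors of X is orthogonal to v. On it
  the perturbed matrix agrees with X and stretches by at most c, which bounds its smallest singular
  value.\<close>

lemma rank_one_interlacing:
  fixes X Xt :: "complex mat"
  assumes X: "X \<in> carrier_mat n n" and Xt: "Xt \<in> carrier_mat n n"
    and entries: "\<And>i j. i < n \<Longrightarrow> j < n \<Longrightarrow> Xt $$ (i, j) = X $$ (i, j) + p i * cnj (v j)"
    and b: "right_singular_basis n X w s"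
    and lm: "l < n" "m < n" "l \<noteq> m" and c: "s l \<le> c" "s m \<le> c"
  shows "smallest_singular_value Xt \<le> c"
proof -
  have n: "n > 0" using lm by simp
  have w: "orthonormal n n w" and s0: "0 \<le> s l" "0 \<le> s m" using b lm by (auto simp: right_singular_basis_def)
  have c0: "0 \<le> c" using s0 c by linarith
  define P where "P = (\<Sum>j<n. w l j * cnj (v j))"
  define Q where "Q = (\<Sum>j<n. w m j * cnj (v j))"
  \<comment> \<open>A solution (A, B) of A P + B Q = 0 that is nonzero even when P and Q both
    vanish.\<close>
  define A where "A = (if P = 0 \<and> Q = 0 then 1 else Q)"
  define B where "B = (if P = 0 \<and> Q = 0 then 0 else - P)"
  have AB: "A * P + B * Q = 0" "(cmod A)\<^sup>2 + (cmod B)\<^sup>2 > 0"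
    by (auto simp: A_def B_def add_pos_nonneg add_nonneg_pos)
  define x where "x = (\<lambda>j. A * w l j + B * w m j)"
  have xv: "(\<Sum>j<n. x j * cnj (v j)) = 0"
    using AB(1) by (simp add: x_def P_def Q_def algebra_simps sum.distrib sum_distrib_left)
  have Xx: "(\<Sum>j<n. Xt $$ (k, j) * x j) = (\<Sum>j<n. X $$ (k, j) * x j)" if k: "k < n" for k
  proof -
    have "(\<Sum>j<n. Xt $$ (k, j) * x j) = (\<Sum>j<n. X $$ (k, j) * x j + p k * (x j * cnj (v j)))"
      using k by (intro sum.cong refl) (simp add: entries algebra_simps)
    also have "\<dots> = (\<Sum>j<n. X $$ (k, j) * x j) + p k * (\<Sum>j<n. x j * cnj (v j))"
      by (simp only: sum.distrib sum_distrib_left)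
    finally show ?thesis unfolding xv by simp
  qed
  have co: "coord n w x i = A * (if i = l then 1 else 0) + B * (if i = m then 1 else 0)" if i: "i < n" for i
  proof -
    have "coord n w x i = A * (\<Sum>j<n. w l j * cnj (w i j)) + B * (\<Sum>j<n. w m j * cnj (w i j))"
      by (simp add: coord_def x_def algebra_simps sum.distrib sum_distrib_left)
    then show ?thesis using orthonormalD[OF w lm(1) i] orthonormalD[OF w lm(2) i] by auto
  qed
  have two: "(\<Sum>i<n. f i * (cmod (coord n w x i))\<^sup>2) = f l * (cmod A)\<^sup>2 + f m * (cmod B)\<^sup>2" for f :: "nat \<Rightarrow> real"
  proof -
    have "(\<Sum>i<n. f i * (cmod (coord n w x i))\<^sup>2) = (\<Sum>i\<in>{l, m}. f i * (cmod (coord n w x i))\<^sup>2)"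
      by (rule sum.mono_neutral_right) (use lm co in auto)
    also have "\<dots> = f l * (cmod A)\<^sup>2 + f m * (cmod B)\<^sup>2" using lm co by simp
    finally show ?thesis .
  qed
  define \<sigma> where "\<sigma> = smallest_singular_value Xt"
  have \<sigma>0: "0 \<le> \<sigma>" unfolding \<sigma>_def by (rule smallest_singular_value_nonneg[OF Xt n])
  have "\<sigma>\<^sup>2 * ((cmod A)\<^sup>2 + (cmod B)\<^sup>2) = \<sigma>\<^sup>2 * (\<Sum>i<n. (cmod (x i))\<^sup>2)"
    using two[of "\<lambda>_. 1"] coord_norm[OF w, of x] by simp
  also have "\<dots> \<le> (\<Sum>k<n. (cmod (\<Sum>j<n. Xt $$ (k, j) * x j))\<^sup>2)"
    unfolding \<sigma>_def by (rule smallest_singular_value_lower[OF Xt n])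
  also have "\<dots> = (\<Sum>k<n. (cmod (\<Sum>j<n. X $$ (k, j) * x j))\<^sup>2)" by (intro sum.cong refl) (simp only: Xx lessThan_iff)
  also have "\<dots> = (s l)\<^sup>2 * (cmod A)\<^sup>2 + (s m)\<^sup>2 * (cmod B)\<^sup>2"
    unfolding right_singular_basis_norm[OF b] by (rule two)
  also have "\<dots> \<le> c\<^sup>2 * (cmod A)\<^sup>2 + c\<^sup>2 * (cmod B)\<^sup>2"
    using s0 c by (intro add_mono mult_right_mono power_mono) auto
  finally have "\<sigma>\<^sup>2 * ((cmod A)\<^sup>2 + (cmod B)\<^sup>2) \<le> c\<^sup>2 * ((cmod A)\<^sup>2 + (cmod B)\<^sup>2)" by (simp add: distrib_left)
  then have "\<sigma>\<^sup>2 \<le> c\<^sup>2" using AB(2) by (simp add: mult_le_cancel_right)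
  then show ?thesis unfolding \<sigma>_def[symmetric] by (rule power2_le_imp_le[OF _ c0])
qed

text \<open>Terms of size at most 1 cannot exceed 1 in total unless two of them are positive. This
  turns an averaged statement about singular values into the two indices that interlacing
  needs.\<close>

lemma two_indices_of_sum_gt_1:
  fixes f :: "nat \<Rightarrow> real"
  assumes "\<And>l. l < n \<Longrightarrow> f l \<le> 1" and gt: "1 < (\<Sum>l<n. f l)"
  obtains l m where "l < n" "m < n" "l \<noteq> m" "0 < f l" "0 < f m"
proof -
  define A where "A = {l. l < n \<and> 0 < f l}"
  have fin: "finite A" by (simp add: A_def)
  have "(\<Sum>l<n. f l) \<le> (\<Sum>l<n. if 0 < f l then 1 else 0)"
    using assms(1) by (intro sum_mono) auto
  also have "\<dots> = real (card A)"
    by (simp add: sum.If_cases A_def Int_def)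
  finally have "1 < card A" using gt by linarith
  then obtain l where l: "l \<in> A" by (metis card.empty ex_in_conv not_less0)
  have "card (A - {l}) \<noteq> 0" using \<open>1 < card A\<close> l fin by (simp add: card_Diff_singleton)
  then have "A - {l} \<noteq> {}" by (metis card.empty)
  then obtain m where "m \<in> A" "m \<noteq> l" by blast
  then show ?thesis using that[of l m] l by (auto simp: A_def)
qed

text \<open>The situation at one fixed outcome: every almost sure fact is now a plain hypothesis and
  the scalars are complex. \<open>g n\<close> is the concatenated pair of random vectors; the
  scalings \<open>cu\<close> and \<open>cv\<close> with n c^2 -> 1 cover both models of u and
  v.\<close>

locale perturbed_sequence = compact_distribution \<mu> a for \<mu> a +
  fixes X Xt :: "nat \<Rightarrow> complex mat" and g u v ut vt :: "nat \<Rightarrow> nat \<Rightarrow> complex"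
    and cu cv :: "nat \<Rightarrow> real" and \<theta> :: real and \<sigma> :: "nat \<Rightarrow> real"
  assumes \<theta>: "\<theta> > 0" and \<theta>_le: "ereal \<theta> \<le> lower_threshold \<mu>"
    and phi_deriv: "filterlim (deriv (phi \<mu>)) at_bot (at_left a)"
    and X: "\<And>n. X n \<in> carrier_mat n n" and Xt: "\<And>n. Xt n \<in> carrier_mat n n"
    and Xt_entry: "\<And>n i j. i < n \<Longrightarrow> j < n \<Longrightarrow> Xt n $$ (i, j) = X n $$ (i, j) + of_real \<theta> * u n i * cnj (v n j)"
    and weak: "weak_conv_m (\<lambda>n. singular_value_measure (X n)) \<mu>"
    and smallest: "(\<lambda>n. smallest_singular_value (X n)) \<longlonglongrightarrow> a"
    and \<sigma>_def: "\<And>n. \<sigma> n = smallest_singular_value (Xt n)"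
    and right_eq: "\<And>n k. n \<ge> 1 \<Longrightarrow> k < n \<Longrightarrow> (\<Sum>j<n. Xt n $$ (k, j) * vt n j) = of_real (\<sigma> n) * ut n k"
    and left_eq: "\<And>n i. n \<ge> 1 \<Longrightarrow> i < n \<Longrightarrow> (\<Sum>k<n. cnj (Xt n $$ (k, i)) * ut n k) = of_real (\<sigma> n) * vt n i"
    and ut_norm: "\<And>n. n \<ge> 1 \<Longrightarrow> (\<Sum>k<n. (cmod (ut n k))\<^sup>2) = 1"
    and vt_norm: "\<And>n. n \<ge> 1 \<Longrightarrow> (\<Sum>k<n. (cmod (vt n k))\<^sup>2) = 1"
    and u_eq: "\<And>n i. i < n \<Longrightarrow> u n i = of_real (cu n) * g n i"
    and v_eq: "\<And>n i. i < n \<Longrightarrow> v n i = of_real (cv n) * g n (n + i)"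
    and cu: "(\<lambda>n. real n * (cu n)\<^sup>2) \<longlonglongrightarrow> 1" and cv: "(\<lambda>n. real n * (cv n)\<^sup>2) \<longlonglongrightarrow> 1"
    and uu: "\<And>k. (\<lambda>n. centered_form (2 * n) (uu_coeff k n (X n)) (g n) / of_nat n) \<longlonglongrightarrow> 0"
    and vv: "\<And>k. (\<lambda>n. centered_form (2 * n) (vv_coeff k n (X n)) (g n) / of_nat n) \<longlonglongrightarrow> 0"
    and uv: "\<And>k. (\<lambda>n. centered_form (2 * n) (uv_coeff k n (X n)) (g n) / of_nat n) \<longlonglongrightarrow> 0"
begin

definition alpha :: "nat \<Rightarrow> complex" where "alpha n = (\<Sum>j<n. vt n j * cnj (v n j))"
definition beta :: "nat \<Rightarrow> complex" where "beta n = (\<Sum>k<n. ut n k * cnj (u n k))"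

lemma singular_average:
  fixes f :: "real \<Rightarrow> real"
  assumes b: "\<And>n. right_singular_basis n (X n) (W n) (S n)"
    and f: "continuous_on UNIV f" and B: "\<And>x. \<bar>f x\<bar> \<le> B"
  shows "(\<lambda>n. (\<Sum>l<n. f (S n l)) / real n) \<longlonglongrightarrow> (\<integral>t. f t \<partial>\<mu>)"
proof -
  \<comment> \<open>The index is shifted because at n = 0 there are no singular values, hence no
    probability measure.\<close>
  have wc: "weak_conv_m (\<lambda>n. singular_value_measure (X (Suc n))) \<mu>"
    using weak unfolding weak_conv_m_def weak_conv_def by (auto intro: LIMSEQ_Suc)
  have rd: "real_distribution (singular_value_measure (X (Suc n)))" for n
    by (rule real_distribution_singular_value_measure[OF X]) simp
  have "(\<lambda>n. \<integral>t. f t \<partial>singular_value_measure (X (Suc n))) \<longlonglongrightarrow> (\<integral>t. f t \<partial>\<mu>)"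
    by (rule weak_conv_imp_integral_bdd_continuous_conv[OF rd _ wc, where B = B])
       (use f B in \<open>auto simp: continuous_on_eq_continuous_at intro: real_distribution_axioms\<close>)
  moreover have "(\<integral>t. f t \<partial>singular_value_measure (X (Suc n))) = (\<Sum>l<Suc n. f (S (Suc n) l)) / real (Suc n)" for n
    by (rule integral_singular_value_measure[OF X b]) (use f in \<open>auto intro: borel_measurable_continuous_onI\<close>)
  ultimately have "(\<lambda>n. (\<Sum>l<Suc n. f (S (Suc n) l)) / real (Suc n)) \<longlonglongrightarrow> (\<integral>t. f t \<partial>\<mu>)" by simp
  then show ?thesis by (rule LIMSEQ_imp_Suc)
qed

text \<open>Since a is in the support of \<mu>, a positive fraction of the singular values of X lies
  below c. For large n there are at least two of them, and \<open>rank_one_interlacing\<close>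
  applies.\<close>

lemma \<sigma>_upper:
  assumes b: "\<And>n. right_singular_basis n (X n) (W n) (S n)" and c: "a < c"
  shows "eventually (\<lambda>n. \<sigma> n \<le> c) sequentially"
proof -
  define c' where "c' = (a + c) / 2"
  have c': "a < c'" "c' < c" using c by (auto simp: c'_def)
  \<comment> \<open>A continuous function between the indicators of t < c' and t <= c, since weak
    convergence is tested on bounded continuous functions.\<close>
  define f where "f = (\<lambda>t. max 0 (min 1 ((c - t) / (c - c'))))"
  have f: "continuous_on UNIV f" unfolding f_def using c' by (intro continuous_intros) auto
  have fb: "0 \<le> f t" "f t \<le> 1" for t by (auto simp: f_def)
  have fpos: "t \<le> c" if "0 < f t" for t
  proof -
    have "0 < (c - t) / (c - c')" using that by (auto simp: f_def max_def min_def split: if_splits)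
    then show ?thesis using c' by (auto simp: zero_less_divide_iff)
  qed
  have fm: "f \<in> borel_measurable borel" by (rule borel_measurable_continuous_onI[OF f])
  have int: "integrable \<mu> f"
    by (rule integrable_const_bound[where B = 1]) (use fm fb in auto)
  have "prob {..<c'} = (\<integral>t. indicator {..<c'} t \<partial>\<mu>)" by simp
  also have "\<dots> \<le> (\<integral>t. f t \<partial>\<mu>)"
  proof (rule integral_mono)
    show "integrable \<mu> (indicat_real {..<c'})"
      by (intro integrable_real_indicator) (auto simp: emeasure_eq_measure)
    show "indicat_real {..<c'} t \<le> f t" for t
      using c' fb(1)[of t] by (auto simp: indicator_def f_def le_divide_eq)
  qed (rule int)
  finally have I: "0 < (\<integral>t. f t \<partial>\<mu>)" using prob_near_a[OF c'(1)] by linarith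
  define I where "I = (\<integral>t. f t \<partial>\<mu>)"
  have "(\<lambda>n. (\<Sum>l<n. f (S n l)) / real n) \<longlonglongrightarrow> I"
    unfolding I_def by (rule singular_average[OF b f, where B = 1]) (use fb in \<open>auto simp: abs_le_iff intro: order_trans[of _ 0]\<close>)
  then have "eventually (\<lambda>n. I / 2 < (\<Sum>l<n. f (S n l)) / real n) sequentially"
    by (rule order_tendstoD) (use I in \<open>simp add: I_def\<close>)
  moreover have "eventually (\<lambda>n. 2 / I < real n) sequentially"
    by (rule eventually_sequentiallyI[of "nat \<lceil>2 / I\<rceil> + 1"]) linarith
  ultimately show ?thesis
  proof eventually_elim
    case (elim n)
    have I0: "0 < I" using I by (simp add: I_def)
    then have n: "0 < real n" using elim(2) by (smt (verit) divide_pos_pos)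
    have "1 < I / 2 * real n" using elim(2) I0 by (simp add: field_simps)
    also have "\<dots> < (\<Sum>l<n. f (S n l))" using elim(1) n by (simp add: field_simps)
    finally have gt: "1 < (\<Sum>l<n. f (S n l))" .
    show ?case
    proof (rule two_indices_of_sum_gt_1[of n "\<lambda>l. f (S n l)"])
      fix l m assume lm: "l < n" "m < n" "l \<noteq> m" "0 < f (S n l)" "0 < f (S n m)"
      show "\<sigma> n \<le> c"
        unfolding \<sigma>_def
      proof (rule rank_one_interlacing[OF X Xt _ b lm(1-3) fpos[OF lm(4)] fpos[OF lm(5)]])
        show "Xt n $$ (i, j) = X n $$ (i, j) + of_real \<theta> * u n i * cnj (v n j)" if "i < n" "j < n" for i j
          by (rule Xt_entry[OF that])
      qed
    qed (use fb gt in auto)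
  qed
qed

text \<open>Compactness: \<sigma>, \<alpha>, \<beta> are eventually bounded, so it suffices that
  every subsequential limit has \<alpha>0 = \<beta>0 = 0. That is \<open>edge_bound\<close> when
  \<sigma> tends to a, and \<open>interior_equation\<close> when the limit is smaller.\<close>

lemma alpha_beta_tendsto_0: "alpha \<longlonglongrightarrow> 0 \<and> beta \<longlonglongrightarrow> 0"
proof -
  have "\<forall>n. \<exists>w s. right_singular_basis n (X n) w s" using right_singular_basis_exists by meson
  then obtain W S where b: "\<And>n. right_singular_basis n (X n) (W n) (S n)" by metis
  \<comment> \<open>\<open>Z n\<close> is meaningful only when all singular values are positive,
    which holds for all large n.\<close>
  have "\<forall>n. \<exists>z. (\<forall>l<n. 0 < S n l) \<longrightarrow> svd n (X n) (W n) z (S n)" using svd_exists[OF b] by blast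
  then obtain Z where Z: "\<And>n. (\<forall>l<n. 0 < S n l) \<Longrightarrow> svd n (X n) (W n) (Z n) (S n)" by metis
  have S_lower: "eventually (\<lambda>n. \<forall>l<n. c < S n l) sequentially" if "c < a" for c
    using order_tendstoD(1)[OF smallest that]
  proof eventually_elim
    case (elim n)
    then show ?case using smallest_singular_value_le[OF X b, of _ n] by (meson less_le_trans)
  qed
  have good: "eventually (\<lambda>n. n \<ge> 1 \<and> svd n (X n) (W n) (Z n) (S n) \<and> det (X n) \<noteq> 0) sequentially"
    using S_lower[OF a_pos] eventually_ge_at_top[of 1]
    by eventually_elim (use Z det_nonzero_iff_singular_values_pos[OF X b] in blast)
  define U where "U = (\<lambda>n. coord n (Z n) (u n))"
  define V where "V = (\<lambda>n. coord n (W n) (v n))"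
  define U' where "U' = (\<lambda>n. coord n (Z n) (ut n))"
  define V' where "V' = (\<lambda>n. coord n (W n) (vt n))"
  have avg: "(\<lambda>n. (\<Sum>l<n. yfun (S n l) ^ k) / real n) \<longlonglongrightarrow> (\<integral>t. yfun t ^ k \<partial>\<mu>)" for k
    by (rule singular_average[OF b, where B = 1])
       (use yfun_bounds in \<open>auto intro!: continuous_intros power_le_one simp: less_imp_le power_abs abs_of_pos\<close>)
  have coord_scale: "coord n w x l = of_real c * coord n w y l" if "\<And>i. i < n \<Longrightarrow> x i = of_real c * y i" for n w x y l and c :: real
    unfolding coord_def sum_distrib_left using that by (intro sum.cong refl) (simp add: mult_ac)
  have Uc: "U n l = of_real (cu n) * coord n (Z n) (g n) l" for n l
    unfolding U_def by (rule coord_scale) (rule u_eq)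
  have Vc: "V n l = of_real (cv n) * coord n (W n) (\<lambda>i. g n (n + i)) l" for n l
    unfolding V_def by (rule coord_scale) (rule v_eq)
  \<comment> \<open>The weighted moment is n c^2 times the sum of the centred form over n, which
    vanishes, and the average of y^k over the singular values, which tends to the moment of
    \<mu>.\<close>
  have mom: "(\<lambda>n. \<Sum>l<n. (cmod (Y n l))\<^sup>2 * yfun (S n l) ^ k) \<longlonglongrightarrow> (\<integral>t. yfun t ^ k \<partial>\<mu>)"
    if Yc: "\<And>n l. Y n l = of_real (c n) * G n l" and c: "(\<lambda>n. real n * (c n)\<^sup>2) \<longlonglongrightarrow> 1"
      and form: "(\<lambda>n. F n / of_nat n) \<longlonglongrightarrow> (0::complex)"
      and F: "eventually (\<lambda>n. F n = of_real ((\<Sum>l<n. yfun (S n l) ^ k * (cmod (G n l))\<^sup>2) - (\<Sum>l<n. yfun (S n l) ^ k))) sequentially"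
    for Y G :: "nat \<Rightarrow> nat \<Rightarrow> complex" and c :: "nat \<Rightarrow> real" and F :: "nat \<Rightarrow> complex" and k
  proof -
    have "(\<lambda>n. real n * (c n)\<^sup>2 * (Re (F n / of_nat n) + (\<Sum>l<n. yfun (S n l) ^ k) / real n)) \<longlonglongrightarrow> 1 * (Re 0 + (\<integral>t. yfun t ^ k \<partial>\<mu>))"
      by (intro tendsto_mult tendsto_add tendsto_Re c form avg)
    then have "(\<lambda>n. real n * (c n)\<^sup>2 * (Re (F n / of_nat n) + (\<Sum>l<n. yfun (S n l) ^ k) / real n)) \<longlonglongrightarrow> (\<integral>t. yfun t ^ k \<partial>\<mu>)" by simp
    then show ?thesis
    proof (rule Lim_transform_eventually)
      show "eventually (\<lambda>n. real n * (c n)\<^sup>2 * (Re (F n / of_nat n) + (\<Sum>l<n. yfun (S n l) ^ k) / real n) = (\<Sum>l<n. (cmod (Y n l))\<^sup>2 * yfun (S n l) ^ k)) sequentially"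
        using F eventually_gt_at_top[of 0]
      proof eventually_elim
        case (elim n)
        have "F n / of_nat n = of_real (((\<Sum>l<n. yfun (S n l) ^ k * (cmod (G n l))\<^sup>2) - (\<Sum>l<n. yfun (S n l) ^ k)) / real n)"
          unfolding elim(1) of_real_divide by simp
        then have "Re (F n / of_nat n) = ((\<Sum>l<n. yfun (S n l) ^ k * (cmod (G n l))\<^sup>2) - (\<Sum>l<n. yfun (S n l) ^ k)) / real n"
          by (simp only: Re_complex_of_real)
        then have "Re (F n / of_nat n) + (\<Sum>l<n. yfun (S n l) ^ k) / real n = (\<Sum>l<n. yfun (S n l) ^ k * (cmod (G n l))\<^sup>2) / real n"
          by (simp add: diff_divide_distrib)
        then have "real n * (c n)\<^sup>2 * (Re (F n / of_nat n) + (\<Sum>l<n. yfun (S n l) ^ k) / real n) = (c n)\<^sup>2 * (\<Sum>l<n. yfun (S n l) ^ k * (cmod (G n l))\<^sup>2)"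
          using elim(2) by simp
        also have "\<dots> = (\<Sum>l<n. (cmod (Y n l))\<^sup>2 * yfun (S n l) ^ k)"
          unfolding sum_distrib_left Yc norm_mult norm_of_real power_mult_distrib power2_abs by (simp add: mult_ac)
        finally show ?case .
      qed
    qed
  qed
  have U_mom: "(\<lambda>n. \<Sum>l<n. (cmod (U n l))\<^sup>2 * yfun (S n l) ^ k) \<longlonglongrightarrow> (\<integral>t. yfun t ^ k \<partial>\<mu>)" for k
    by (rule mom[OF Uc cu uu[of k]], use good in eventually_elim) (use centered_form_uu[OF X] in \<open>unfold yfun_def, blast\<close>)
  have V_mom: "(\<lambda>n. \<Sum>l<n. (cmod (V n l))\<^sup>2 * yfun (S n l) ^ k) \<longlonglongrightarrow> (\<integral>t. yfun t ^ k \<partial>\<mu>)" for k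
    by (rule mom[OF Vc cv vv[of k]], use good in eventually_elim) (use centered_form_vv[OF X] in \<open>unfold yfun_def, blast\<close>)
  have U_norm: "(\<lambda>n. \<Sum>l<n. (cmod (U n l))\<^sup>2) \<longlonglongrightarrow> 1" using U_mom[of 0] prob_space by simp
  have V_norm: "(\<lambda>n. \<Sum>l<n. (cmod (V n l))\<^sup>2) \<longlonglongrightarrow> 1" using V_mom[of 0] prob_space by simp
  have cross: "(\<lambda>n. \<Sum>l<n. V n l * cnj (U n l) * of_real (S n l * yfun (S n l)) * of_real (yfun (S n l) ^ k)) \<longlonglongrightarrow> 0" for k
  proof -
    define F where "F = (\<lambda>n. centered_form (2 * n) (uv_coeff k n (X n)) (g n))"
    \<comment> \<open>Boundedness of n cu cv suffices here, since the form it multiplies tends to 0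
      after division by n.\<close>
    obtain K where cuv: "\<And>n. norm (complex_of_real (real n * (cu n * cv n))) \<le> K"
    proof -
      have "(\<lambda>n. (real n * (cu n)\<^sup>2 + real n * (cv n)\<^sup>2)) \<longlonglongrightarrow> 1 + 1" by (intro tendsto_add cu cv)
      then have "Bseq (\<lambda>n. real n * (cu n)\<^sup>2 + real n * (cv n)\<^sup>2)" by (rule convergent_imp_Bseq[OF convergentI])
      then obtain K where K: "\<And>n. norm (real n * (cu n)\<^sup>2 + real n * (cv n)\<^sup>2) \<le> K" by (auto simp: Bseq_def)
      have "norm (complex_of_real (real n * (cu n * cv n))) \<le> K" for n
      proof -
        have "2 * (\<bar>cu n\<bar> * \<bar>cv n\<bar>) \<le> (cu n)\<^sup>2 + (cv n)\<^sup>2" using sum_squares_bound[of "\<bar>cu n\<bar>" "\<bar>cv n\<bar>"] by simp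
        moreover have "0 \<le> \<bar>cu n\<bar> * \<bar>cv n\<bar>" by simp
        ultimately have "\<bar>cu n\<bar> * \<bar>cv n\<bar> \<le> (cu n)\<^sup>2 + (cv n)\<^sup>2" by linarith
        then have "real n * (\<bar>cu n\<bar> * \<bar>cv n\<bar>) \<le> real n * ((cu n)\<^sup>2 + (cv n)\<^sup>2)" by (intro mult_left_mono) auto
        then show ?thesis using K[of n] by (simp add: norm_mult abs_mult distrib_left)
      qed
      then show ?thesis by (rule that)
    qed
    have "(\<lambda>n. complex_of_real (real n * (cu n * cv n)) * (F n / of_nat n)) \<longlonglongrightarrow> 0"
    proof (rule Lim_null_comparison)
      show "eventually (\<lambda>n. norm (complex_of_real (real n * (cu n * cv n)) * (F n / of_nat n)) \<le> K * norm (F n / of_nat n)) sequentially"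
        unfolding norm_mult[of "complex_of_real _"] by (intro always_eventually allI mult_right_mono cuv norm_ge_zero)
      show "(\<lambda>n. K * norm (F n / of_nat n)) \<longlonglongrightarrow> 0"
        using uv[of k] unfolding F_def by (intro tendsto_mult_right_zero tendsto_norm_zero)
    qed
    then show ?thesis
    proof (rule Lim_transform_eventually)
      show "eventually (\<lambda>n. complex_of_real (real n * (cu n * cv n)) * (F n / of_nat n) = (\<Sum>l<n. V n l * cnj (U n l) * of_real (S n l * yfun (S n l)) * of_real (yfun (S n l) ^ k))) sequentially"
        using good
      proof eventually_elim
        case (elim n)
        have "F n = (\<Sum>l<n. of_real (yfun (S n l) ^ Suc k * S n l) * coord n (W n) (\<lambda>i. g n (n + i)) l * cnj (coord n (Z n) (g n) l))"
          unfolding F_def yfun_def using elim by (intro centered_form_uv[OF X]) auto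
        moreover have "complex_of_real (real n * (cu n * cv n)) * (F n / of_nat n) = of_real (cu n * cv n) * F n"
          using elim by simp
        ultimately show ?case
          by (simp add: sum_distrib_left Uc Vc mult_ac)
      qed
    qed
  qed
  \<comment> \<open>The two singular vector equations projected on the singular bases of X: the rank
    one term contributes only through the overlap with v or with u.\<close>
  have E1: "of_real (S n l) * V' n l + of_real \<theta> * alpha n * U n l = of_real (\<sigma> n) * U' n l"
    and E2: "of_real (S n l) * U' n l + of_real \<theta> * beta n * V n l = of_real (\<sigma> n) * V' n l"
    if d: "svd n (X n) (W n) (Z n) (S n)" and n: "n \<ge> 1" and l: "l < n" for n l
  proof -
    have "of_real (\<sigma> n) * U' n l = (\<Sum>k<n. (\<Sum>j<n. Xt n $$ (k, j) * vt n j) * cnj (Z n l k))"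
      unfolding U'_def coord_def sum_distrib_left using right_eq[OF n] by (intro sum.cong refl) (simp add: mult.assoc)
    also have "\<dots> = (\<Sum>k<n. (\<Sum>j<n. X n $$ (k, j) * vt n j) * cnj (Z n l k) + of_real \<theta> * alpha n * (u n k * cnj (Z n l k)))"
    proof (intro sum.cong refl)
      fix k assume "k \<in> {..<n}"
      then have "(\<Sum>j<n. Xt n $$ (k, j) * vt n j) = (\<Sum>j<n. X n $$ (k, j) * vt n j) + of_real \<theta> * u n k * alpha n"
        by (simp add: Xt_entry alpha_def algebra_simps sum.distrib sum_distrib_left)
      then show "(\<Sum>j<n. Xt n $$ (k, j) * vt n j) * cnj (Z n l k) = (\<Sum>j<n. X n $$ (k, j) * vt n j) * cnj (Z n l k) + of_real \<theta> * alpha n * (u n k * cnj (Z n l k))"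
        by (simp add: algebra_simps)
    qed
    also have "\<dots> = (\<Sum>k<n. (\<Sum>j<n. X n $$ (k, j) * vt n j) * cnj (Z n l k)) + of_real \<theta> * alpha n * U n l"
      by (simp only: sum.distrib sum_distrib_left U_def coord_def)
    also have "(\<Sum>k<n. (\<Sum>j<n. X n $$ (k, j) * vt n j) * cnj (Z n l k)) = (\<Sum>j<n. vt n j * cnj (\<Sum>k<n. cnj (X n $$ (k, j)) * Z n l k))"
      unfolding sum_distrib_right by (subst sum.swap) (simp add: sum_distrib_left mult_ac)
    also have "\<dots> = of_real (S n l) * V' n l"
      unfolding V'_def coord_def sum_distrib_left using d l by (intro sum.cong refl) (simp add: svd_def mult_ac)
    finally show "of_real (S n l) * V' n l + of_real \<theta> * alpha n * U n l = of_real (\<sigma> n) * U' n l" by simp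
    have "of_real (\<sigma> n) * V' n l = (\<Sum>i<n. (\<Sum>k<n. cnj (Xt n $$ (k, i)) * ut n k) * cnj (W n l i))"
      unfolding V'_def coord_def sum_distrib_left using left_eq[OF n] by (intro sum.cong refl) (simp add: mult.assoc)
    also have "\<dots> = (\<Sum>i<n. (\<Sum>k<n. cnj (X n $$ (k, i)) * ut n k) * cnj (W n l i) + of_real \<theta> * beta n * (v n i * cnj (W n l i)))"
    proof (intro sum.cong refl)
      fix i assume "i \<in> {..<n}"
      then have "(\<Sum>k<n. cnj (Xt n $$ (k, i)) * ut n k) = (\<Sum>k<n. cnj (X n $$ (k, i)) * ut n k) + of_real \<theta> * v n i * beta n"
        by (simp add: Xt_entry beta_def algebra_simps sum.distrib sum_distrib_left)
      then show "(\<Sum>k<n. cnj (Xt n $$ (k, i)) * ut n k) * cnj (W n l i) = (\<Sum>k<n. cnj (X n $$ (k, i)) * ut n k) * cnj (W n l i) + of_real \<theta> * beta n * (v n i * cnj (W n l i))"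
        by (simp add: algebra_simps)
    qed
    also have "\<dots> = (\<Sum>i<n. (\<Sum>k<n. cnj (X n $$ (k, i)) * ut n k) * cnj (W n l i)) + of_real \<theta> * beta n * V n l"
      by (simp only: sum.distrib sum_distrib_left V_def coord_def)
    also have "(\<Sum>i<n. (\<Sum>k<n. cnj (X n $$ (k, i)) * ut n k) * cnj (W n l i)) = (\<Sum>k<n. ut n k * cnj (\<Sum>i<n. X n $$ (k, i) * W n l i))"
      unfolding sum_distrib_right by (subst sum.swap) (simp add: sum_distrib_left mult_ac)
    also have "\<dots> = of_real (S n l) * U' n l"
      unfolding U'_def coord_def sum_distrib_left using d l by (intro sum.cong refl) (simp add: svd_def mult_ac)
    finally show "of_real (S n l) * U' n l + of_real \<theta> * beta n * V n l = of_real (\<sigma> n) * V' n l" by simp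
  qed
  \<comment> \<open>Multiplying either equation by \<sigma> and inserting the other eliminates one
    of U', V' and leaves the factor \<sigma>^2 - s^2.\<close>
  have eqs: "eventually (\<lambda>n. (\<forall>l<n. of_real ((\<sigma> n)\<^sup>2 - (S n l)\<^sup>2) * U' n l = of_real \<theta> * (alpha n * of_real (\<sigma> n) * U n l + beta n * of_real (S n l) * V n l)) \<and>
      (\<forall>l<n. of_real ((\<sigma> n)\<^sup>2 - (S n l)\<^sup>2) * V' n l = of_real \<theta> * (beta n * of_real (\<sigma> n) * V n l + alpha n * of_real (S n l) * U n l))) sequentially"
    using good
  proof eventually_elim
    case (elim n)
    show ?case
    proof (intro conjI allI impI)
      fix l assume l: "l < n"
      note e1 = E1[OF _ _ l, symmetric] and e2 = E2[OF _ _ l, symmetric]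
      have a1: "of_real (\<sigma> n) * U' n l = of_real (S n l) * V' n l + of_real \<theta> * alpha n * U n l"
        and a2: "of_real (\<sigma> n) * V' n l = of_real (S n l) * U' n l + of_real \<theta> * beta n * V n l"
        using e1 e2 elim by auto
      have "of_real ((\<sigma> n)\<^sup>2 - (S n l)\<^sup>2) * U' n l = of_real (\<sigma> n) * (of_real (\<sigma> n) * U' n l) - of_real (S n l) * of_real (S n l) * U' n l"
        by (simp add: power2_eq_square algebra_simps)
      also have "\<dots> = of_real (S n l) * (of_real (\<sigma> n) * V' n l) + of_real (\<sigma> n) * (of_real \<theta> * alpha n * U n l) - of_real (S n l) * of_real (S n l) * U' n l"
        unfolding a1 by (simp add: algebra_simps)
      also have "\<dots> = of_real \<theta> * (alpha n * of_real (\<sigma> n) * U n l + beta n * of_real (S n l) * V n l)"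
        unfolding a2 by (simp add: algebra_simps)
      finally show "of_real ((\<sigma> n)\<^sup>2 - (S n l)\<^sup>2) * U' n l = of_real \<theta> * (alpha n * of_real (\<sigma> n) * U n l + beta n * of_real (S n l) * V n l)" .
      have "of_real ((\<sigma> n)\<^sup>2 - (S n l)\<^sup>2) * V' n l = of_real (\<sigma> n) * (of_real (\<sigma> n) * V' n l) - of_real (S n l) * of_real (S n l) * V' n l"
        by (simp add: power2_eq_square algebra_simps)
      also have "\<dots> = of_real (S n l) * (of_real (\<sigma> n) * U' n l) + of_real (\<sigma> n) * (of_real \<theta> * beta n * V n l) - of_real (S n l) * of_real (S n l) * V' n l"
        unfolding a2 by (simp add: algebra_simps)
      also have "\<dots> = of_real \<theta> * (beta n * of_real (\<sigma> n) * V n l + alpha n * of_real (S n l) * U n l)"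
        unfolding a1 by (simp add: algebra_simps)
      finally show "of_real ((\<sigma> n)\<^sup>2 - (S n l)\<^sup>2) * V' n l = of_real \<theta> * (beta n * of_real (\<sigma> n) * V n l + alpha n * of_real (S n l) * U n l)" .
    qed
  qed
  have norms: "eventually (\<lambda>n. (\<Sum>l<n. (cmod (U' n l))\<^sup>2) = 1 \<and> (\<Sum>l<n. (cmod (V' n l))\<^sup>2) = 1) sequentially"
    using good by eventually_elim (simp add: U'_def V'_def svd_def coord_norm ut_norm vt_norm)
  have ab: "eventually (\<lambda>n. beta n = (\<Sum>l<n. U' n l * cnj (U n l)) \<and> alpha n = (\<Sum>l<n. V' n l * cnj (V n l))) sequentially"
    using good by eventually_elim (simp add: U_def V_def U'_def V'_def svd_def coord_parseval alpha_def beta_def)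
  \<comment> \<open>The heart of the argument, on a subsequence where \<sigma>, \<alpha> and \<beta>
    converge.\<close>
  have limit0: "\<alpha>0 = 0 \<and> \<beta>0 = 0"
    if r: "strict_mono r" and lim: "(\<sigma> \<circ> r) \<longlonglongrightarrow> b" "(alpha \<circ> r) \<longlonglongrightarrow> \<alpha>0" "(beta \<circ> r) \<longlonglongrightarrow> \<beta>0" for r b \<alpha>0 \<beta>0
  proof -
    note sub = eventually_subseq[OF r]
    have sl: "(\<lambda>n. f (r n)) \<longlonglongrightarrow> L" if "f \<longlonglongrightarrow> L" for f :: "nat \<Rightarrow> 'x::topological_space" and L
      using LIMSEQ_subseq_LIMSEQ[OF that r] by (simp add: o_def)
    have b0: "0 \<le> b"
    proof (rule tendsto_lowerbound[OF lim(1)])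
      show "eventually (\<lambda>n. 0 \<le> (\<sigma> \<circ> r) n) sequentially"
        using sub[OF eventually_gt_at_top[of 0]]
        by eventually_elim (simp add: \<sigma>_def smallest_singular_value_nonneg[OF Xt])
    qed simp
    have ba: "b \<le> a"
    proof (rule ccontr)
      assume "\<not> b \<le> a"
      then have c: "a < (a + b) / 2" "(a + b) / 2 < b" by auto
      have "b \<le> (a + b) / 2"
        by (rule tendsto_upperbound[OF lim(1)]) (use sub[OF \<sigma>_upper[OF b c(1)]] in \<open>auto simp: o_def\<close>)
      then show False using c by simp
    qed
    have rd: "real_distribution \<mu>" by (rule real_distribution_axioms)
    \<comment> \<open>Complex conjugation exchanges the roles of U and V in the cross
      moments.\<close>
    have cross': "(\<lambda>n. \<Sum>l<n. U n l * cnj (V n l) * of_real (S n l * yfun (S n l)) * of_real (yfun (S n l) ^ k)) \<longlonglongrightarrow> 0" for k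
      using tendsto_cnj[OF cross[of k]] by (simp add: mult_ac)
    \<comment> \<open>The first interpretation is for left vectors; the second exchanges U with V
      and \<alpha> with \<beta>.\<close>
    interpret eu: edge_limit \<mu> r "\<lambda>n. S (r n)" "\<lambda>n. U (r n)" "\<lambda>n. V (r n)" "\<lambda>n. U' (r n)" "\<sigma> \<circ> r" "alpha \<circ> r" "beta \<circ> r" \<theta> a b \<alpha>0 \<beta>0
      by (unfold_locales; (rule rd \<theta> a_pos AE_ge_a lim sl[OF U_mom] sl[OF V_norm] sl[OF cross])?)
         (use sub[OF eqs] sub[OF norms] sub[OF ab] sub[OF S_lower] in \<open>auto simp: o_def elim: eventually_mono\<close>)
    interpret ev: edge_limit \<mu> r "\<lambda>n. S (r n)" "\<lambda>n. V (r n)" "\<lambda>n. U (r n)" "\<lambda>n. V' (r n)" "\<sigma> \<circ> r" "beta \<circ> r" "alpha \<circ> r" \<theta> a b \<beta>0 \<alpha>0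
      by (unfold_locales; (rule rd \<theta> a_pos AE_ge_a lim sl[OF V_mom] sl[OF U_norm] sl[OF cross'])?)
         (use sub[OF eqs] sub[OF norms] sub[OF ab] sub[OF S_lower] in \<open>auto simp: o_def elim: eventually_mono\<close>)
    show ?thesis
    proof (cases "b = a")
      case True
      \<comment> \<open>A nonzero x would bound all edge integrals by 2 / (\<theta>^2 a^2 |x|^2),
        against their unboundedness.\<close>
      have z: "x = 0" if "\<And>\<eta>. \<eta> > 0 \<Longrightarrow> a\<^sup>2 * (cmod x)\<^sup>2 * edge_integral \<eta> \<le> 2 / \<theta>\<^sup>2" for x
      proof (rule ccontr)
        assume "x \<noteq> 0"
        then have p: "0 < a\<^sup>2 * (cmod x)\<^sup>2" using a_pos by simp
        obtain \<eta> where \<eta>: "\<eta> > 0" "2 / \<theta>\<^sup>2 / (a\<^sup>2 * (cmod x)\<^sup>2) < edge_integral \<eta>"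
          using edge_integral_unbounded[OF phi_deriv] by blast
        then have "2 / \<theta>\<^sup>2 < edge_integral \<eta> * (a\<^sup>2 * (cmod x)\<^sup>2)" unfolding pos_divide_less_eq[OF p] by simp
        then have "2 / \<theta>\<^sup>2 < a\<^sup>2 * (cmod x)\<^sup>2 * edge_integral \<eta>" by (simp only: mult.commute)
        then show False using that[OF \<eta>(1)] by simp
      qed
      show ?thesis
        using z[of \<alpha>0] z[of \<beta>0] eu.edge_bound[OF True] ev.edge_bound[OF True] unfolding edge_integral_def by blast
    next
      case False
      then have "b < a" using ba by simp
      define \<kappa> where "\<kappa> = \<theta> * phi \<mu> b"
      have \<kappa>: "\<bar>\<kappa>\<bar> < 1" unfolding \<kappa>_def by (rule subthreshold[OF \<theta> \<theta>_le b0 \<open>b < a\<close>])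
      \<comment> \<open>Composing the two equations gives \<alpha>0 = \<kappa>^2 \<alpha>0 with
        |\<kappa>| < 1.\<close>
      have e: "\<beta>0 = of_real \<kappa> * \<alpha>0" "\<alpha>0 = of_real \<kappa> * \<beta>0"
        using eu.interior_equation[OF b0 \<open>b < a\<close>] ev.interior_equation[OF b0 \<open>b < a\<close>] by (auto simp: \<kappa>_def)
      have "cmod \<alpha>0 = \<bar>\<kappa>\<bar> * (\<bar>\<kappa>\<bar> * cmod \<alpha>0)"
        using arg_cong[OF e(2), of cmod] arg_cong[OF e(1), of cmod] by (simp add: norm_mult)
      moreover have "\<bar>\<kappa>\<bar> * \<bar>\<kappa>\<bar> < 1" using mult_strict_mono[OF \<kappa> \<kappa>] by simp
      ultimately have "cmod \<alpha>0 = 0"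
        by (metis mult.assoc mult_cancel_right1 order_less_irrefl)
      then show ?thesis using e(1) by simp
    qed
  qed
  define f where "f = (\<lambda>n. cmod (alpha n) + cmod (beta n))"
  have bd: "eventually (\<lambda>n. 0 \<le> \<sigma> n \<and> \<sigma> n \<le> a + 1 \<and> cmod (alpha n) \<le> 2 \<and> cmod (beta n) \<le> 2) sequentially"
    using ab norms \<sigma>_upper[OF b, of "a + 1", simplified] order_tendstoD(2)[OF U_norm, of 2, simplified] order_tendstoD(2)[OF V_norm, of 2, simplified] eventually_gt_at_top[of 0]
  proof eventually_elim
    case (elim n)
    have cs: "cmod (\<Sum>l<n. p l * cnj (q l)) \<le> 2" if "(\<Sum>l<n. (cmod (p l))\<^sup>2) = 1" "(\<Sum>l<n. (cmod (q l))\<^sup>2) < 2" for p q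
    proof -
      have "cmod (\<Sum>l<n. p l * cnj (q l)) \<le> (\<Sum>l<n. ((cmod (p l))\<^sup>2 + (cmod (q l))\<^sup>2) / 2)"
      proof (rule sum_norm_le)
        fix l
        show "cmod (p l * cnj (q l)) \<le> ((cmod (p l))\<^sup>2 + (cmod (q l))\<^sup>2) / 2"
          using sum_squares_bound[of "cmod (p l)" "cmod (q l)"] by (simp add: norm_mult)
      qed
      also have "\<dots> = ((\<Sum>l<n. (cmod (p l))\<^sup>2) + (\<Sum>l<n. (cmod (q l))\<^sup>2)) / 2"
        by (simp add: sum.distrib sum_divide_distrib[symmetric])
      finally show ?thesis using that by simp
    qed
    show ?case
      using elim cs[of "U' n" "U n"] cs[of "V' n" "V n"]
      by (auto simp: \<sigma>_def smallest_singular_value_nonneg[OF Xt])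
  qed
  have "f \<longlonglongrightarrow> 0"
  proof (rule ccontr)
    assume "\<not> f \<longlonglongrightarrow> 0"
    then obtain e where e: "e > 0" "\<not> eventually (\<lambda>n. dist (f n) 0 < e) sequentially"
      unfolding tendsto_iff by blast
    \<comment> \<open>The bounds hold only eventually, so the bad indices are selected among those
      that satisfy \<open>P\<close>; then the whole subsequence stays in a compact set.\<close>
    define P where "P = (\<lambda>n. 0 \<le> \<sigma> n \<and> \<sigma> n \<le> a + 1 \<and> cmod (alpha n) \<le> 2 \<and> cmod (beta n) \<le> 2)"
    have "\<not> eventually (\<lambda>n. dist (f n) 0 < e \<or> \<not> P n) sequentially"
    proof
      assume "eventually (\<lambda>n. dist (f n) 0 < e \<or> \<not> P n) sequentially"
      then have "eventually (\<lambda>n. dist (f n) 0 < e) sequentially"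
        using bd by eventually_elim (auto simp: P_def)
      then show False using e(2) by simp
    qed
    from not_eventually_sequentiallyD[OF this]
    obtain r :: "nat \<Rightarrow> nat" where r: "strict_mono r" "\<forall>n. \<not> (dist (f (r n)) 0 < e \<or> \<not> P (r n))" by blast
    define t where "t = (\<lambda>n. (\<sigma> (r n), alpha (r n), beta (r n)))"
    have "range t \<subseteq> {0..a + 1} \<times> (cball 0 2 \<times> cball 0 2)"
      using r(2) by (auto simp: t_def P_def)
    moreover have "bounded ({0..a + 1} \<times> (cball 0 2 \<times> cball (0::complex) 2))" for dummy :: complex
      by (intro bounded_Times bounded_cball bounded_closed_interval)
    ultimately have "bounded (range t)" by (rule bounded_subset[rotated]) 
    from bounded_imp_convergent_subsequence[OF this]
    obtain L and q :: "nat \<Rightarrow> nat" where q: "strict_mono q" "(t \<circ> q) \<longlonglongrightarrow> L" by blast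
    have rq: "strict_mono (r \<circ> q)" by (rule strict_mono_o[OF r(1) q(1)])
    have l1: "(\<sigma> \<circ> (r \<circ> q)) \<longlonglongrightarrow> fst L" using tendsto_fst[OF q(2)] by (simp add: t_def o_def)
    have l2: "(alpha \<circ> (r \<circ> q)) \<longlonglongrightarrow> fst (snd L)" using tendsto_fst[OF tendsto_snd[OF q(2)]] by (simp add: t_def o_def)
    have l3: "(beta \<circ> (r \<circ> q)) \<longlonglongrightarrow> snd (snd L)" using tendsto_snd[OF tendsto_snd[OF q(2)]] by (simp add: t_def o_def)
    have "fst (snd L) = 0" "snd (snd L) = 0" using limit0[OF rq l1 l2 l3] by auto
    then have "(\<lambda>n. f (r (q n))) \<longlonglongrightarrow> 0"
      using tendsto_add[OF tendsto_norm[OF l2] tendsto_norm[OF l3]] by (simp add: f_def o_def)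
    then have "eventually (\<lambda>n. dist (f (r (q n))) 0 < e) sequentially" using e(1) by (rule tendstoD)
    then have "eventually (\<lambda>n. False) sequentially" by eventually_elim (use r(2) in blast)
    then show False by simp
  qed
  then have "(\<lambda>n. cmod (alpha n)) \<longlonglongrightarrow> 0" "(\<lambda>n. cmod (beta n)) \<longlonglongrightarrow> 0"
    by (auto intro: tendsto_0_le[where K = 1] simp: f_def)
  then show ?thesis by (simp add: tendsto_norm_zero_iff)
qed

end

section \<open>Projection onto the kernel for a rank one perturbation\<close>

lemma conjugate_of_real [simp]: "conjugate (of_real r :: 'k::real_or_complex) = of_real r"
proof (cases "r = 0")
  case False
  have "of_real r * conjugate (of_real r :: 'k) = of_real r * of_real r"
    using mult_conjugate_eq[of "of_real r :: 'k"] by (simp add: scaleR_conv_of_real power2_eq_square)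
  then show ?thesis using False by simp
qed simp

lemma conjugate_scalar_prod_self: "x \<bullet>c x = of_real ((l2_norm (x :: 'k::real_or_complex vec))\<^sup>2)"
proof -
  have "x \<bullet>c x = (\<Sum>i<dim_vec x. of_real ((norm (x $ i))\<^sup>2))"
    by (simp add: scalar_prod_def atLeast0LessThan mult_conjugate_eq scaleR_conv_of_real del: of_real_power)
  then show ?thesis by (simp add: l2_norm_def sum_nonneg del: of_real_power)
qed

lemma l2_norm_nonneg [simp]: "0 \<le> l2_norm x"
  by (simp add: l2_norm_def sum_nonneg)

lemma l2_norm_smult: "l2_norm (c \<cdot>\<^sub>v x) = norm c * l2_norm (x :: 'k::real_normed_field vec)"
  by (simp add: l2_norm_def norm_mult power_mult_distrib real_sqrt_mult flip: sum_distrib_left)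

lemma l2_norm_eq_0: "x \<in> carrier_vec n \<Longrightarrow> l2_norm x = 0 \<longleftrightarrow> x = 0\<^sub>v n"
  by (auto simp: l2_norm_def sum_nonneg_eq_0_iff intro!: eq_vecI)

lemma outer_carrier [simp]: "u \<in> carrier_vec n \<Longrightarrow> v \<in> carrier_vec m \<Longrightarrow> outer u v \<in> carrier_mat n m"
  by (auto simp: outer_def)

lemma mat_adjoint_smult_outer:
  "mat_adjoint (of_real r \<cdot>\<^sub>m outer u v) = of_real r \<cdot>\<^sub>m outer v (u :: 'k::real_or_complex vec)"
  by (rule eq_matI) (auto simp: mat_adjoint_def mat_of_rows_def outer_def conjugate_dist_mul)

lemma outer_mult_vec:
  fixes u v y :: "'k::real_or_complex vec"
  assumes "y \<in> carrier_vec (dim_vec v)"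
  shows "(c \<cdot>\<^sub>m outer u v) *\<^sub>v y = (c * (y \<bullet>c v)) \<cdot>\<^sub>v u"
  using assms by (intro eq_vecI) (auto simp: outer_def scalar_prod_def sum_distrib_left sum_distrib_right mult_ac)

text \<open>Q Q^* w = \<theta>^2 |v|^2 <w, u> u, so the kernel equation, divided by \<theta>^2, says
  that w is this particular multiple of u.\<close>

lemma rank_one_kernel:
  fixes u v :: "'k::real_or_complex vec"
  assumes u: "u \<in> carrier_vec n" and v: "v \<in> carrier_vec n" and \<theta>: "\<theta> > 0"
  defines "Q \<equiv> of_real \<theta> \<cdot>\<^sub>m outer u v"
  shows "w \<in> mat_kernel (of_real (\<theta>\<^sup>2) \<cdot>\<^sub>m 1\<^sub>m n - Q * mat_adjoint Q) \<longleftrightarrow>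
    w \<in> carrier_vec n \<and> w = ((w \<bullet>c u) * of_real ((l2_norm v)\<^sup>2)) \<cdot>\<^sub>v u"
proof -
  have Q: "Q \<in> carrier_mat n n" and Qa: "mat_adjoint Q \<in> carrier_mat n n"
    and Qe: "mat_adjoint Q = of_real \<theta> \<cdot>\<^sub>m outer v u"
    using u v by (auto simp: Q_def mat_adjoint_smult_outer)
  have e: "(of_real (\<theta>\<^sup>2) \<cdot>\<^sub>m 1\<^sub>m n - Q * mat_adjoint Q) *\<^sub>v w
      = of_real (\<theta>\<^sup>2) \<cdot>\<^sub>v (w - ((w \<bullet>c u) * of_real ((l2_norm v)\<^sup>2)) \<cdot>\<^sub>v u)" if w: "w \<in> carrier_vec n" for w
  proof -
    have "(Q * mat_adjoint Q) *\<^sub>v w = Q *\<^sub>v (mat_adjoint Q *\<^sub>v w)"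
      by (rule assoc_mult_mat_vec[OF Q Qa w])
    also have "mat_adjoint Q *\<^sub>v w = (of_real \<theta> * (w \<bullet>c u)) \<cdot>\<^sub>v v"
      unfolding Qe by (rule outer_mult_vec) (use w u in auto)
    also have "Q *\<^sub>v \<dots> = (of_real \<theta> * (((of_real \<theta> * (w \<bullet>c u)) \<cdot>\<^sub>v v) \<bullet>c v)) \<cdot>\<^sub>v u"
      unfolding Q_def by (rule outer_mult_vec) (use v in auto)
    also have "\<dots> = (of_real (\<theta>\<^sup>2) * ((w \<bullet>c u) * of_real ((l2_norm v)\<^sup>2))) \<cdot>\<^sub>v u"
      using v by (simp add: conjugate_scalar_prod_self power2_eq_square mult_ac)
    finally have f: "(Q * mat_adjoint Q) *\<^sub>v w = (of_real (\<theta>\<^sup>2) * ((w \<bullet>c u) * of_real ((l2_norm v)\<^sup>2))) \<cdot>\<^sub>v u" .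
    have "(of_real (\<theta>\<^sup>2) \<cdot>\<^sub>m 1\<^sub>m n - Q * mat_adjoint Q) *\<^sub>v w
        = (of_real (\<theta>\<^sup>2) \<cdot>\<^sub>m 1\<^sub>m n) *\<^sub>v w - (Q * mat_adjoint Q) *\<^sub>v w"
      using Q Qa w by (intro minus_mult_distrib_mat_vec) auto
    also have "(of_real (\<theta>\<^sup>2) \<cdot>\<^sub>m 1\<^sub>m n) *\<^sub>v w = of_real (\<theta>\<^sup>2) \<cdot>\<^sub>v w"
    proof (rule eq_vecI)
      fix i assume "i < dim_vec (of_real (\<theta>\<^sup>2) \<cdot>\<^sub>v w)"
      then have i: "i < n" using w by simp
      have "((of_real (\<theta>\<^sup>2) \<cdot>\<^sub>m 1\<^sub>m n) *\<^sub>v w) $ i = (\<Sum>j = 0..<n. of_real (\<theta>\<^sup>2) * (if j = i then 1 else 0) * w $ j)"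
        using w i by (simp add: scalar_prod_def)
      also have "\<dots> = (\<Sum>j = 0..<n. if j = i then of_real (\<theta>\<^sup>2) * w $ j else 0)"
        by (intro sum.cong) auto
      also have "\<dots> = (of_real (\<theta>\<^sup>2) \<cdot>\<^sub>v w) $ i" using w i by simp
      finally show "((of_real (\<theta>\<^sup>2) \<cdot>\<^sub>m 1\<^sub>m n) *\<^sub>v w) $ i = (of_real (\<theta>\<^sup>2) \<cdot>\<^sub>v w) $ i" .
    qed (use w in simp)
    finally show ?thesis unfolding f using w u by (intro eq_vecI) (auto simp: algebra_simps)
  qed
  have z: "of_real (\<theta>\<^sup>2) \<cdot>\<^sub>v (w - y) = 0\<^sub>v n \<longleftrightarrow> w = y" if "w \<in> carrier_vec n" "y \<in> carrier_vec n" for w y :: "'k vec"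
    using that \<theta> by (auto simp: vec_eq_iff)
  have c: "(of_real (\<theta>\<^sup>2) \<cdot>\<^sub>m 1\<^sub>m n - Q * mat_adjoint Q) \<in> carrier_mat n n" using Q Qa by auto
  let ?y = "((w \<bullet>c u) * of_real ((l2_norm v)\<^sup>2)) \<cdot>\<^sub>v u"
  have y: "?y \<in> carrier_vec n" using u by simp
  have "w \<in> mat_kernel (of_real (\<theta>\<^sup>2) \<cdot>\<^sub>m 1\<^sub>m n - Q * mat_adjoint Q) \<longleftrightarrow>
      w \<in> carrier_vec n \<and> (of_real (\<theta>\<^sup>2) \<cdot>\<^sub>m 1\<^sub>m n - Q * mat_adjoint Q) *\<^sub>v w = 0\<^sub>v n"
    unfolding mat_kernel[OF c] by (rule mem_Collect_eq)
  also have "\<dots> \<longleftrightarrow> w \<in> carrier_vec n \<and> w = ?y"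
    by (rule conj_cong[OF refl]) (simp only: e z[OF _ y])
  finally show ?thesis .
qed

text \<open>Two candidates differ by a vector of F that is orthogonal to F, hence to itself. Closure
  under differences is all the linear structure used.\<close>

lemma orth_proj_eqI:
  fixes x :: "'k::real_or_complex vec"
  assumes F: "F \<subseteq> carrier_vec n" "\<And>y w. y \<in> F \<Longrightarrow> w \<in> F \<Longrightarrow> y - w \<in> F"
    and x: "x \<in> carrier_vec n" and p: "p \<in> F" "\<And>w. w \<in> F \<Longrightarrow> (x - p) \<bullet>c w = 0"
  shows "orth_proj F x = p"
  unfolding orth_proj_def
proof (rule the_equality)
  fix q assume q: "q \<in> F \<and> (\<forall>w\<in>F. (x - q) \<bullet>c w = 0)"
  have c: "p \<in> carrier_vec n" "q \<in> carrier_vec n" using p q F by auto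
  have d: "q - p \<in> F" using F q p by auto
  have "q - p = (x - p) - (x - q)" using c x by (intro eq_vecI) auto
  then have "(q - p) \<bullet>c (q - p) = ((x - p) - (x - q)) \<bullet>c (q - p)" by simp
  also have "\<dots> = (x - p) \<bullet>c (q - p) - (x - q) \<bullet>c (q - p)"
    using c x by (intro minus_scalar_prod_distrib[of _ n]) auto
  also have "\<dots> = 0" using p(2)[OF d] q d by simp
  finally have "l2_norm (q - p) = 0" by (simp add: conjugate_scalar_prod_self)
  then have "q - p = 0\<^sub>v n" using l2_norm_eq_0[of "q - p" n] c by auto
  then show "q = p" using c by (auto simp: vec_eq_iff)
qed (use p in auto)

text \<open>The kernel is the line through \<open>u\<close> if \<open>u\<close> and \<open>v\<close> are unit vectors, and it is
  usually \<open>{0}\<close> in the i.i.d. model.\<close>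

lemma proj_norm_rank_one_kernel_le:
  fixes u v :: "'k::real_or_complex vec"
  assumes u: "u \<in> carrier_vec n" and v: "v \<in> carrier_vec n" and \<theta>: "\<theta> > 0" and x: "x \<in> carrier_vec n"
  defines "Q \<equiv> of_real \<theta> \<cdot>\<^sub>m outer u v"
  shows "proj_norm x (mat_kernel (of_real (\<theta>\<^sup>2) \<cdot>\<^sub>m 1\<^sub>m n - Q * mat_adjoint Q)) \<le> norm (x \<bullet>c u) / l2_norm u"
proof -
  define F where "F = mat_kernel (of_real (\<theta>\<^sup>2) \<cdot>\<^sub>m 1\<^sub>m n - Q * mat_adjoint Q)"
  note F_iff = rank_one_kernel[OF u v \<theta>, folded Q_def, folded F_def]
  have F_line: "\<exists>c. w = c \<cdot>\<^sub>v u" if "w \<in> F" for w using F_iff[of w] that by blast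
  have sub: "F \<subseteq> carrier_vec n" using F_iff by blast
  show ?thesis
  proof (cases "u \<in> F \<and> u \<noteq> 0\<^sub>v n")
    \<comment> \<open>Here the kernel is the whole line through u, and the projection is given by
      the usual coefficient <x, u>/<u, u>.\<close>
    case True
    then have e: "u = ((u \<bullet>c u) * of_real ((l2_norm v)\<^sup>2)) \<cdot>\<^sub>v u" using F_iff by blast
    have smult: "c \<cdot>\<^sub>v u \<in> F" for c
    proof -
      have "((c \<cdot>\<^sub>v u) \<bullet>c u * of_real ((l2_norm v)\<^sup>2)) \<cdot>\<^sub>v u
          = c \<cdot>\<^sub>v (((u \<bullet>c u) * of_real ((l2_norm v)\<^sup>2)) \<cdot>\<^sub>v u)"
        using u by (simp add: smult_smult_assoc mult.assoc)
      also have "\<dots> = c \<cdot>\<^sub>v u" by (rule arg_cong[where f = "\<lambda>y. c \<cdot>\<^sub>v y", OF e[symmetric]])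
      finally have eq: "c \<cdot>\<^sub>v u = ((c \<cdot>\<^sub>v u) \<bullet>c u * of_real ((l2_norm v)\<^sup>2)) \<cdot>\<^sub>v u" by (rule sym)
      have "c \<cdot>\<^sub>v u \<in> carrier_vec n" using u by simp
      then show ?thesis using eq by (rule F_iff[THEN iffD2, OF conjI])
    qed
    have nz: "l2_norm u \<noteq> 0" using True l2_norm_eq_0[OF u] by simp
    define c where "c = (x \<bullet>c u) / (u \<bullet>c u)"
    have "orth_proj F x = c \<cdot>\<^sub>v u"
    proof (rule orth_proj_eqI[OF sub _ x smult])
      fix y w assume y: "y \<in> F" and w: "w \<in> F"
      from F_line[OF y] obtain b where b: "y = b \<cdot>\<^sub>v u" ..
      from F_line[OF w] obtain d where d: "w = d \<cdot>\<^sub>v u" ..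
      have "y - w = (b - d) \<cdot>\<^sub>v u" unfolding b d using u by (intro eq_vecI) (auto simp: left_diff_distrib)
      then show "y - w \<in> F" by (simp only: smult)
    next
      fix w assume "w \<in> F"
      from F_line[OF this] obtain d where w: "w = d \<cdot>\<^sub>v u" ..
      have "(x - c \<cdot>\<^sub>v u) \<bullet>c u = (x \<bullet>c u) - c * (u \<bullet>c u)"
        using u x by (subst minus_scalar_prod_distrib[of _ n]) auto
      also have "\<dots> = 0" using nz by (simp add: c_def conjugate_scalar_prod_self)
      finally show "(x - c \<cdot>\<^sub>v u) \<bullet>c w = 0" using u x by (simp add: w conjugate_smult_vec)
    qed
    then have "proj_norm x F = norm c * l2_norm u" by (simp add: proj_norm_def l2_norm_smult)
    also have "norm c = norm (x \<bullet>c u) / (l2_norm u)\<^sup>2"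
      by (simp add: c_def norm_divide conjugate_scalar_prod_self norm_power)
    also have "\<dots> * l2_norm u = norm (x \<bullet>c u) / l2_norm u" using nz by (simp add: power2_eq_square)
    finally show ?thesis by (simp add: F_def)
  next
    case False
    \<comment> \<open>A nonzero kernel vector is a multiple of u and would put u itself into the
      kernel; so the kernel is {0} and the projection vanishes.\<close>
    have F0: "w = 0\<^sub>v n" if w: "w \<in> F" for w
    proof -
      define c where "c = (w \<bullet>c u) * of_real ((l2_norm v)\<^sup>2)"
      have wc: "w = c \<cdot>\<^sub>v u" using w F_iff[of w] by (simp add: c_def)
      have "u = 0\<^sub>v n" if c0: "c \<noteq> 0"
      proof -
        have uw: "u = (1 / c) \<cdot>\<^sub>v w" unfolding wc using c0 u by (simp add: smult_smult_assoc)
        have wc': "w \<in> carrier_vec n" using w sub by auto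
        have "(u \<bullet>c u) * of_real ((l2_norm v)\<^sup>2) = (1 / c) * ((w \<bullet>c u) * of_real ((l2_norm v)\<^sup>2))"
          by (subst uw, subst smult_scalar_prod_distrib[of _ n]) (use u wc' in auto)
        also have "\<dots> = 1" using c0 by (simp add: c_def)
        finally have "u \<in> F" using F_iff[of u] u by simp
        then show ?thesis using False by blast
      qed
      then show ?thesis using wc u by (cases "c = 0") auto
    qed
    have z: "0\<^sub>v n \<in> F" using u by (auto simp: F_iff)
    have "orth_proj F x = 0\<^sub>v n"
    proof (rule orth_proj_eqI[OF sub _ x z])
      fix y w assume "y \<in> F" "w \<in> F"
      then show "y - w \<in> F" using F0[of y] F0[of w] z by simp
    next
      fix w assume "w \<in> F"
      then show "(x - 0\<^sub>v n) \<bullet>c w = 0" using F0[of w] x by simp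
    qed
    then have "proj_norm x F = 0" by (simp add: proj_norm_def l2_norm_def)
    then show ?thesis by (simp add: F_def)
  qed
qed

lemma proj_norm_nonneg [simp]: "0 \<le> proj_norm x F"
  by (simp add: proj_norm_def)

section \<open>Embedding the scalar field into the complex numbers\<close>

lemma conjugate_imaginary_unit:
  assumes "i * i = (- 1 :: 'k::real_or_complex)"
  shows "conjugate i = - i" and "norm i = 1"
proof -
  have "norm i * norm i = 1" using assms by (metis norm_minus_cancel norm_mult norm_one)
  then show n: "norm i = 1" by (metis abs_of_nonneg abs_square_eq_1 norm_ge_zero power2_eq_square)
  have "i \<noteq> 0" using n by auto
  moreover have "i * conjugate i = i * (- i)" using mult_conjugate_eq[of i] n assms by simp
  ultimately show "conjugate i = - i" by (metis mult_left_cancel)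
qed

definition field_embedding :: "('k::real_or_complex \<Rightarrow> complex) \<Rightarrow> bool" where
  "field_embedding f \<longleftrightarrow> (\<forall>x y. f (x + y) = f x + f y) \<and> (\<forall>x y. f (x * y) = f x * f y) \<and>
     (\<forall>r. f (of_real r) = of_real r) \<and> (\<forall>x. f (conjugate x) = cnj (f x)) \<and> (\<forall>x. cmod (f x) = norm x)"

text \<open>If all scalars are real multiples of 1, the real coefficient is the embedding. Otherwise
  the map b from complex numbers to a real combination of 1 and i preserves sums, products,
  conjugation and norm; it is injective because it preserves the norm, and its inverse f inherits
  these properties.\<close>

lemma field_embedding_exists: "\<exists>f :: 'k::real_or_complex \<Rightarrow> complex. field_embedding f"
  using real_or_complex[where ?'a = 'k]
proof (elim disjE exE conjE)
  assume "\<forall>x::'k. \<exists>r. x = r *\<^sub>R 1"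
  then obtain R where R: "\<And>x::'k. x = of_real (R x)" by (metis of_real_def)
  have uniq: "R (of_real r) = r" for r using R[of "of_real r"] by (metis of_real_eq_iff)
  have "R (x + y) = R x + R y" for x y using uniq[of "R x + R y"] R[of x] R[of y] by (metis of_real_add)
  moreover have "R (x * y) = R x * R y" for x y using uniq[of "R x * R y"] R[of x] R[of y] by (metis of_real_mult)
  moreover have "R (conjugate x) = R x" for x using R[of x] by (metis conjugate_of_real)
  moreover have "norm x = \<bar>R x\<bar>" for x using R[of x] by (metis norm_of_real)
  ultimately have "field_embedding (\<lambda>x::'k. of_real (R x))" by (simp add: field_embedding_def uniq)
  then show ?thesis by blast
next
  fix i :: 'k assume i: "i * i = - 1" and ex: "\<forall>x. \<exists>r s. x = r *\<^sub>R 1 + s *\<^sub>R i"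
  have "\<forall>x. \<exists>z. x = of_real (Re z) + of_real (Im z) * i"
  proof
    fix x from ex obtain r s where "x = r *\<^sub>R 1 + s *\<^sub>R i" by blast
    then show "\<exists>z. x = of_real (Re z) + of_real (Im z) * i"
      by (intro exI[of _ "Complex r s"]) (simp add: scaleR_conv_of_real)
  qed
  then obtain f where f: "\<And>x. x = of_real (Re (f x)) + of_real (Im (f x)) * i" by metis
  define b where "b = (\<lambda>z. of_real (Re z) + of_real (Im z) * i)"
  have bf: "b (f x) = x" for x using f[of x] by (simp add: b_def)
  note ci = conjugate_imaginary_unit[OF i]
  have b_add: "b (z + w) = b z + b w" for z w by (simp add: b_def algebra_simps)
  have b_mult: "b (z * w) = b z * b w" for z w
  proof -
    have "b z * b w = of_real (Re z) * of_real (Re w) + (of_real (Re z) * of_real (Im w) + of_real (Im z) * of_real (Re w)) * i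
        + of_real (Im z) * of_real (Im w) * (i * i)" by (simp add: b_def algebra_simps)
    also have "\<dots> = b (z * w)" by (simp add: b_def i algebra_simps)
    finally show ?thesis by simp
  qed
  have b_cnj: "b (cnj z) = conjugate (b z)" for z by (simp add: b_def conjugate_dist_add conjugate_dist_mul ci)
  have b_norm: "norm (b z) = cmod z" for z
  proof -
    have "of_real ((norm (b z))\<^sup>2) = b z * b (cnj z)" unfolding b_cnj mult_conjugate_eq by (simp add: of_real_def)
    also have "\<dots> = b (z * cnj z)" by (simp add: b_mult)
    also have "\<dots> = of_real ((cmod z)\<^sup>2)" unfolding complex_norm_square[symmetric] by (simp add: b_def del: of_real_power)
    finally have "(norm (b z))\<^sup>2 = (cmod z)\<^sup>2" by (simp only: of_real_eq_iff)
    then show ?thesis by simp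
  qed
  have b_inj: "z = w" if "b z = b w" for z w
  proof -
    have "b (z - w) = 0" using b_add[of "z - w" w] that by simp
    then have "cmod (z - w) = 0" using b_norm[of "z - w"] by simp
    then show ?thesis by simp
  qed
  have "f (x + y) = f x + f y" "f (x * y) = f x * f y" "f (conjugate x) = cnj (f x)" "cmod (f x) = norm x" for x y
    by (auto intro!: b_inj simp: b_add b_mult b_cnj bf b_norm[symmetric])
  moreover have "f (of_real r) = of_real r" for r by (rule b_inj) (simp add: bf, simp add: b_def)
  ultimately show ?thesis unfolding field_embedding_def by blast
qed

text \<open>One fixed embedding, through which the matrix analysis done over the complex numbers is
  applied to both scalar fields.\<close>

definition embed :: "'k::real_or_complex \<Rightarrow> complex" where
  "embed = (SOME f. field_embedding f)"

lemma embed_simps [simp]: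
  "embed (x + y) = embed x + embed y" "embed (x * y) = embed x * embed y"
  "embed (of_real r) = of_real r" "embed (conjugate x) = cnj (embed x)" "cmod (embed x) = norm x"
  using someI_ex[OF field_embedding_exists] unfolding embed_def field_embedding_def by blast+

lemma embed_0_1 [simp]: "embed 0 = 0" "embed 1 = 1"
  using embed_simps(3)[of 0] embed_simps(3)[of 1] by simp_all

interpretation embed: field_hom "embed :: 'k::real_or_complex \<Rightarrow> complex"
  by unfold_locales simp_all

lemma bounded_linear_embed: "bounded_linear embed"
  by (rule bounded_linear_intro[where K = 1]) (simp_all add: scaleR_conv_of_real)

lemma measurable_embed [measurable]: "embed \<in> borel_measurable borel"
  by (intro borel_measurable_continuous_onI linear_continuous_on bounded_linear_embed)

interpretation embed_poly: map_poly_inj_idom_hom "embed :: 'k::real_or_complex \<Rightarrow> complex" ..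

lemma mat_adjoint_map_embed: "mat_adjoint (map_mat embed A) = map_mat embed (mat_adjoint A)"
  by (rule eq_matI) (auto simp: mat_adjoint_def mat_of_rows_def)

text \<open>Over the complex numbers the characteristic polynomial of A^* A splits with real roots.
  That factorization is the image of one over the given field, and \<open>embed\<close> is injective
  on polynomials, so both fields see the same roots with multiplicity.\<close>

lemma singular_values_map_embed:
  fixes A :: "'k::real_or_complex mat"
  assumes A: "A \<in> carrier_mat n n"
  shows "singular_values (map_mat embed A) = singular_values A"
proof -
  have Ac: "map_mat embed A \<in> carrier_mat n n" and Aa: "mat_adjoint A \<in> carrier_mat n n" 
    using A by (auto simp: mat_adjoint_def)
  obtain w s where ws: "right_singular_basis n (map_mat embed A) w s"
    by (rule right_singular_basis_exists)
  define l where "l = (\<lambda>k. - (s k)\<^sup>2)"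
  have "map_poly embed (char_poly (mat_adjoint A * A)) = char_poly (map_mat embed (mat_adjoint A * A))"
    by (rule embed.char_poly_hom[symmetric]) (use A Aa in auto)
  also have "map_mat embed (mat_adjoint A * A) = mat_adjoint (map_mat embed A) * map_mat embed A"
    using embed.mat_hom_mult[OF Aa A] by (simp add: mat_adjoint_map_embed)
  also have "char_poly \<dots> = (\<Prod>k\<leftarrow>[0..<n]. [:- complex_of_real ((s k)\<^sup>2), 1:])"
    by (rule char_poly_adjoint_mult[OF Ac ws])
  also have "\<dots> = map_poly embed (\<Prod>k\<leftarrow>[0..<n]. [:- of_real ((s k)\<^sup>2), 1:])"
    unfolding embed_poly.hom_prod_list map_map o_def
    by (intro arg_cong[where f = prod_list] map_cong refl) (simp add: embed.hom_uminus del: of_real_power)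
  finally have k: "char_poly (mat_adjoint A * A) = (\<Prod>k\<leftarrow>[0..<n]. [:- of_real ((s k)\<^sup>2), 1:])"
    by (rule embed_poly.injectivity)
  show ?thesis
    unfolding singular_values_def k char_poly_adjoint_mult[OF Ac ws] proots_linear_factors
    by (simp add: multiset.map_comp o_def del: of_real_power)
qed

lemma singular_value_measure_map_embed:
  "A \<in> carrier_mat n n \<Longrightarrow> singular_value_measure (map_mat embed A) = singular_value_measure A"
  by (simp add: singular_value_measure_def singular_values_map_embed)

lemma smallest_singular_value_map_embed:
  "A \<in> carrier_mat n n \<Longrightarrow> smallest_singular_value (map_mat embed A) = smallest_singular_value A"
  by (simp add: smallest_singular_value_def singular_values_map_embed)

text \<open>The constant depends on \<nu> alone and not on N, as the summability in n requires. The
  fourth moment of |h|^2 - 1 uses the eighth moment of \<nu>.\<close>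

lemma standardized_family_embed:
  fixes Y :: "nat \<Rightarrow> 'w \<Rightarrow> 'k::real_or_complex"
  assumes M: "prob_space M" and ind: "prob_space.indep_vars M (\<lambda>_. borel) Y {..<N}"
    and law: "\<And>i. i < N \<Longrightarrow> distr M borel (Y i) = \<nu>" and \<nu>: "prob_space \<nu>" and sets: "sets \<nu> = sets borel"
    and mean: "integrable \<nu> (\<lambda>x. x)" "(\<integral>x. x \<partial>\<nu>) = 0"
    and var: "(\<integral>x. (norm x)\<^sup>2 \<partial>\<nu>) = 1"
    and moments: "\<And>p. integrable \<nu> (\<lambda>x. norm x ^ p)"
  shows "standardized_family M (\<lambda>i \<omega>. embed (Y i \<omega>)) N
    (E4 \<nu> embed + E4 \<nu> (\<lambda>x. of_real ((cmod (embed x))\<^sup>2) - 1))"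
proof -
  interpret prob_space M by (rule M)
  interpret \<nu>: prob_space \<nu> by (rule \<nu>)
  have meas: "Y i \<in> borel_measurable M" if "i < N" for i
    using ind that by (auto simp: indep_vars_def)
  have \<nu>_borel: "f \<in> borel_measurable \<nu> \<longleftrightarrow> f \<in> borel_measurable borel" for f :: "'k \<Rightarrow> complex"
    by (simp add: measurable_cong_sets[OF sets refl])
  have int: "integrable M (\<lambda>\<omega>. f (Y i \<omega>)) \<longleftrightarrow> integrable \<nu> f"
    and eq: "(\<integral>\<omega>. f (Y i \<omega>) \<partial>M) = (\<integral>x. f x \<partial>\<nu>)"
    if "i < N" "f \<in> borel_measurable borel" for i and f :: "'k \<Rightarrow> 'b::{banach, second_countable_topology}"
    using integrable_distr_eq[OF meas[OF that(1)] that(2)] integral_distr[OF meas[OF that(1)] that(2)] law[OF that(1)]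
    by auto
  have i1: "integrable \<nu> embed" by (rule integrable_bounded_linear[OF bounded_linear_embed mean(1)])
  have i2: "(\<integral>x. embed x \<partial>\<nu>) = 0"
    using integral_bounded_linear[OF bounded_linear_embed mean(1)] mean(2) by simp
  have i3: "integrable \<nu> (\<lambda>x. (cmod (embed x))\<^sup>2)" using moments[of 2] by simp
  have L: "L4 \<nu> embed" using moments[of 4] by (simp add: L4_def \<nu>_borel measurable_embed)
  have L2: "L4 \<nu> (\<lambda>x. of_real ((cmod (embed x))\<^sup>2) - 1)"
  proof -
    have "(\<lambda>x::'k. complex_of_real ((cmod (embed x))\<^sup>2)) \<in> borel_measurable borel" by measurable
    moreover have "cmod (of_real ((cmod (embed x))\<^sup>2)) ^ 4 = norm x ^ 8" for x :: 'k
      by (simp add: norm_power flip: power_mult)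
    ultimately have "L4 \<nu> (\<lambda>x. of_real ((cmod (embed x))\<^sup>2))"
      unfolding L4_def \<nu>_borel using moments[of 8] by presburger
    from L4_add[OF this \<nu>.L4_const[of "- 1"]] show ?thesis by simp
  qed
  have E: "E4 M (\<lambda>\<omega>. f (Y i \<omega>)) = E4 \<nu> f" and LL: "L4 \<nu> f \<Longrightarrow> L4 M (\<lambda>\<omega>. f (Y i \<omega>))"
    if i: "i < N" and f [measurable]: "f \<in> borel_measurable borel" for f i
  proof -
    have f4: "(\<lambda>x. cmod (f x) ^ 4) \<in> borel_measurable borel" by measurable
    show "E4 M (\<lambda>\<omega>. f (Y i \<omega>)) = E4 \<nu> f" unfolding E4_def by (rule eq[OF i f4])
    have "(\<lambda>\<omega>. f (Y i \<omega>)) \<in> borel_measurable M" by (rule measurable_compose[OF meas[OF i] f])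
    then show "L4 M (\<lambda>\<omega>. f (Y i \<omega>))" if "L4 \<nu> f"
      using that int[OF i f4] unfolding L4_def by blast
  qed
  have sq: "(\<lambda>x::'k. (cmod (embed x))\<^sup>2) \<in> borel_measurable borel" by measurable
  have sq1: "(\<lambda>x::'k. of_real ((cmod (embed x))\<^sup>2) - (1::complex)) \<in> borel_measurable borel" by measurable
  show ?thesis
  proof (unfold_locales, goal_cases)
    case 1
    show ?case by (rule indep_vars_compose2[OF ind]) (rule measurable_embed)
  next
    case (2 i)
    show ?case using int[OF 2 measurable_embed] i1 by blast
  next
    case (3 i)
    show ?case using eq[OF 3 measurable_embed] i2 by (rule trans)
  next
    case (4 i)
    show ?case using int[OF 4 sq] i3 by blast
  next
    case (5 i)
    show ?case using eq[OF 5 sq] var unfolding embed_simps by (rule trans)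
  next
    case (6 i)
    show ?case by (rule LL[OF 6 measurable_embed L])
  next
    case (7 i)
    show ?case unfolding E[OF 7 measurable_embed] using E4_nonneg[of \<nu>] by simp
  next
    case (8 i)
    show ?case by (rule LL[OF 8 sq1 L2])
  next
    case (9 i)
    show ?case unfolding E[OF 9 sq1] using E4_nonneg[of \<nu> embed] by simp
  qed
qed

section \<open>Independence of finite blocks from generated sigma-algebras\<close>

lemma vimage_in_generated_sigma:
  fixes G :: "'i \<Rightarrow> 'w \<Rightarrow> 'a::topological_space" and h :: "'a \<Rightarrow> 'b::topological_space"
  assumes f: "\<And>i. i \<in> I \<Longrightarrow> f i \<in> J" and [measurable]: "h \<in> borel_measurable borel"
    and B: "B \<in> sets (PiM I (\<lambda>_. borel))"
  shows "(\<lambda>\<omega>. \<lambda>i\<in>I. h (G (f i) \<omega>)) -` B \<inter> space M \<in> generated_sigma M G J"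
proof -
  define E where "E = (\<Union>i\<in>J. {G i -` A \<inter> space M | A. A \<in> sets borel})"
  define S where "S = sigma (space M) E"
  have "E \<subseteq> Pow (space M)" by (auto simp: E_def)
  then have S: "space S = space M" "sets S = generated_sigma M G J"
    by (auto simp: S_def generated_sigma_def E_def)
  have "G j \<in> borel_measurable S" if "j \<in> J" for j
  proof (rule measurableI)
    fix A :: "'a set" assume "A \<in> sets borel"
    with that have "G j -` A \<inter> space M \<in> E" by (auto simp: E_def)
    then show "G j -` A \<inter> space S \<in> sets S"
      unfolding S generated_sigma_def E_def by (rule sigma_sets.Basic)
  qed simp
  then have "(\<lambda>\<omega>. h (G (f i) \<omega>)) \<in> borel_measurable S" if "i \<in> I" for i
    by (rule measurable_compose[OF _ assms(2)]) (use f[OF that] in blast)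
  then have "(\<lambda>\<omega>. \<lambda>i\<in>I. h (G (f i) \<omega>)) \<in> measurable S (PiM I (\<lambda>_. borel))"
    by (rule measurable_restrict)
  from measurable_sets[OF this B] show ?thesis by (simp add: S)
qed

text \<open>The finite blocks at a single n are functions of the two full families over all n; their
  preimages lie in the generated sigma-algebras, so independence is inherited.\<close>

lemma indep_maps_generated:
  fixes G :: "'i \<Rightarrow> 'w \<Rightarrow> 'a::topological_space" and X :: "'j \<Rightarrow> 'w \<Rightarrow> 'a"
    and h :: "'a \<Rightarrow> 'b::topological_space"
  assumes M: "prob_space M"
    and ind: "prob_space.indep_set M (generated_sigma M G J) (generated_sigma M X K)"
    and f: "\<And>i. i \<in> I \<Longrightarrow> f i \<in> J" and f': "\<And>i. i \<in> I' \<Longrightarrow> f' i \<in> K"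
    and h [measurable]: "h \<in> borel_measurable borel"
    and G: "\<And>i. i \<in> I \<Longrightarrow> G (f i) \<in> borel_measurable M" and X: "\<And>i. i \<in> I' \<Longrightarrow> X (f' i) \<in> borel_measurable M"
  shows "indep_maps M (PiM I' (\<lambda>_. borel)) (\<lambda>\<omega>. \<lambda>i\<in>I'. h (X (f' i) \<omega>))
    (PiM I (\<lambda>_. borel)) (\<lambda>\<omega>. \<lambda>i\<in>I. h (G (f i) \<omega>))"
proof -
  interpret prob_space M by (rule M)
  have "prob ((\<lambda>\<omega>. \<lambda>i\<in>I'. h (X (f' i) \<omega>)) -` A \<inter> space M \<inter> ((\<lambda>\<omega>. \<lambda>i\<in>I. h (G (f i) \<omega>)) -` B \<inter> space M)) =
    prob ((\<lambda>\<omega>. \<lambda>i\<in>I'. h (X (f' i) \<omega>)) -` A \<inter> space M) * prob ((\<lambda>\<omega>. \<lambda>i\<in>I. h (G (f i) \<omega>)) -` B \<inter> space M)"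
    if "A \<in> sets (PiM I' (\<lambda>_. borel))" "B \<in> sets (PiM I (\<lambda>_. borel))" for A B
  proof -
    have "(\<lambda>\<omega>. \<lambda>i\<in>I. h (G (f i) \<omega>)) -` B \<inter> space M \<in> generated_sigma M G J"
      by (rule vimage_in_generated_sigma[OF f h that(2)])
    moreover have "(\<lambda>\<omega>. \<lambda>i\<in>I'. h (X (f' i) \<omega>)) -` A \<inter> space M \<in> generated_sigma M X K"
      by (rule vimage_in_generated_sigma[OF f' h that(1)])
    ultimately show ?thesis by (subst Int_commute, subst mult.commute) (rule indep_setD[OF ind])
  qed
  moreover have "(\<lambda>\<omega>. \<lambda>i\<in>I'. h (X (f' i) \<omega>)) \<in> measurable M (PiM I' (\<lambda>_. borel))"
    by (rule measurable_restrict) (use X in measurable)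
  moreover have "(\<lambda>\<omega>. \<lambda>i\<in>I. h (G (f i) \<omega>)) \<in> measurable M (PiM I (\<lambda>_. borel))"
    by (rule measurable_restrict) (use G in measurable)
  ultimately show ?thesis unfolding indep_maps_def by blast
qed

section \<open>Norms of the random vectors and transfer to the given field\<close>

lemma eventually_det_nonzero:
  assumes A: "\<And>n. A n \<in> carrier_mat n n" and lim: "(\<lambda>n. smallest_singular_value (A n :: complex mat)) \<longlonglongrightarrow> a" and a: "a > 0"
  shows "eventually (\<lambda>n. n \<ge> 1 \<and> det (A n) \<noteq> 0) sequentially"
proof -
  have "eventually (\<lambda>n. smallest_singular_value (A n) > 0) sequentially"
    using order_tendstoD(1)[OF lim a] .
  with eventually_ge_at_top[of 1] show ?thesis
  proof eventually_elim
    case (elim n)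
    obtain w s where b: "right_singular_basis n (A n) w s" by (rule right_singular_basis_exists)
    have "0 < s l" if "l < n" for l
      using smallest_singular_value_le[OF A b that] elim(2) by linarith
    then show ?case using det_nonzero_iff_singular_values_pos[OF A b] elim(1) by blast
  qed
qed

text \<open>At exponent 0 the coefficient block is the identity, so the concentration of forms
  contains the law of large numbers for the squared norms of the two random vectors.\<close>

lemma centered_form_0:
  assumes A: "A \<in> carrier_mat n n" and det: "det A \<noteq> 0"
  shows "centered_form (2 * n) (uu_coeff 0 n A) g = of_real ((\<Sum>i<n. (cmod (g i))\<^sup>2) - real n)"
    and "centered_form (2 * n) (vv_coeff 0 n A) g = of_real ((\<Sum>i<n. (cmod (g (n + i)))\<^sup>2) - real n)"
proof -
  obtain w z s where d: "svd n A w z s" by (rule svd_of_det[OF A det])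
  then have o: "orthonormal n n w" "orthonormal n n z" by (simp_all add: svd_def)
  show "centered_form (2 * n) (uu_coeff 0 n A) g = of_real ((\<Sum>i<n. (cmod (g i))\<^sup>2) - real n)"
    unfolding centered_form_uu[OF A det d] power_0 mult_1 coord_norm[OF o(2)] by simp
  show "centered_form (2 * n) (vv_coeff 0 n A) g = of_real ((\<Sum>i<n. (cmod (g (n + i)))\<^sup>2) - real n)"
    unfolding centered_form_vv[OF A det d] power_0 mult_1 coord_norm[OF o(1)] by simp
qed

lemma tendsto_1_of_centered:
  assumes "(\<lambda>n. c n / of_nat n) \<longlonglongrightarrow> (0 :: complex)"
    and "eventually (\<lambda>n. n \<ge> 1 \<and> c n = of_real (q n - real n)) sequentially"
  shows "(\<lambda>n. q n / real n) \<longlonglongrightarrow> 1"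
proof -
  have "eventually (\<lambda>n. c n / of_nat n = of_real (q n / real n - 1)) sequentially"
    using assms(2) by eventually_elim (simp add: field_simps)
  then have "(\<lambda>n. complex_of_real (q n / real n - 1)) \<longlonglongrightarrow> of_real 0"
    using assms(1) by (simp add: tendsto_cong)
  then have "(\<lambda>n. q n / real n - 1) \<longlonglongrightarrow> 0" by (simp only: tendsto_of_real_iff)
  from tendsto_add[OF this tendsto_const[of 1]] show ?thesis by simp
qed

text \<open>Both models multiply the Gaussian-like vector by a real scalar; isolating it lets them
  be treated together.\<close>

definition model_scale :: "perturbation_model \<Rightarrow> 'k::real_or_complex vec \<Rightarrow> real" where
  "model_scale p g = (case p of IID \<Rightarrow> 1 / sqrt (real (dim_vec g)) | Orthonormalized \<Rightarrow> 1 / l2_norm g)"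

lemma model_vec_scale: "model_vec p g = of_real (model_scale p g) \<cdot>\<^sub>v g"
  by (cases p) (simp_all add: model_scale_def)

lemma model_scale_tendsto:
  fixes g :: "nat \<Rightarrow> 'k::real_or_complex vec"
  assumes g: "\<And>n. g n \<in> carrier_vec n" and lim: "(\<lambda>n. (l2_norm (g n))\<^sup>2 / real n) \<longlonglongrightarrow> 1"
  shows "(\<lambda>n. real n * (model_scale p (g n))\<^sup>2) \<longlonglongrightarrow> 1" "(\<lambda>n. l2_norm (model_vec p (g n))) \<longlonglongrightarrow> 1"
proof -
  show s: "(\<lambda>n. real n * (model_scale p (g n))\<^sup>2) \<longlonglongrightarrow> 1"
  proof (cases p)
    case IID
    have "eventually (\<lambda>n. real n * (model_scale p (g n))\<^sup>2 = 1) sequentially"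
      using eventually_ge_at_top[of 1]
      by eventually_elim (simp add: IID model_scale_def power_divide carrier_vecD[OF g])
    then show ?thesis by (rule tendsto_eventually)
  next
    case Orthonormalized
    have "(\<lambda>n. inverse ((l2_norm (g n))\<^sup>2 / real n)) \<longlonglongrightarrow> inverse 1" by (rule tendsto_inverse[OF lim]) simp
    then show ?thesis by (simp add: Orthonormalized model_scale_def power_divide)
  qed
  have "(\<lambda>n. sqrt (real n * (model_scale p (g n))\<^sup>2 * ((l2_norm (g n))\<^sup>2 / real n))) \<longlonglongrightarrow> sqrt (1 * 1)"
    by (intro tendsto_intros s lim)
  moreover have "eventually (\<lambda>n. sqrt (real n * (model_scale p (g n))\<^sup>2 * ((l2_norm (g n))\<^sup>2 / real n)) = l2_norm (model_vec p (g n))) sequentially"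
    using eventually_ge_at_top[of 1]
  proof eventually_elim
    case (elim n)
    have "real n * (model_scale p (g n))\<^sup>2 * ((l2_norm (g n))\<^sup>2 / real n) = (l2_norm (model_vec p (g n)))\<^sup>2"
      using elim by (simp add: model_vec_scale l2_norm_smult power_mult_distrib)
    then show ?case by simp
  qed
  ultimately show "(\<lambda>n. l2_norm (model_vec p (g n))) \<longlonglongrightarrow> 1" by (simp add: tendsto_cong)
qed

lemma sum_cmod_embed: "x \<in> carrier_vec n \<Longrightarrow> (\<Sum>i<n. (cmod (embed (x $ i)))\<^sup>2) = (l2_norm x)\<^sup>2"
  by (simp add: l2_norm_def sum_nonneg)

lemma embed_scalar_prod:
  "y \<in> carrier_vec n \<Longrightarrow> embed (x \<bullet>c y) = (\<Sum>i<n. embed (x $ i) * cnj (embed (y $ i)))"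
  by (simp add: scalar_prod_def embed.hom_sum atLeast0LessThan)

lemma embed_mult_mat_vec:
  "A \<in> carrier_mat n m \<Longrightarrow> x \<in> carrier_vec m \<Longrightarrow> i < n \<Longrightarrow>
    embed ((A *\<^sub>v x) $ i) = (\<Sum>j<m. embed (A $$ (i, j)) * embed (x $ j))"
  by (simp add: scalar_prod_def embed.hom_sum atLeast0LessThan)

text \<open>The deterministic result \<open>alpha_beta_tendsto_0\<close> carried back along
  \<open>embed\<close>, which preserves singular values, inner products and norms. Dividing by the
  norms of u and v, which tend to 1, prepares the comparison with the projections.\<close>

lemma singular_vectors_delocalized:
  fixes X Xt :: "nat \<Rightarrow> 'k::real_or_complex mat" and gu gv u v ut vt :: "nat \<Rightarrow> 'k vec"
  assumes \<mu>: "compact_distribution \<mu> a"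
    and \<theta>: "\<theta> > 0" "ereal \<theta> \<le> lower_threshold \<mu>" and phi: "filterlim (deriv (phi \<mu>)) at_bot (at_left a)"
    and X: "\<And>n. X n \<in> carrier_mat n n" and g: "\<And>n. gu n \<in> carrier_vec n" "\<And>n. gv n \<in> carrier_vec n"
    and weak: "weak_conv_m (\<lambda>n. singular_value_measure (X n)) \<mu>"
    and smallest: "(\<lambda>n. smallest_singular_value (X n)) \<longlonglongrightarrow> a"
    and u: "\<And>n. u n = model_vec p (gu n)" and v: "\<And>n. v n = model_vec p (gv n)"
    and Xt: "\<And>n. Xt n = X n + of_real \<theta> \<cdot>\<^sub>m outer (u n) (v n)"
    and pair: "\<And>n. n \<ge> 1 \<Longrightarrow> singular_vector_pair (Xt n) (smallest_singular_value (Xt n)) (ut n) (vt n)"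
  defines "h \<equiv> \<lambda>n i. embed (if i < n then gu n $ i else gv n $ (i - n))"
  assumes uu: "\<And>k. (\<lambda>n. centered_form (2 * n) (uu_coeff k n (map_mat embed (X n))) (h n) / of_nat n) \<longlonglongrightarrow> 0"
    and vv: "\<And>k. (\<lambda>n. centered_form (2 * n) (vv_coeff k n (map_mat embed (X n))) (h n) / of_nat n) \<longlonglongrightarrow> 0"
    and uv: "\<And>k. (\<lambda>n. centered_form (2 * n) (uv_coeff k n (map_mat embed (X n))) (h n) / of_nat n) \<longlonglongrightarrow> 0"
  shows "(\<lambda>n. norm (ut n \<bullet>c u n) / l2_norm (u n)) \<longlonglongrightarrow> 0" "(\<lambda>n. norm (vt n \<bullet>c v n) / l2_norm (v n)) \<longlonglongrightarrow> 0"
proof -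
  let ?A = "\<lambda>n. map_mat embed (X n)"
  have A: "?A n \<in> carrier_mat n n" for n using X by simp
  have smallestA: "(\<lambda>n. smallest_singular_value (?A n)) \<longlonglongrightarrow> a"
    using smallest by (simp add: smallest_singular_value_map_embed[OF X])
  have weakA: "weak_conv_m (\<lambda>n. singular_value_measure (?A n)) \<mu>"
    using weak by (simp add: singular_value_measure_map_embed[OF X])
  note det = eventually_det_nonzero[OF A smallestA compact_distribution.a_pos[OF \<mu>]]
  have hs: "(\<Sum>i<n. (cmod (h n i))\<^sup>2) = (l2_norm (gu n))\<^sup>2" "(\<Sum>i<n. (cmod (h n (n + i)))\<^sup>2) = (l2_norm (gv n))\<^sup>2" for n
    unfolding h_def using sum_cmod_embed[OF g(1)] sum_cmod_embed[OF g(2)] by simp_all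
  have gu_lim: "(\<lambda>n. (l2_norm (gu n))\<^sup>2 / real n) \<longlonglongrightarrow> 1"
    by (rule tendsto_1_of_centered[OF uu[of 0]], use det in eventually_elim) (use centered_form_0(1)[OF A] hs(1) in metis)
  have gv_lim: "(\<lambda>n. (l2_norm (gv n))\<^sup>2 / real n) \<longlonglongrightarrow> 1"
    by (rule tendsto_1_of_centered[OF vv[of 0]], use det in eventually_elim) (use centered_form_0(2)[OF A] hs(2) in metis)
  note su = model_scale_tendsto[OF g(1) gu_lim, of p] and sv = model_scale_tendsto[OF g(2) gv_lim, of p]
  have uc: "u n \<in> carrier_vec n" and vc: "v n \<in> carrier_vec n" for n using g by (auto simp: u v model_vec_scale)
  have Xtc: "Xt n \<in> carrier_mat n n" for n unfolding Xt using X uc vc by auto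
  have Xtac: "mat_adjoint (Xt n) \<in> carrier_mat n n" for n using Xtc[of n] by (auto simp: mat_adjoint_def)
  have p: "ut n \<in> carrier_vec n" "vt n \<in> carrier_vec n" "l2_norm (ut n) = 1" "l2_norm (vt n) = 1"
    "Xt n *\<^sub>v vt n = of_real (smallest_singular_value (Xt n)) \<cdot>\<^sub>v ut n"
    "mat_adjoint (Xt n) *\<^sub>v ut n = of_real (smallest_singular_value (Xt n)) \<cdot>\<^sub>v vt n" if "n \<ge> 1" for n
    using pair[OF that] Xtc[of n] by (auto simp: singular_vector_pair_def)
  have right: "(\<Sum>j<n. embed (Xt n $$ (k, j)) * embed (vt n $ j)) = of_real (smallest_singular_value (Xt n)) * embed (ut n $ k)"
    if "n \<ge> 1" "k < n" for n k
    using embed_mult_mat_vec[OF Xtc p(2)[OF that(1)] that(2)] p(1)[OF that(1)] that by (simp add: p(5))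
  have left: "(\<Sum>k<n. cnj (embed (Xt n $$ (k, i))) * embed (ut n $ k)) = of_real (smallest_singular_value (Xt n)) * embed (vt n $ i)"
    if "n \<ge> 1" "i < n" for n i
  proof -
    have "embed (mat_adjoint (Xt n) $$ (i, k)) = cnj (embed (Xt n $$ (k, i)))" if "k < n" for k
      using that \<open>i < n\<close> Xtc[of n] by (simp add: mat_adjoint_def mat_of_rows_def)
    then show ?thesis
      using embed_mult_mat_vec[OF Xtac p(1)[OF that(1)] that(2)] p(2)[OF that(1)] that by (simp add: p(6))
  qed
  interpret perturbed_sequence \<mu> a ?A "\<lambda>n. map_mat embed (Xt n)" h "\<lambda>n i. embed (u n $ i)" "\<lambda>n i. embed (v n $ i)"
    "\<lambda>n i. embed (ut n $ i)" "\<lambda>n i. embed (vt n $ i)" "\<lambda>n. model_scale p (gu n)" "\<lambda>n. model_scale p (gv n)" \<theta>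
    "\<lambda>n. smallest_singular_value (Xt n)"
  proof (rule perturbed_sequence.intro[OF \<mu>], unfold_locales, goal_cases)
    case 1 show ?case by (rule \<theta>(1))
  next
    case 2 show ?case by (rule \<theta>(2))
  next
    case 3 show ?case by (rule phi)
  next
    case 4 show ?case by (rule A)
  next
    case 5 show ?case using Xtc by simp
  next
    case (6 n i j)
    then show ?case using X[of n] uc[of n] vc[of n] by (simp add: Xt outer_def carrier_vecD)
  next
    case 7 show ?case by (rule weakA)
  next
    case 8 show ?case by (rule smallestA)
  next
    case 9 show ?case by (simp add: smallest_singular_value_map_embed[OF Xtc])
  next
    case (10 n k) then show ?case using right[of n k] Xtc[of n] by simp
  next
    case (11 n i) then show ?case using left[of n i] Xtc[of n] by simp
  next
    case (12 n) then show ?case using sum_cmod_embed[OF p(1)] p(3) by simp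
  next
    case (13 n) then show ?case using sum_cmod_embed[OF p(2)] p(4) by simp
  next
    case (14 n i) then show ?case using g(1)[of n] by (simp add: u model_vec_scale h_def)
  next
    case (15 n i) then show ?case using g(2)[of n] by (simp add: v model_vec_scale h_def)
  next
    case 16 show ?case by (rule su(1))
  next
    case 17 show ?case by (rule sv(1))
  next
    case (18 k) show ?case by (rule uu)
  next
    case (19 k) show ?case by (rule vv)
  next
    case (20 k) show ?case by (rule uv)
  qed
  have "cmod (beta n) = norm (ut n \<bullet>c u n)" "cmod (alpha n) = norm (vt n \<bullet>c v n)" for n
    unfolding beta_def alpha_def embed_scalar_prod[OF uc, symmetric] embed_scalar_prod[OF vc, symmetric] by simp_all
  then have l: "(\<lambda>n. norm (ut n \<bullet>c u n)) \<longlonglongrightarrow> 0" "(\<lambda>n. norm (vt n \<bullet>c v n)) \<longlonglongrightarrow> 0"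
    using alpha_beta_tendsto_0 tendsto_norm_zero[of alpha] tendsto_norm_zero[of beta] by auto
  show "(\<lambda>n. norm (ut n \<bullet>c u n) / l2_norm (u n)) \<longlonglongrightarrow> 0"
    using tendsto_divide[OF l(1) su(2)] by (simp add: u)
  show "(\<lambda>n. norm (vt n \<bullet>c v n) / l2_norm (v n)) \<longlonglongrightarrow> 0"
    using tendsto_divide[OF l(2) sv(2)] by (simp add: v)
qed

section \<open>Reindexing of independent families and conclusion\<close>

lemma (in prob_space) indep_sets_reindex:
  assumes f: "inj_on f I" and ind: "indep_sets F (f ` I)"
  shows "indep_sets (\<lambda>i. F (f i)) I"
proof (rule indep_setsI)
  show "F (f i) \<subseteq> events" if "i \<in> I" for i using ind that by (auto simp: indep_sets_def)
  fix A J assume J: "J \<noteq> {}" "J \<subseteq> I" "finite J" and A: "\<forall>j\<in>J. A j \<in> F (f j)"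
  have inj: "inj_on f J" using f J(2) by (rule inj_on_subset)
  define B where "B = (\<lambda>k. A (inv_into J f k))"
  have B: "B (f j) = A j" if "j \<in> J" for j using that inj by (simp add: B_def)
  have "prob (\<Inter>k\<in>f ` J. B k) = (\<Prod>k\<in>f ` J. prob (B k))"
    by (rule indep_setsD[OF ind]) (use J A B in auto)
  also have "(\<Inter>k\<in>f ` J. B k) = (\<Inter>j\<in>J. A j)" using B by auto
  also have "(\<Prod>k\<in>f ` J. prob (B k)) = (\<Prod>j\<in>J. prob (A j))" using B by (simp add: prod.reindex[OF inj])
  finally show "prob (\<Inter>j\<in>J. A j) = (\<Prod>j\<in>J. prob (A j))" .
qed

lemma (in prob_space) indep_vars_reindex:
  "inj_on f I \<Longrightarrow> indep_vars M' X (f ` I) \<Longrightarrow> indep_vars (\<lambda>i. M' (f i)) (\<lambda>i. X (f i)) I"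
  unfolding indep_vars_def2 using indep_sets_reindex[of f I] by auto

theorem theorem2p15:
  fixes M :: "'w measure"
    and X P Xt :: "nat \<Rightarrow> 'w \<Rightarrow> 'k::real_or_complex mat"
    and Gu Gv u v ut vt :: "nat \<Rightarrow> 'w \<Rightarrow> 'k vec"
    and \<nu> :: "'k measure"
    and \<mu> :: "real measure"
    and \<theta> a :: real
    and model :: perturbation_model
  assumes M: "prob_space M"
    and X_dim: "\<And>n \<omega>. \<omega> \<in> space M \<Longrightarrow> X n \<omega> \<in> carrier_mat n n"
    and X_meas: "\<And>n i j. i < n \<Longrightarrow> j < n \<Longrightarrow> (\<lambda>\<omega>. X n \<omega> $$ (i, j)) \<in> borel_measurable M"
    and \<mu>: "real_distribution \<mu>"
    and \<mu>_compact: "compact (measure_support \<mu>)"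
    and X_conv: "AE \<omega> in M. weak_conv_m (\<lambda>n. singular_value_measure (X n \<omega>)) \<mu>"
    and a: "a = Inf (measure_support \<mu>)"
    and X_smallest: "AE \<omega> in M. (\<lambda>n. smallest_singular_value (X n \<omega>)) \<longlonglongrightarrow> a"
    and \<nu>: "prob_space \<nu>" "sets \<nu> = sets borel"
    and \<nu>_mean: "integrable \<nu> (\<lambda>x. x)" "(\<integral>x. x \<partial>\<nu>) = 0"
    and \<nu>_var: "integrable \<nu> (\<lambda>x. (norm x)\<^sup>2)" "(\<integral>x. (norm x)\<^sup>2 \<partial>\<nu>) = 1"
    and \<nu>_lsi: "log_sobolev \<nu>"
    and G_dim: "\<And>n \<omega>. \<omega> \<in> space M \<Longrightarrow> Gu n \<omega> \<in> carrier_vec n"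
      "\<And>n \<omega>. \<omega> \<in> space M \<Longrightarrow> Gv n \<omega> \<in> carrier_vec n"
    and G_law: "\<And>n i. i < n \<Longrightarrow> distr M borel (\<lambda>\<omega>. Gu n \<omega> $ i) = \<nu>"
      "\<And>n i. i < n \<Longrightarrow> distr M borel (\<lambda>\<omega>. Gv n \<omega> $ i) = \<nu>"
    and G_indep: "\<And>n. prob_space.indep_vars M (\<lambda>_. borel)
        (case_sum (\<lambda>i \<omega>. Gu n \<omega> $ i) (\<lambda>i \<omega>. Gv n \<omega> $ i)) ({..<n} <+> {..<n})"
    and G_X_indep: "prob_space.indep_set M
        (generated_sigma M
          (\<lambda>(n, k) \<omega>. case_sum (\<lambda>i. Gu n \<omega> $ i) (\<lambda>i. Gv n \<omega> $ i) k)
          (SIGMA n:UNIV. {..<n} <+> {..<n}))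
        (generated_sigma M (\<lambda>(n, i, j) \<omega>. X n \<omega> $$ (i, j))
          (SIGMA n:UNIV. {..<n} \<times> {..<n}))"
    and \<theta>: "\<theta> > 0"
    and u: "\<And>n \<omega>. u n \<omega> = model_vec model (Gu n \<omega>)"
    and v: "\<And>n \<omega>. v n \<omega> = model_vec model (Gv n \<omega>)"
    and P: "\<And>n \<omega>. P n \<omega> = of_real \<theta> \<cdot>\<^sub>m outer (u n \<omega>) (v n \<omega>)"
    and Xt: "\<And>n \<omega>. Xt n \<omega> = X n \<omega> + P n \<omega>"
    and sing_vecs: "\<And>n \<omega>. n \<ge> 1 \<Longrightarrow> \<omega> \<in> space M \<Longrightarrow>
        singular_vector_pair (Xt n \<omega>) (smallest_singular_value (Xt n \<omega>)) (ut n \<omega>) (vt n \<omega>)"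
    and a_pos: "a > 0"
    and \<theta>_le: "ereal \<theta> \<le> lower_threshold \<mu>"
    and phi_deriv: "filterlim (deriv (phi \<mu>)) at_bot (at_left a)"
  shows "(AE \<omega> in M. (\<lambda>n. proj_norm (ut n \<omega>)
           (mat_kernel (of_real (\<theta>\<^sup>2) \<cdot>\<^sub>m 1\<^sub>m n - P n \<omega> * mat_adjoint (P n \<omega>)))) \<longlonglongrightarrow> 0) \<and>
         (AE \<omega> in M. (\<lambda>n. proj_norm (vt n \<omega>)
           (mat_kernel (of_real (\<theta>\<^sup>2) \<cdot>\<^sub>m 1\<^sub>m n - mat_adjoint (P n \<omega>) * P n \<omega>))) \<longlonglongrightarrow> 0)"
proof -
  interpret prob_space M by (rule M)
  have distribution: "compact_distribution \<mu> a"
    by (intro compact_distribution.intro compact_distribution_axioms.intro \<mu> \<mu>_compact a a_pos)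
  \<comment> \<open>Position of the i-th coordinate of the concatenated vector in the disjoint sum
    that indexes the independent family.\<close>
  define pos where "pos = (\<lambda>n i. if i < n then Inl i else Inr (i - n :: nat))"
  define G where "G = (\<lambda>(n, k) \<omega>. case_sum (\<lambda>i. Gu n \<omega> $ i) (\<lambda>i. Gv n \<omega> $ i) k)"
  define Y where "Y = (\<lambda>n i. G (n, pos n i))"
  define XX where "XX = (\<lambda>n \<omega>. mat n n (\<lambda>ij. embed (X n \<omega> $$ ij)))"
  have Y: "Y n i \<omega> = (if i < n then Gu n \<omega> $ i else Gv n \<omega> $ (i - n))" for n i \<omega>
    by (simp add: Y_def G_def pos_def)
  have pos: "inj_on (pos n) {..<2 * n}" "pos n ` {..<2 * n} = {..<n} <+> {..<n}" for n
  proof -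
    show "inj_on (pos n) {..<2 * n}" by (auto simp: inj_on_def pos_def split: if_splits)
    have "Inr i \<in> pos n ` {..<2 * n}" if "i < n" for i
      using that by (intro image_eqI[of _ _ "n + i"]) (auto simp: pos_def)
    moreover have "Inl i \<in> pos n ` {..<2 * n}" if "i < n" for i
      using that by (intro image_eqI[of _ _ i]) (auto simp: pos_def)
    ultimately show "pos n ` {..<2 * n} = {..<n} <+> {..<n}" by (fastforce simp: pos_def)
  qed
  have Y_indep: "indep_vars (\<lambda>_. borel) (Y n) {..<2 * n}" for n
  proof -
    have "indep_vars (\<lambda>_. borel)
        (\<lambda>i. case_sum (\<lambda>i \<omega>. Gu n \<omega> $ i) (\<lambda>i \<omega>. Gv n \<omega> $ i) (pos n i)) {..<2 * n}"
      by (rule indep_vars_reindex[OF pos(1)]) (simp only: pos(2) G_indep)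
    moreover have "(\<lambda>i. case_sum (\<lambda>i \<omega>. Gu n \<omega> $ i) (\<lambda>i \<omega>. Gv n \<omega> $ i) (pos n i)) = Y n"
      by (auto simp: fun_eq_iff Y pos_def)
    ultimately show ?thesis by simp
  qed
  have Y_law: "distr M borel (Y n i) = \<nu>" if "i < 2 * n" for n i
  proof (cases "i < n")
    case True
    then have "Y n i = (\<lambda>\<omega>. Gu n \<omega> $ i)" by (simp add: fun_eq_iff Y)
    then show ?thesis using G_law(1)[OF True] by simp
  next
    case False
    then have "Y n i = (\<lambda>\<omega>. Gv n \<omega> $ (i - n))" by (simp add: fun_eq_iff Y)
    then show ?thesis using G_law(2)[of "i - n" n] False that by simp
  qed
  have Y_meas: "Y n i \<in> borel_measurable M" if "i < 2 * n" for n i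
    using Y_indep[of n] that by (auto simp: indep_vars_def)
  have family: "standardized_family M (\<lambda>i \<omega>. embed (Y n i \<omega>)) (2 * n)
      (E4 \<nu> embed + E4 \<nu> (\<lambda>x. of_real ((cmod (embed x))\<^sup>2) - 1))" for n
    by (rule standardized_family_embed[OF M Y_indep Y_law \<nu> \<nu>_mean \<nu>_var(2)
          log_sobolev_integrable_norm_power[OF \<nu> \<nu>_lsi]])
  have independent: "indep_maps M (PiM ({..<n} \<times> {..<n}) (\<lambda>_. borel)) (\<lambda>\<omega>. \<lambda>ij\<in>{..<n} \<times> {..<n}. XX n \<omega> $$ ij)
      (PiM {..<2 * n} (\<lambda>_. borel)) (\<lambda>\<omega>. \<lambda>i\<in>{..<2 * n}. embed (Y n i \<omega>))" for n
  proof -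
    have "indep_maps M (PiM ({..<n} \<times> {..<n}) (\<lambda>_. borel))
        (\<lambda>\<omega>. \<lambda>ij\<in>{..<n} \<times> {..<n}. embed ((\<lambda>(n, i, j) \<omega>. X n \<omega> $$ (i, j)) (n, ij) \<omega>))
        (PiM {..<2 * n} (\<lambda>_. borel)) (\<lambda>\<omega>. \<lambda>i\<in>{..<2 * n}. embed (G (n, pos n i) \<omega>))"
    proof (rule indep_maps_generated[OF M G_X_indep[folded G_def]])
      show "(n, pos n i) \<in> (SIGMA n:UNIV. {..<n} <+> {..<n})" if "i \<in> {..<2 * n}" for i
        using that pos(2)[of n] by blast
      show "G (n, pos n i) \<in> borel_measurable M" if "i \<in> {..<2 * n}" for i
        using Y_meas[of i n] that by (simp add: Y_def)
    qed (use X_meas in auto)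
    moreover have "(\<lambda>ij\<in>{..<n} \<times> {..<n}. embed ((\<lambda>(n, i, j) \<omega>. X n \<omega> $$ (i, j)) (n, ij) \<omega>))
        = (\<lambda>ij\<in>{..<n} \<times> {..<n}. XX n \<omega> $$ ij)" for \<omega>
      by (rule restrict_ext) (auto simp: XX_def)
    ultimately show ?thesis by (simp only: Y_def)
  qed
  have XX: "XX n \<omega> = map_mat embed (X n \<omega>)" if "\<omega> \<in> space M" for n \<omega>
    using X_dim[OF that, of n] by (intro eq_matI) (auto simp: XX_def)
  have XX_carrier: "XX n \<omega> \<in> carrier_mat n n" for n \<omega> by (simp add: XX_def)
  note centered = AE_centered_form_tendsto_0[OF XX_carrier family independent]
  \<comment> \<open>There are countably many exponents k, so for each kind of form one null set
    serves all of them.\<close>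
  have "AE \<omega> in M. \<forall>k. (\<lambda>n. centered_form (2 * n) (uu_coeff k n (XX n \<omega>)) (\<lambda>i. embed (Y n i \<omega>)) / of_nat n) \<longlonglongrightarrow> 0"
    "AE \<omega> in M. \<forall>k. (\<lambda>n. centered_form (2 * n) (vv_coeff k n (XX n \<omega>)) (\<lambda>i. embed (Y n i \<omega>)) / of_nat n) \<longlonglongrightarrow> 0"
    "AE \<omega> in M. \<forall>k. (\<lambda>n. centered_form (2 * n) (uv_coeff k n (XX n \<omega>)) (\<lambda>i. embed (Y n i \<omega>)) / of_nat n) \<longlonglongrightarrow> 0"
    unfolding AE_all_countable
    by (intro allI centered admissible_uu admissible_vv admissible_uv)+
  then have "AE \<omega> in M. (\<lambda>n. proj_norm (ut n \<omega>)
           (mat_kernel (of_real (\<theta>\<^sup>2) \<cdot>\<^sub>m 1\<^sub>m n - P n \<omega> * mat_adjoint (P n \<omega>)))) \<longlonglongrightarrow> 0 \<and>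
         (\<lambda>n. proj_norm (vt n \<omega>)
           (mat_kernel (of_real (\<theta>\<^sup>2) \<cdot>\<^sub>m 1\<^sub>m n - mat_adjoint (P n \<omega>) * P n \<omega>))) \<longlonglongrightarrow> 0"
    using X_conv X_smallest AE_space
  proof eventually_elim
    case (elim \<omega>)
    have carrier: "X n \<omega> \<in> carrier_mat n n" "Gu n \<omega> \<in> carrier_vec n" "Gv n \<omega> \<in> carrier_vec n"
      "u n \<omega> \<in> carrier_vec n" "v n \<omega> \<in> carrier_vec n" "Xt n \<omega> \<in> carrier_mat n n" for n
      using X_dim[OF elim(6)] G_dim[OF elim(6)]
      by (auto simp: u v Xt P model_vec_scale intro!: add_carrier_mat smult_carrier_mat outer_carrier)
    note forms = elim(1-3)[unfolded XX[OF elim(6)] Y, rule_format]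
    note lim = singular_vectors_delocalized[OF distribution \<theta> \<theta>_le phi_deriv carrier(1-3) elim(4,5) u v
        Xt[unfolded P] sing_vecs[OF _ elim(6)] forms]
    have vectors: "ut n \<omega> \<in> carrier_vec n" "vt n \<omega> \<in> carrier_vec n" if "n \<ge> 1" for n
      using sing_vecs[OF that elim(6)] carrier(6)[of n] by (auto simp: singular_vector_pair_def)
    have "(\<lambda>n. proj_norm (ut n \<omega>) (mat_kernel (of_real (\<theta>\<^sup>2) \<cdot>\<^sub>m 1\<^sub>m n - P n \<omega> * mat_adjoint (P n \<omega>)))) \<longlonglongrightarrow> 0"
    \<comment> \<open>The comparison starts at n = 1, since there is no unit vector in dimension
      0.\<close>
    proof (rule Lim_null_comparison[OF _ lim(1)], use eventually_ge_at_top[of 1] in eventually_elim)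
      case (elim n)
      show ?case
        using proj_norm_rank_one_kernel_le[OF carrier(4,5) \<theta> vectors(1)[OF elim]] by (simp add: P)
    qed
    \<comment> \<open>The adjoint of P is \<theta> v u^*, so this is the same kernel bound with u
      and v exchanged.\<close>
    moreover have "(\<lambda>n. proj_norm (vt n \<omega>) (mat_kernel (of_real (\<theta>\<^sup>2) \<cdot>\<^sub>m 1\<^sub>m n - mat_adjoint (P n \<omega>) * P n \<omega>))) \<longlonglongrightarrow> 0"
    proof (rule Lim_null_comparison[OF _ lim(2)], use eventually_ge_at_top[of 1] in eventually_elim)
      case (elim n)
      show ?case
        using proj_norm_rank_one_kernel_le[OF carrier(5,4) \<theta> vectors(2)[OF elim]]
        by (simp add: P mat_adjoint_smult_outer)
    qed
    ultimately show ?case ..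
  qed
  then show ?thesis by (simp only: AE_conj_iff)
qed

end
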